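(* Let $(X,d_X,\mathfrak m)$ be a complete separable metric space with a non-negative, non-zero Radon measure finite on bounded sets, and let $(Y,d_Y)$ be a complete metric space. Let $u\in S^2(X,Y)$, put $\mu:=u_*(|Du|^2\mathfrak m)$ and let $f\in S^2(Y,d_Y,\mu)$. Then there is $g\in S^2(X)$ such that $g=f\circ u$ $\mathfrak m$-a.e. on $\{|Du|>0\}$ and $$|\mathrm dg|\le |\mathrm d_\mu f|\circ u\,|Du|\qquad\mathfrak m\text{-a.e.}$$ More precisely, there are such a $g\in S^2(X)$ and a sequence $(f_n)\subset \mathrm{LIP}_{bd}(Y)$ such that $$f_n\to f\quad \mu\text{-a.e.},\qquad \mathrm{lip}_a(f_n)\to|\mathrm d_\mu f|\quad\text{in }L^2(\mu),$$ $$f_n\circ u\to g\quad\mathfrak m\text{-a.e.},\qquad \mathrm{lip}_a(f_n)\circ u\,|Du|\to|\mathrm d_\mu f|\circ u\,|Du|\quad\text{in }L^2(\mathfrak m).$$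
   Context: On a metric space $Z$ with a non-negative Radon measure $\mathfrak n$ finite on bounded sets, $\mathrm{LIP}(Z)$ is the set of real-valued Lipschitz functions, $\mathrm{LIP}_{bd}(Z)$ the set of functions Lipschitz on bounded sets, $\mathrm{Lip}(f)$ the global Lipschitz constant, and $\mathrm{lip}_a(f)(x):=\limsup_{y,z\to x}|f(y)-f(z)|/d_Z(y,z)$ ($0$ at isolated points). $L^0(\mathfrak n)$ is the space of real Borel functions modulo $\mathfrak n$-a.e. equality, with the topology of convergence in measure on sets of finite measure. $f\in S^2(Z,d_Z,\mathfrak n)$ means: there are $G\in L^2(\mathfrak n)$ and $(f_n)\subset\mathrm{LIP}_{bd}(Z)$ with $f_n\to f$ in $L^0(\mathfrak n)$ and $\mathrm{lip}_a(f_n)\rightharpoonup G$ weakly in $L^2(\mathfrak n)$; the $\mathfrak n$-a.e. minimal such $G\ge0$ is denoted $|Df|$, also written $|\mathrm d_{\mathfrak n}f|$ (it is the pointwise norm of the abstract differential $\mathrm d_{\mathfrak n}f$); for $\mathfrak n=\mathfrak m$ on $X$ one writes $|\mathrm df|$. $S^2(X):=S^2(X,d_X,\mathfrak m)$. $S^2(X,Y)$ is the set of Borel maps $u:X\to Y$ with $u(X\setminus N)$ separable for some $\mathfrak m$-null $N$, for which there is $G\in L^2(\mathfrak m)$, $G\ge 0$, such that for every $f\in\mathrm{LIP}(Y)$ one has $f\circ u\in S^2(X)$ and $|D(f\circ u)|\le \mathrm{Lip}(f)\,G$ $\mathfrak m$-a.e. The $\mathfrak m$-a.e. least such $G$ is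 denoted $|Du|$. The measure $\mu=u_*(|Du|^2\mathfrak m)$ is finite. For $h\in L^0(\mu)$, $h\circ u$ is well defined $\mathfrak m$-a.e. on $\{|Du|>0\}$, so $h\circ u\,|Du|\in L^0(\mathfrak m)$ is well defined, equal to $0$ on $\{|Du|=0\}$. *)

theory Defs
  imports "HOL-Analysis.Analysis"
begin

definition radon_measure :: "'a::topological_space measure \<Rightarrow> bool" where
  "radon_measure M \<longleftrightarrow>
     sets M = sets borel \<and>
     (\<forall>x. \<exists>U. open U \<and> x \<in> U \<and> emeasure M U < \<infinity>) \<and>
     (\<forall>B\<in>sets M. emeasure M B = (SUP K\<in>{K. K \<subseteq> B \<and> compact K}. emeasure M K))"

definition boundedly_finite :: "'a::metric_space measure \<Rightarrow> bool" where
  "boundedly_finite M \<longleftrightarrow> (\<forall>B\<in>sets M. bounded B \<longrightarrow> emeasure M B < \<infinity>)"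

text \<open>Elements of \<open>L\<^sup>0\<close> and \<open>L\<^sup>2\<close> are represented by measurable functions; the
  convergences below do not depend on the choice of measurable representatives.\<close>

definition L0_tendsto ::
    "'a measure \<Rightarrow> (nat \<Rightarrow> 'a \<Rightarrow> real) \<Rightarrow> ('a \<Rightarrow> real) \<Rightarrow> bool" where
  "L0_tendsto M fs f \<longleftrightarrow>
     (\<forall>k. fs k \<in> borel_measurable M) \<and> f \<in> borel_measurable M \<and>
     (\<forall>E\<in>sets M. emeasure M E < \<infinity> \<longrightarrow>
        (\<forall>\<epsilon>>0. (\<lambda>k. emeasure M {x\<in>E. \<bar>fs k x - f x\<bar> > \<epsilon>}) \<longlonglongrightarrow> 0))"

definition L2 :: "'a measure \<Rightarrow> ('a \<Rightarrow> real) set" where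
  "L2 M = {f \<in> borel_measurable M. integrable M (\<lambda>x. (f x)\<^sup>2)}"

definition L2_tendsto ::
    "'a measure \<Rightarrow> (nat \<Rightarrow> 'a \<Rightarrow> real) \<Rightarrow> ('a \<Rightarrow> real) \<Rightarrow> bool" where
  "L2_tendsto M fs f \<longleftrightarrow>
     (\<forall>k. fs k \<in> L2 M) \<and> f \<in> L2 M \<and> (\<lambda>k. \<integral>x. (fs k x - f x)\<^sup>2 \<partial>M) \<longlonglongrightarrow> 0"

definition L2_weakly_tendsto ::
    "'a measure \<Rightarrow> (nat \<Rightarrow> 'a \<Rightarrow> real) \<Rightarrow> ('a \<Rightarrow> real) \<Rightarrow> bool" where
  "L2_weakly_tendsto M fs f \<longleftrightarrow>
     (\<forall>k. fs k \<in> L2 M) \<and> f \<in> L2 M \<and>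
     (\<forall>h\<in>L2 M. (\<lambda>k. \<integral>x. fs k x * h x \<partial>M) \<longlonglongrightarrow> (\<integral>x. f x * h x \<partial>M))"

definition LIP :: "('a::metric_space \<Rightarrow> real) set" where
  "LIP = {f. \<exists>L. L-lipschitz_on UNIV f}"

definition LIP_bd :: "('a::metric_space \<Rightarrow> real) set" where
  "LIP_bd = {f. \<forall>B. bounded B \<longrightarrow> (\<exists>L. L-lipschitz_on B f)}"

definition Lip_const :: "('a::metric_space \<Rightarrow> real) \<Rightarrow> real" where
  "Lip_const f = Inf {L. L-lipschitz_on UNIV f}"

text \<open>The asymptotic Lipschitz constant. For \<open>f \<in> LIP_bd\<close> the upper limit at a non-isolated
  point is finite, so nothing is lost by the conversion to \<^typ>\<open>real\<close>; it is not meant to be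
  used where the upper limit is infinite.\<close>

definition lip_a :: "('a::metric_space \<Rightarrow> real) \<Rightarrow> 'a \<Rightarrow> real" where
  "lip_a f x =
     (if x isolated_in UNIV then 0
      else real_of_ereal
        (Limsup (inf (nhds x \<times>\<^sub>F nhds x) (principal {(y, z). y \<noteq> z}))
           (\<lambda>(y, z). ereal (\<bar>f y - f z\<bar> / dist y z))))"

definition relaxed_slope ::
    "'a::metric_space measure \<Rightarrow> ('a \<Rightarrow> real) \<Rightarrow> ('a \<Rightarrow> real) \<Rightarrow> bool" where
  "relaxed_slope M f G \<longleftrightarrow>
     (\<exists>fs. (\<forall>k. fs k \<in> LIP_bd) \<and> L0_tendsto M fs f \<and>
           L2_weakly_tendsto M (\<lambda>k. lip_a (fs k)) G)"

definition S2 :: "'a::metric_space measure \<Rightarrow> ('a \<Rightarrow> real) set" where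
  "S2 M = {f \<in> borel_measurable M. \<exists>G\<in>L2 M. relaxed_slope M f G}"

text \<open>\<open>|Df|\<close> is determined only up to null sets; \<open>slope M f\<close> is a fixed representative of it.\<close>

definition is_minimal_slope ::
    "'a::metric_space measure \<Rightarrow> ('a \<Rightarrow> real) \<Rightarrow> ('a \<Rightarrow> real) \<Rightarrow> bool" where
  "is_minimal_slope M f G \<longleftrightarrow>
     G \<in> L2 M \<and> (AE x in M. 0 \<le> G x) \<and> relaxed_slope M f G \<and>
     (\<forall>H. relaxed_slope M f H \<longrightarrow> (AE x in M. G x \<le> H x))"

definition slope :: "'a::metric_space measure \<Rightarrow> ('a \<Rightarrow> real) \<Rightarrow> 'a \<Rightarrow> real" where
  "slope M f = (SOME G. is_minimal_slope M f G)"

definition map_slope_bound ::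
    "'a::metric_space measure \<Rightarrow> ('a \<Rightarrow> 'b::metric_space) \<Rightarrow> ('a \<Rightarrow> real) \<Rightarrow> bool" where
  "map_slope_bound M u G \<longleftrightarrow>
     G \<in> L2 M \<and> (AE x in M. 0 \<le> G x) \<and>
     (\<forall>f\<in>LIP. f \<circ> u \<in> S2 M \<and> (AE x in M. slope M (f \<circ> u) x \<le> Lip_const f * G x))"

definition essentially_separable :: "'a measure \<Rightarrow> ('a \<Rightarrow> 'b::topological_space) \<Rightarrow> bool" where
  "essentially_separable M u \<longleftrightarrow>
     (\<exists>N\<in>null_sets M. separable_space (top_of_set (u ` (space M - N))))"

definition S2_map :: "'a::metric_space measure \<Rightarrow> ('a \<Rightarrow> 'b::metric_space) set" where
  "S2_map M = {u \<in> borel_measurable M. essentially_separable M u \<and> (\<exists>G. map_slope_bound M u G)}"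

text \<open>\<open>map_slope M u\<close> is a fixed representative of \<open>|Du|\<close>.\<close>

definition map_slope ::
    "'a::metric_space measure \<Rightarrow> ('a \<Rightarrow> 'b::metric_space) \<Rightarrow> 'a \<Rightarrow> real" where
  "map_slope M u =
     (SOME G. map_slope_bound M u G \<and>
              (\<forall>H. map_slope_bound M u H \<longrightarrow> (AE x in M. G x \<le> H x)))"

text \<open>The measure \<open>\<mu> = u\<^sub>*(|Du|\<^sup>2 M)\<close>.\<close>

definition energy_image ::
    "'a::metric_space measure \<Rightarrow> ('a \<Rightarrow> 'b::metric_space) \<Rightarrow> 'b measure" where
  "energy_image M u = distr (density M (\<lambda>x. ennreal ((map_slope M u x)\<^sup>2))) borel u"

end

theory Submission
  imports Defs
begin

text \<open>
  The class of functions \<open>G \<ge> 0\<close> dominating, up to an \<open>L\<^sup>2\<close>-small error, the asymptotic Lipschitz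
  constants of some sequence in \<open>LIP_bd\<close> converging a.e. to \<open>f\<close> is closed and, by gluing two
  such sequences along open sets, stable under pointwise minima; it therefore has a least element,
  which is the minimal slope of \<open>f\<close> and has the usual locality. By locality and McShane extension on
  countably many small balls, \<open>F \<circ> u\<close> has slope at most \<open>lip_a F \<circ> u * |Du|\<close> for bounded
  \<open>F \<in> LIP_bd\<close>. Optimal approximations of \<open>f\<close> need not converge along \<open>u\<close> where \<open>|Du| = 0\<close>.
  So \<open>f\<^sup>+\<close> and \<open>f\<^sup>-\<close> are approximated separately by nonnegative functions, convex combinations
  of which converge along \<open>u\<close> to limits in \<open>[0, \<infinity>]\<close>; composing with the 1-Lipschitz function that
  is the identity on \<open>[0, K]\<close>, decreases to \<open>0\<close> on \<open>[K, 2 K]\<close> and vanishes beyond, and then letting \<open>K\<close> tend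
  to infinity, replaces the infinite limits by \<open>0\<close> without increasing slopes.
\<close>

section \<open>Square integrable functions\<close>

text \<open>The obstacle is that \<mu> does not see {|Du| = 0}: Lipschitz functions converging
  \<mu>-a.e. to f may oscillate or blow up along u there, and no L2(m) bound on their compositions
  with u is available, so weak compactness cannot supply g. The substitute is a compactness of
  convex combinations that works without bounds, through the integral of exp (-t). It asks for
  functions bounded below, which is why f^+ and f^- are treated apart; by locality their slopes live
  on disjoint sets, so the splitting costs no constant. Folding has a second purpose: it bounds the
  approximations. The composition estimate makes a function of height K globally Lipschitz by a
  cut-off between radii R and 2 R; the cut-off has slope K / R, and this vanishes as R grows because
  K is fixed. Since \<open>sub_slope\<close> measures only the positive part of \<open>lip_a\<close>
  minus G, estimates can stay one-sided; strong convergence of \<open>lip_a\<close> is then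
  recovered from minimality, because a sequence bounded in the limit by the least element has no
  room to lose energy.\<close>

definition sqn :: "'a measure \<Rightarrow> ('a \<Rightarrow> real) \<Rightarrow> ennreal" where
  "sqn M f = (\<integral>\<^sup>+x. ennreal ((f x)\<^sup>2) \<partial>M)"

lemma L2_iff: "f \<in> L2 M \<longleftrightarrow> f \<in> borel_measurable M \<and> sqn M f < \<infinity>"
  unfolding L2_def sqn_def by (auto simp: integrable_iff_bounded)

lemma L2_measurable: "f \<in> L2 M \<Longrightarrow> f \<in> borel_measurable M"
  by (simp add: L2_iff)

lemma sqn_integral: "f \<in> L2 M \<Longrightarrow> sqn M f = ennreal (\<integral>x. (f x)\<^sup>2 \<partial>M)"
  unfolding sqn_def by (rule nn_integral_eq_integral) (auto simp: L2_def)

lemma sqn_mono_AE: "AE x in M. \<bar>f x\<bar> \<le> \<bar>g x\<bar> \<Longrightarrow> sqn M f \<le> sqn M g"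
  unfolding sqn_def by (intro nn_integral_mono_AE) (auto simp: abs_le_square_iff intro: ennreal_leI)

text \<open>The constant comes from (a + b)^2 \<le> 2 a^2 + 2 b^2; it is harmless, since the bound
  only serves finiteness and convergence to 0.\<close>

lemma sqn_le_add:
  assumes [measurable]: "g \<in> borel_measurable M" "h \<in> borel_measurable M"
    and "AE x in M. \<bar>f x\<bar> \<le> \<bar>g x\<bar> + \<bar>h x\<bar>"
  shows "sqn M f \<le> 2 * sqn M g + 2 * sqn M h"
proof -
  have "sqn M f \<le> (\<integral>\<^sup>+x. 2 * ennreal ((g x)\<^sup>2) + 2 * ennreal ((h x)\<^sup>2) \<partial>M)"
    unfolding sqn_def
  proof (rule nn_integral_mono_AE, use assms(3) in eventually_elim)
    case (elim x)
    have "(f x)\<^sup>2 \<le> (\<bar>g x\<bar> + \<bar>h x\<bar>)\<^sup>2" using elim by (metis abs_ge_zero power2_abs power_mono)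
    also have "\<dots> \<le> 2 * (g x)\<^sup>2 + 2 * (h x)\<^sup>2"
      using sum_squares_bound[of "\<bar>g x\<bar>" "\<bar>h x\<bar>"] by (simp add: power2_sum)
    finally have "ennreal ((f x)\<^sup>2) \<le> ennreal (2 * (g x)\<^sup>2 + 2 * (h x)\<^sup>2)" by (rule ennreal_leI)
    then show ?case by (simp add: ennreal_mult ennreal_plus)
  qed
  also have "\<dots> = 2 * sqn M g + 2 * sqn M h"
    by (simp add: sqn_def nn_integral_add nn_integral_cmult)
  finally show ?thesis .
qed

lemma tendsto_0_ennreal_iff:
  fixes f :: "nat \<Rightarrow> ennreal"
  shows "f \<longlonglongrightarrow> 0 \<longleftrightarrow> (\<forall>e>0::real. eventually (\<lambda>n. f n < ennreal e) sequentially)"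
proof
  assume "f \<longlonglongrightarrow> 0"
  then show "\<forall>e>0::real. eventually (\<lambda>n. f n < ennreal e) sequentially"
    by (auto intro: order_tendstoD)
next
  assume *: "\<forall>e>0::real. eventually (\<lambda>n. f n < ennreal e) sequentially"
  show "f \<longlonglongrightarrow> 0"
  proof (rule order_tendstoI)
    fix a :: ennreal assume "0 < a"
    obtain e :: real where "0 < e" "ennreal e < a"
    proof (cases a)
      case (real r)
      then have "0 < r / 2" "ennreal (r / 2) < a" using \<open>0 < a\<close> by (auto simp: ennreal_less_iff)
      then show thesis using that by blast
    next
      case top
      then show thesis using that[of 1] by simp
    qed
    then show "\<forall>\<^sub>F n in sequentially. f n < a" by (intro eventually_mono[OF *[rule_format, OF \<open>0 < e\<close>]]) (rule less_trans)
  qed simp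
qed

lemma ennreal_squeeze_0:
  fixes f g :: "nat \<Rightarrow> ennreal"
  assumes "g \<longlonglongrightarrow> 0" "\<And>n. f n \<le> g n"
  shows "f \<longlonglongrightarrow> 0"
  by (rule tendsto_sandwich[OF _ _ tendsto_const assms(1)]) (auto simp: assms(2))

lemma sqn_tendsto_add:
  assumes "\<And>n. g n \<in> borel_measurable M" "\<And>n. h n \<in> borel_measurable M"
    and "\<And>n. AE x in M. \<bar>f n x\<bar> \<le> \<bar>g n x\<bar> + \<bar>h n x\<bar>"
    and "(\<lambda>n. sqn M (g n)) \<longlonglongrightarrow> 0" "(\<lambda>n. sqn M (h n)) \<longlonglongrightarrow> 0"
  shows "(\<lambda>n. sqn M (f n)) \<longlonglongrightarrow> 0"
proof (rule ennreal_squeeze_0)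
  have "(\<lambda>n. 2 * sqn M (g n) + 2 * sqn M (h n)) \<longlonglongrightarrow> 2 * 0 + 2 * 0"
    by (intro tendsto_add ennreal_tendsto_cmult assms) auto
  then show "(\<lambda>n. 2 * sqn M (g n) + 2 * sqn M (h n)) \<longlonglongrightarrow> 0" by simp
qed (intro sqn_le_add assms)

lemma sqn_tendsto_mono:
  assumes "\<And>n. AE x in M. \<bar>f n x\<bar> \<le> \<bar>g n x\<bar>" "(\<lambda>n. sqn M (g n)) \<longlonglongrightarrow> 0"
  shows "(\<lambda>n. sqn M (f n)) \<longlonglongrightarrow> 0"
  by (rule ennreal_squeeze_0[OF assms(2)]) (intro sqn_mono_AE assms)

lemma sqn_cmult: "f \<in> borel_measurable M \<Longrightarrow> sqn M (\<lambda>x. c * f x) = ennreal (c\<^sup>2) * sqn M f"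
  by (simp add: sqn_def power_mult_distrib ennreal_mult nn_integral_cmult)

lemma sqn_dominated:
  assumes [measurable]: "\<And>n. f n \<in> borel_measurable M" and w: "w \<in> L2 M"
    and b: "\<And>n. AE x in M. \<bar>f n x\<bar> \<le> w x" and l: "AE x in M. (\<lambda>n. f n x) \<longlonglongrightarrow> 0"
  shows "(\<lambda>n. sqn M (f n)) \<longlonglongrightarrow> 0"
proof -
  have [measurable]: "w \<in> borel_measurable M" using w by (rule L2_measurable)
  have "(\<lambda>n. sqn M (f n)) \<longlonglongrightarrow> (\<integral>\<^sup>+x. 0 \<partial>M)" unfolding sqn_def
  proof (rule nn_integral_dominated_convergence[where w="\<lambda>x. ennreal ((w x)\<^sup>2)"])
    show "AE x in M. ennreal ((f j x)\<^sup>2) \<le> ennreal ((w x)\<^sup>2)" for j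
      using b[of j] by eventually_elim (auto intro!: ennreal_leI simp: abs_le_square_iff[symmetric])
    show "(\<integral>\<^sup>+ x. ennreal ((w x)\<^sup>2) \<partial>M) < \<infinity>" using w by (simp add: L2_iff sqn_def)
    show "AE x in M. (\<lambda>i. ennreal ((f i x)\<^sup>2)) \<longlonglongrightarrow> 0"
      using l
    proof eventually_elim
      case (elim x)
      then have "(\<lambda>i. (f i x)\<^sup>2) \<longlonglongrightarrow> 0\<^sup>2" by (rule tendsto_power)
      then show ?case using tendsto_ennrealI[of "\<lambda>i. (f i x)\<^sup>2" 0] by simp
    qed
  qed auto
  then show ?thesis by simp
qed

lemma L2_bounded:
  assumes "f \<in> borel_measurable M" "g \<in> L2 M" "AE x in M. \<bar>f x\<bar> \<le> \<bar>g x\<bar>"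
  shows "f \<in> L2 M"
  using assms sqn_mono_AE[OF assms(3)] by (auto simp: L2_iff)

lemma L2_bounded_add:
  assumes "f \<in> borel_measurable M" "g \<in> L2 M" "h \<in> L2 M" "AE x in M. \<bar>f x\<bar> \<le> \<bar>g x\<bar> + \<bar>h x\<bar>"
  shows "f \<in> L2 M"
proof -
  have "sqn M f \<le> 2 * sqn M g + 2 * sqn M h"
    using assms by (intro sqn_le_add) (auto simp: L2_iff)
  also have "\<dots> < \<infinity>" using assms by (simp add: L2_iff ennreal_mult_less_top)
  finally show ?thesis using assms by (simp add: L2_iff)
qed

lemma L2_add: "f \<in> L2 M \<Longrightarrow> g \<in> L2 M \<Longrightarrow> (\<lambda>x. f x + g x) \<in> L2 M"
  by (rule L2_bounded_add[of _ M f g]) (auto simp: L2_def)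

lemma L2_diff: "f \<in> L2 M \<Longrightarrow> g \<in> L2 M \<Longrightarrow> (\<lambda>x. f x - g x) \<in> L2 M"
  by (rule L2_bounded_add[of _ M f g]) (auto simp: L2_def)

lemma L2_limit:
  assumes f: "\<And>n. f n \<in> L2 M" and g: "g \<in> borel_measurable M"
    and l: "(\<lambda>n. sqn M (\<lambda>x. f n x - g x)) \<longlonglongrightarrow> 0"
  shows "g \<in> L2 M"
proof -
  from l[unfolded tendsto_0_ennreal_iff, rule_format, OF zero_less_one]
  obtain n where n: "sqn M (\<lambda>x. f n x - g x) < ennreal 1"
    unfolding eventually_sequentially by blast
  then have "(\<lambda>x. f n x - g x) \<in> L2 M"
    unfolding L2_iff using g L2_measurable[OF f[of n]] less_trans[OF n ennreal_less_top] by simp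
  from L2_diff[OF f[of n] this] show ?thesis by simp
qed

lemma L2_cmult: "f \<in> L2 M \<Longrightarrow> (\<lambda>x. c * f x) \<in> L2 M"
  by (auto simp: L2_iff sqn_cmult ennreal_mult_less_top)

lemma L2_sum:
  "(\<And>i. i \<in> I \<Longrightarrow> f i \<in> L2 M) \<Longrightarrow> (\<lambda>x. \<Sum>i\<in>I. f i x) \<in> L2 M"
proof (induction I rule: infinite_finite_induct)
  case (insert i I)
  then show ?case by (simp add: L2_add)
qed (auto simp: L2_iff sqn_def)

lemma L2_mult_integrable:
  assumes "f \<in> L2 M" "g \<in> L2 M" shows "integrable M (\<lambda>x. f x * g x)"
proof (rule Bochner_Integration.integrable_bound)
  show "integrable M (\<lambda>x. (f x)\<^sup>2 + (g x)\<^sup>2)" using assms by (auto simp: L2_def)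
  show "(\<lambda>x. f x * g x) \<in> borel_measurable M" using assms by (auto simp: L2_def)
  have "norm (a * b) \<le> norm (a\<^sup>2 + b\<^sup>2)" for a b :: real
  proof -
    have "2 * (\<bar>a\<bar> * \<bar>b\<bar>) \<le> a\<^sup>2 + b\<^sup>2" "0 \<le> \<bar>a\<bar> * \<bar>b\<bar>"
      using sum_squares_bound[of "\<bar>a\<bar>" "\<bar>b\<bar>"] by (simp_all add: mult.assoc)
    then have "\<bar>a\<bar> * \<bar>b\<bar> \<le> a\<^sup>2 + b\<^sup>2" by linarith
    then show ?thesis by (simp add: abs_mult)
  qed
  then show "AE x in M. norm (f x * g x) \<le> norm ((f x)\<^sup>2 + (g x)\<^sup>2)" by auto
qed

text \<open>Young's inequality with a free weight \<open>t\<close>: a large \<open>t\<close> makes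
  the share of a fixed factor small and is paid for by a factor that tends to 0.\<close>

lemma L2_inner_bound:
  assumes "f \<in> L2 M" "g \<in> L2 M" "t > 0"
  shows "\<bar>\<integral>x. f x * g x \<partial>M\<bar> \<le> t * (\<integral>x. (f x)\<^sup>2 \<partial>M) + (1/t) * (\<integral>x. (g x)\<^sup>2 \<partial>M)"
proof -
  have i: "integrable M (\<lambda>x. (f x)\<^sup>2)" "integrable M (\<lambda>x. (g x)\<^sup>2)" using assms by (auto simp: L2_def)
  have "\<bar>\<integral>x. f x * g x \<partial>M\<bar> \<le> (\<integral>x. \<bar>f x * g x\<bar> \<partial>M)" by (rule integral_abs_bound)
  also have "\<dots> \<le> (\<integral>x. t * (f x)\<^sup>2 + (1/t) * (g x)\<^sup>2 \<partial>M)"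
  proof (rule integral_mono)
    show "integrable M (\<lambda>x. \<bar>f x * g x\<bar>)" using L2_mult_integrable[OF assms(1,2)] by simp
    show "integrable M (\<lambda>x. t * (f x)\<^sup>2 + (1/t) * (g x)\<^sup>2)" using i by simp
    fix x
    have "\<bar>f x * g x\<bar> \<le> 2 * \<bar>sqrt t * f x\<bar> * \<bar>g x / sqrt t\<bar>" using assms(3) by (simp add: abs_mult)
    also have "\<dots> \<le> \<bar>sqrt t * f x\<bar>\<^sup>2 + \<bar>g x / sqrt t\<bar>\<^sup>2" by (rule sum_squares_bound)
    also have "\<dots> = t * (f x)\<^sup>2 + (1/t) * (g x)\<^sup>2" using assms(3) by (simp add: power_mult_distrib power_divide)
    finally show "\<bar>f x * g x\<bar> \<le> t * (f x)\<^sup>2 + (1/t) * (g x)\<^sup>2" .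
  qed
  also have "\<dots> = t * (\<integral>x. (f x)\<^sup>2 \<partial>M) + (1/t) * (\<integral>x. (g x)\<^sup>2 \<partial>M)" using i by simp
  finally show ?thesis .
qed

lemma L2_strong_inner:
  assumes "\<And>n. f n \<in> L2 M" "h \<in> L2 M" "(\<lambda>n. sqn M (f n)) \<longlonglongrightarrow> 0"
  shows "(\<lambda>n. \<integral>x. f n x * h x \<partial>M) \<longlonglongrightarrow> 0"
proof (rule LIMSEQ_I)
  fix r :: real assume r: "0 < r"
  define c where "c = (\<integral>x. (h x)\<^sup>2 \<partial>M)"
  have c: "c \<ge> 0" by (auto simp: c_def)
  \<comment> \<open>With this weight the share \<open>(1/t) * c\<close> of the fixed function stays
    below r / 2; the summand 1 keeps \<open>t\<close> positive when h vanishes.\<close>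
  define t where "t = 2 * (c + 1) / r"
  have t: "t > 0" using r c by (simp add: t_def)
  have ct: "(1/t) * c < r / 2" using r c by (simp add: t_def field_simps)
  have "eventually (\<lambda>n. sqn M (f n) < ennreal (r / (2*t))) sequentially"
    using assms(3) r t by (simp add: tendsto_0_ennreal_iff)
  then obtain N where N: "\<And>n. n \<ge> N \<Longrightarrow> sqn M (f n) < ennreal (r / (2*t))"
    by (auto simp: eventually_sequentially)
  have "norm ((\<integral>x. f n x * h x \<partial>M) - 0) < r" if "n \<ge> N" for n
  proof -
    have "(\<integral>x. (f n x)\<^sup>2 \<partial>M) < r / (2*t)"
      using N[OF that] sqn_integral[OF assms(1)[of n]] by (simp add: ennreal_less_iff)
    then have "t * (\<integral>x. (f n x)\<^sup>2 \<partial>M) < r / 2" using t by (simp add: field_simps)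
    then have "\<bar>\<integral>x. f n x * h x \<partial>M\<bar> < r / 2 + r / 2"
      using L2_inner_bound[OF assms(1)[of n] assms(2) t] ct unfolding c_def by linarith
    then show ?thesis by simp
  qed
  then show "\<exists>no. \<forall>n\<ge>no. norm ((\<integral>x. f n x * h x \<partial>M) - 0) < r" by blast
qed

lemma L2_tendsto_iff:
  assumes "\<And>n. f n \<in> L2 M" "g \<in> L2 M"
  shows "L2_tendsto M f g \<longleftrightarrow> (\<lambda>n. sqn M (\<lambda>x. f n x - g x)) \<longlonglongrightarrow> 0"
proof -
  have "(\<lambda>n. sqn M (\<lambda>x. f n x - g x)) = (\<lambda>n. ennreal (\<integral>x. (f n x - g x)\<^sup>2 \<partial>M))"
    using assms by (intro ext sqn_integral L2_diff)
  then show ?thesis using assms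
    using tendsto_ennreal_iff[of "\<lambda>n. \<integral>x. (f n x - g x)\<^sup>2 \<partial>M" sequentially 0] by (auto simp: L2_tendsto_def)
qed

lemma L2_strong_imp_weak:
  assumes "\<And>n. f n \<in> L2 M" "g \<in> L2 M" "(\<lambda>n. sqn M (\<lambda>x. f n x - g x)) \<longlonglongrightarrow> 0"
  shows "L2_weakly_tendsto M f g"
  unfolding L2_weakly_tendsto_def
proof (intro conjI ballI allI assms)
  fix h assume h: "h \<in> L2 M"
  have "(\<lambda>n. \<integral>x. (f n x - g x) * h x \<partial>M) \<longlonglongrightarrow> 0"
    by (rule L2_strong_inner[OF _ h]) (auto intro: L2_diff assms)
  moreover have "(\<integral>x. (f n x - g x) * h x \<partial>M) = (\<integral>x. f n x * h x \<partial>M) - (\<integral>x. g x * h x \<partial>M)" for n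
    using L2_mult_integrable[OF assms(1) h] L2_mult_integrable[OF assms(2) h] by (simp add: left_diff_distrib)
  ultimately show "(\<lambda>n. \<integral>x. f n x * h x \<partial>M) \<longlonglongrightarrow> (\<integral>x. g x * h x \<partial>M)"
    by (simp add: LIM_zero_iff)
qed

lemma sqn_markov:
  assumes [measurable]: "f \<in> borel_measurable M" and "c > 0"
  shows "emeasure M {x \<in> space M. \<bar>f x\<bar> > c} \<le> ennreal (1 / c\<^sup>2) * sqn M f"
proof -
  have "emeasure M {x \<in> space M. \<bar>f x\<bar> > c} \<le> emeasure M {x \<in> space M. 1 \<le> ennreal (1 / c\<^sup>2) * ennreal ((f x)\<^sup>2)}"
  proof (rule emeasure_mono)
    have "1 \<le> ennreal (1 / c\<^sup>2) * ennreal ((f x)\<^sup>2)" if "c < \<bar>f x\<bar>" for x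
    proof -
      have "c\<^sup>2 \<le> (f x)\<^sup>2" using that assms(2) by (simp add: abs_le_square_iff[symmetric])
      then have "1 \<le> 1 / c\<^sup>2 * (f x)\<^sup>2" using assms(2) by (simp add: field_simps)
      then show ?thesis by (simp add: ennreal_mult''[symmetric] ennreal_ge_1)
    qed
    then show "{x \<in> space M. c < \<bar>f x\<bar>} \<subseteq> {x \<in> space M. 1 \<le> ennreal (1 / c\<^sup>2) * ennreal ((f x)\<^sup>2)}" by auto
  qed measurable
  also have "\<dots> \<le> ennreal (1 / c\<^sup>2) * (\<integral>\<^sup>+x. ennreal ((f x)\<^sup>2) * indicator (space M) x \<partial>M)"
    using nn_integral_Markov_inequality[of "\<lambda>x. ennreal ((f x)\<^sup>2)" "space M" M "ennreal (1 / c\<^sup>2)"] by simp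
  also have "(\<integral>\<^sup>+x. ennreal ((f x)\<^sup>2) * indicator (space M) x \<partial>M) = sqn M f"
    unfolding sqn_def by (rule nn_integral_cong) (auto split: split_indicator)
  finally show ?thesis .
qed

lemma borel_cantelli_geometric:
  assumes [measurable]: "\<And>n. A n \<in> sets M" and b: "\<And>n. emeasure M (A n) \<le> ennreal ((1/2)^n)"
  shows "AE x in M. eventually (\<lambda>n. x \<notin> A n) sequentially"
proof -
  have fin: "emeasure M (A n) < \<infinity>" for n using le_less_trans[OF b[of n] ennreal_less_top] by simp
  have "measure M (A n) \<le> (1/2)^n" for n
    using b[of n] fin[of n] unfolding measure_def by (intro enn2real_leI) auto
  then have "summable (\<lambda>n. measure M (A n))"
    by (intro summable_comparison_test'[OF summable_geometric[of "1/2::real"]]) auto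
  from borel_cantelli_AE1[OF _ fin this] show ?thesis by (auto elim!: eventually_mono)
qed

text \<open>Riesz-Fischer: a rapidly Cauchy subsequence converges a.e. by Borel-Cantelli, and
  Fatou's lemma turns this into norm convergence of the whole sequence. The a.e. convergent
  subsequence is part of the result because later limits take their sign from it and weights are
  extracted along it.\<close>

lemma L2_complete:
  fixes x :: "nat \<Rightarrow> 'a \<Rightarrow> real"
  assumes [measurable]: "\<And>n. x n \<in> borel_measurable M"
    and C: "\<And>e. e > 0 \<Longrightarrow> \<exists>N. \<forall>m\<ge>N. \<forall>n\<ge>N. sqn M (\<lambda>w. x m w - x n w) < ennreal e"
  obtains y r where "y \<in> borel_measurable M" "strict_mono (r :: nat \<Rightarrow> nat)"
    "AE w in M. (\<lambda>k. x (r k) w) \<longlonglongrightarrow> y w" "(\<lambda>n. sqn M (\<lambda>w. x n w - y w)) \<longlonglongrightarrow> 0"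
proof -
  \<comment> \<open>The squared distance 8^-k beats the factor 4^k that Chebyshev's inequality costs
    at threshold 2^-k, leaving the summable 2^-k.\<close>
  have "\<exists>r. strict_mono r \<and> (\<forall>k::nat. \<forall>m\<ge>r k. \<forall>n\<ge>r k. sqn M (\<lambda>w. x m w - x n w) < ennreal ((1/8)^k))"
  proof -
    have "\<forall>k::nat. \<exists>N. \<forall>m\<ge>N. \<forall>n\<ge>N. sqn M (\<lambda>w. x m w - x n w) < ennreal ((1/8)^k)" using C by simp
    then obtain N where N: "\<And>k m n. m \<ge> N k \<Longrightarrow> n \<ge> N k \<Longrightarrow> sqn M (\<lambda>w. x m w - x n w) < ennreal ((1/8)^k)" by metis
    define r where "r = rec_nat (N 0) (\<lambda>k a. max (Suc a) (N (Suc k)))"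
    have "strict_mono r" by (rule strict_monoI_Suc) (simp add: r_def)
    moreover have "N k \<le> r k" for k by (cases k) (auto simp: r_def)
    ultimately show ?thesis using N order_trans by blast
  qed
  then obtain r where r: "strict_mono r"
    and rb: "\<And>k m n. m \<ge> r k \<Longrightarrow> n \<ge> r k \<Longrightarrow> sqn M (\<lambda>w. x m w - x n w) < ennreal ((1/8)^k)" by blast
  define A where "A k = {w \<in> space M. \<bar>x (r k) w - x (r (Suc k)) w\<bar> > (1/2)^k}" for k
  have "AE w in M. eventually (\<lambda>n. w \<notin> A n) sequentially"
  proof (rule borel_cantelli_geometric)
    fix n
    show "A n \<in> sets M" unfolding A_def by measurable
    have "emeasure M (A n) \<le> ennreal (1 / ((1/2)^n)\<^sup>2) * sqn M (\<lambda>w. x (r n) w - x (r (Suc n)) w)"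
      unfolding A_def by (rule sqn_markov) auto
    also have "\<dots> \<le> ennreal (1 / ((1/2)^n)\<^sup>2) * ennreal ((1/8)^n)"
      using rb[of n "r n" "r (Suc n)"] strict_mono_less_eq[OF r, of n "Suc n"]
      by (intro mult_left_mono less_imp_le) auto
    also have "\<dots> = ennreal ((1/2)^n)"
    proof -
      have "1 / ((1/2)^n)\<^sup>2 * (1/8)^n = ((1/2)^n :: real)"
      proof -
        have "(1/8::real)^n = ((1/2)^n)^3" by (simp add: power3_eq_cube flip: power_mult_distrib)
        then show ?thesis by (simp add: power2_eq_square power3_eq_cube)
      qed
      then show ?thesis by (simp add: ennreal_mult''[symmetric])
    qed
    finally show "emeasure M (A n) \<le> ennreal ((1/2)^n)" .
  qed
  then have conv: "AE w in M. convergent (\<lambda>k. x (r k) w)"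
    using AE_space
  proof eventually_elim
    case (elim w)
    then obtain N where N: "\<And>n. n \<ge> N \<Longrightarrow> \<bar>x (r n) w - x (r (Suc n)) w\<bar> \<le> (1/2)^n"
      by (auto simp: eventually_sequentially A_def not_less)
    have "summable (\<lambda>n. x (r (Suc n)) w - x (r n) w)"
      by (rule summable_comparison_test'[OF summable_geometric[of "1/2::real"], of N])
         (use N in \<open>auto simp: abs_minus_commute\<close>)
    then have "convergent (\<lambda>n. \<Sum>i<n. x (r (Suc i)) w - x (r i) w)" by (simp add: summable_iff_convergent)
    then have "convergent (\<lambda>n. x (r n) w - x (r 0) w)"
      by (simp add: sum_lessThan_telescope[of "\<lambda>i. x (r i) w"])
    then show "convergent (\<lambda>k. x (r k) w)" using convergent_diff_const_right_iff[of "\<lambda>k. x (r k) w" "x (r 0) w"] by simp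
  qed
  define y where "y w = lim (\<lambda>k. x (r k) w)" for w
  have ym[measurable]: "y \<in> borel_measurable M" unfolding y_def by measurable
  have lim: "AE w in M. (\<lambda>k. x (r k) w) \<longlonglongrightarrow> y w"
    using conv by eventually_elim (simp add: y_def convergent_LIMSEQ_iff)
  have "(\<lambda>n. sqn M (\<lambda>w. x n w - y w)) \<longlonglongrightarrow> 0"
    unfolding tendsto_0_ennreal_iff
  proof (intro allI impI)
    fix e :: real assume "0 < e"
    then obtain N where N: "\<And>m n. m \<ge> N \<Longrightarrow> n \<ge> N \<Longrightarrow> sqn M (\<lambda>w. x m w - x n w) < ennreal (e/2)"
      using C[of "e/2"] by auto
    have "sqn M (\<lambda>w. x n w - y w) < ennreal e" if "n \<ge> N" for n
    proof -
      have "sqn M (\<lambda>w. x n w - y w) = (\<integral>\<^sup>+w. liminf (\<lambda>k. ennreal ((x n w - x (r k) w)\<^sup>2)) \<partial>M)"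
        unfolding sqn_def
      proof (rule nn_integral_cong_AE, use lim in eventually_elim)
        case (elim w)
        have "(\<lambda>k. ennreal ((x n w - x (r k) w)\<^sup>2)) \<longlonglongrightarrow> ennreal ((x n w - y w)\<^sup>2)"
          by (intro tendsto_intros elim)
        from lim_imp_Liminf[OF _ this] show ?case by simp
      qed
      also have "\<dots> \<le> liminf (\<lambda>k. sqn M (\<lambda>w. x n w - x (r k) w))"
        unfolding sqn_def by (rule nn_integral_liminf) measurable
      also have "\<dots> \<le> ennreal (e/2)"
      proof (rule Liminf_le)
        have "r k \<ge> N" if "k \<ge> N" for k using seq_suble[OF r, of k] that by linarith
        then have "sqn M (\<lambda>w. x n w - x (r k) w) \<le> ennreal (e/2)" if "k \<ge> N" for k
          using N[OF \<open>n \<ge> N\<close>] that by (simp add: less_imp_le)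
        then show "\<forall>\<^sub>F k in sequentially. sqn M (\<lambda>w. x n w - x (r k) w) \<le> ennreal (e/2)"
          by (auto simp: eventually_sequentially)
      qed auto
      also have "\<dots> < ennreal e" using \<open>0 < e\<close> by (simp add: ennreal_less_iff)
      finally show ?thesis .
    qed
    then show "\<forall>\<^sub>F n in sequentially. sqn M (\<lambda>w. x n w - y w) < ennreal e"
      by (auto simp: eventually_sequentially)
  qed
  then show thesis using that[OF ym r lim] by simp
qed

section \<open>Convergence in measure and almost everywhere\<close>

lemma AE_imp_L0_tendsto:
  assumes [measurable]: "\<And>k. fs k \<in> borel_measurable M" "f \<in> borel_measurable M"
    and l: "AE x in M. (\<lambda>k. fs k x) \<longlonglongrightarrow> f x"
  shows "L0_tendsto M fs f"
  unfolding L0_tendsto_def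
proof (intro conjI allI ballI impI)
  fix E and e :: real assume E[measurable]: "E \<in> sets M" "emeasure M E < \<infinity>" and e: "e > 0"
  have "(\<lambda>k. \<integral>\<^sup>+x. indicator {x\<in>E. \<bar>fs k x - f x\<bar> > e} x \<partial>M) \<longlonglongrightarrow> (\<integral>\<^sup>+x. 0 \<partial>M)"
  proof (rule nn_integral_dominated_convergence[where w="indicator E"])
    show "AE x in M. (\<lambda>k. indicator {x\<in>E. \<bar>fs k x - f x\<bar> > e} x) \<longlonglongrightarrow> (0::ennreal)"
      using l
    proof eventually_elim
      case (elim x)
      have "eventually (\<lambda>k. \<bar>fs k x - f x\<bar> < e) sequentially"
        using elim e by (simp add: tendsto_iff dist_real_def)
      then show ?case by (intro tendsto_eventually) (auto elim!: eventually_mono)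
    qed
    show "(\<integral>\<^sup>+ x. indicator E x \<partial>M) < \<infinity>" using E by simp
  qed (auto split: split_indicator)
  moreover have "(\<integral>\<^sup>+x. indicator {x\<in>E. \<bar>fs k x - f x\<bar> > e} x \<partial>M) = emeasure M {x\<in>E. \<bar>fs k x - f x\<bar> > e}" for k
    using sets.sets_into_space[OF E(1)] by (intro nn_integral_indicator) measurable
  ultimately show "(\<lambda>k. emeasure M {x\<in>E. \<bar>fs k x - f x\<bar> > e}) \<longlonglongrightarrow> 0" by simp
qed auto

context sigma_finite_measure begin

text \<open>The diagonal argument is packaged as an eventual predicate \<open>Q\<close> all of whose
  selections converge. Thus several diagonals, even over different measures, and further smallness
  conditions can be met by one index function through \<open>eventually_choice\<close>.\<close>

lemma L0_diag:
  assumes X: "\<And>k. L0_tendsto M (X k) (Y k)" and Z: "AE x in M. (\<lambda>k. Y k x) \<longlonglongrightarrow> Z x"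
  shows "\<exists>Q. (\<forall>k. eventually (Q k) sequentially) \<and>
    (\<forall>r. (\<forall>k. Q k (r k)) \<longrightarrow> (AE x in M. (\<lambda>k. X k (r k) x) \<longlonglongrightarrow> Z x))"
proof -
  from sigma_finite_incseq obtain E :: "nat \<Rightarrow> 'a set"
    where E: "range E \<subseteq> sets M" "(\<Union>i. E i) = space M" "\<And>i. emeasure M (E i) \<noteq> \<infinity>" "incseq E" by metis
  have [measurable]: "E k \<in> sets M" for k using E by auto
  have [measurable]: "X k n \<in> borel_measurable M" "Y k \<in> borel_measurable M" for k n
    using X[of k] by (auto simp: L0_tendsto_def)
  \<comment> \<open>Threshold 1 / (k+1) on the k-th exhausting set, with measure below 2^-k: the
    selected bad sets are summable, and every point lies in almost all \<open>E k\<close>.\<close>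
  define A where "A k n = {x\<in>E k. \<bar>X k n x - Y k x\<bar> > 1 / real (Suc k)}" for k n
  define Q where "Q k n \<longleftrightarrow> emeasure M (A k n) < ennreal ((1/2)^k)" for k n
  have "eventually (Q k) sequentially" for k
  proof -
    have "(\<lambda>n. emeasure M (A k n)) \<longlonglongrightarrow> 0"
      using X[of k] E(3)[of k] unfolding A_def L0_tendsto_def by (auto simp: top.not_eq_extremum)
    then show ?thesis unfolding tendsto_0_ennreal_iff Q_def by simp
  qed
  moreover have "AE x in M. (\<lambda>k. X k (r k) x) \<longlonglongrightarrow> Z x" if r: "\<And>k. Q k (r k)" for r
  proof -
    have "A k (r k) = {x\<in>space M. x \<in> E k \<and> \<bar>X k (r k) x - Y k x\<bar> > 1 / real (Suc k)}" for k
      using E(2) by (auto simp: A_def)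
    then have "A k (r k) \<in> sets M" for k by simp
    from borel_cantelli_geometric[OF this] r
    have "AE x in M. eventually (\<lambda>k. x \<notin> A k (r k)) sequentially" by (simp add: Q_def less_imp_le)
    then show ?thesis using Z AE_space
    proof eventually_elim
      case (elim x)
      obtain k0 where "x \<in> E k0" using elim(3) E(2) by auto
      then have "eventually (\<lambda>k. x \<in> E k) sequentially"
        using E(4) by (auto simp: eventually_sequentially incseq_def)
      with elim(1) have "eventually (\<lambda>k. norm (X k (r k) x - Y k x) \<le> 1 / real (Suc k)) sequentially"
        by eventually_elim (auto simp: A_def)
      from Lim_null_comparison[OF this] have "(\<lambda>k. X k (r k) x - Y k x) \<longlonglongrightarrow> 0"
        using LIMSEQ_inverse_real_of_nat by (simp add: inverse_eq_divide)
      from tendsto_add[OF this elim(2)] show ?case by simp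
    qed
  qed
  ultimately show ?thesis by blast
qed

text \<open>The clause \<open>k \<le> r k\<close> makes \<open>r\<close> tend to infinity, so a
  sequence selected by \<open>r\<close> keeps the limits of the original one.\<close>

lemma eventually_choice:
  assumes "\<And>k::nat. eventually (Q k) sequentially" "\<And>k::nat. eventually (P k) sequentially"
  shows "\<exists>r::nat \<Rightarrow> nat. \<forall>k. Q k (r k) \<and> P k (r k) \<and> k \<le> r k"
proof -
  have "\<exists>n. Q k n \<and> P k n \<and> k \<le> n" for k
    using eventually_happens'[OF _ eventually_conj[OF assms(1)[of k] eventually_conj[OF assms(2)[of k] eventually_ge_at_top[of k]]]]
    by simp
  then show ?thesis by metis
qed

lemma L0_AE_subseq:
  assumes "L0_tendsto M fs f"
  obtains r :: "nat \<Rightarrow> nat" where "\<And>k. k \<le> r k" "AE x in M. (\<lambda>k. fs (r k) x) \<longlonglongrightarrow> f x"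
proof -
  from L0_diag[of "\<lambda>_. fs" "\<lambda>_. f" f] assms obtain Q where
    Q: "\<And>k. eventually (Q k) sequentially"
    "\<And>r. \<forall>k. Q k (r k) \<Longrightarrow> AE x in M. (\<lambda>k. fs (r k) x) \<longlonglongrightarrow> f x" by auto
  obtain r where "\<And>k. Q k (r k)" "\<And>k. k \<le> r k"
    using eventually_choice[of Q "\<lambda>_ _. True"] Q(1) by auto
  with Q(2) that show thesis by blast
qed

end

lemma filterlim_ge_self: "(\<And>k::nat. k \<le> r k) \<Longrightarrow> filterlim r at_top sequentially"
  by (rule filterlim_at_top_mono[OF filterlim_ident]) auto

text \<open>Running minima of a norm-minimising sequence decrease to a minimiser \<open>g\<close> of
  the norm. For a competitor \<open>K\<close>, the function min g K is again a competitor and of no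
  larger norm, hence equal to g a.e., that is g \<le> K. Accordingly the closedness hypothesis
  concerns sequences dominated by their first member and converging from above. The lemma yields
  both the least sub-slope of a function and |Du|.\<close>

lemma L2_lattice_min:
  fixes \<G> :: "('a \<Rightarrow> real) set"
  assumes sub: "\<G> \<subseteq> L2 M" and ne: "\<G> \<noteq> {}" and nonneg: "\<And>G. G \<in> \<G> \<Longrightarrow> AE x in M. 0 \<le> G x"
    and min: "\<And>G H. G \<in> \<G> \<Longrightarrow> H \<in> \<G> \<Longrightarrow> (\<lambda>x. min (G x) (H x)) \<in> \<G>"
    and lim: "\<And>G G0. (\<And>n::nat. G n \<in> \<G>) \<Longrightarrow> G0 \<in> L2 M \<Longrightarrow> (AE x in M. (\<lambda>n. G n x) \<longlonglongrightarrow> G0 x) \<Longrightarrow>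
        (AE x in M. \<forall>n. 0 \<le> G0 x \<and> G0 x \<le> G n x \<and> G n x \<le> G 0 x) \<Longrightarrow> G0 \<in> \<G>"
  obtains G0 where "G0 \<in> \<G>" "\<And>H. H \<in> \<G> \<Longrightarrow> AE x in M. G0 x \<le> H x"
proof -
  define J where "J G = (\<integral>x. (G x)\<^sup>2 \<partial>M)" for G :: "'a \<Rightarrow> real"
  define I where "I = Inf (J ` \<G>)"
  have bdd: "bdd_below (J ` \<G>)" by (rule bdd_belowI[of _ 0]) (auto simp: J_def)
  have I: "I \<le> J G" if "G \<in> \<G>" for G unfolding I_def using bdd that by (auto intro: cInf_lower)
  have int: "integrable M (\<lambda>x. (G x)\<^sup>2)" if "G \<in> \<G>" for G using that sub by (auto simp: L2_def)
  have "\<exists>G\<in>\<G>. J G < I + 1 / real (Suc n)" for n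
  proof -
    have "Inf (J ` \<G>) < I + 1 / real (Suc n)" by (simp add: I_def)
    then show ?thesis using ne by (subst (asm) cInf_less_iff[OF _ bdd]) auto
  qed
  then obtain H where H: "\<And>n. H n \<in> \<G>" "\<And>n. J (H n) < I + 1 / real (Suc n)" by metis
  define G where "G = rec_nat (H 0) (\<lambda>n g x. min (g x) (H (Suc n) x))"
  have GS: "G (Suc n) x = min (G n x) (H (Suc n) x)" for n x by (simp add: G_def)
  have G0: "G 0 = H 0" by (simp add: G_def)
  have G: "G n \<in> \<G>" for n
  proof (induction n)
    case (Suc n)
    have "G (Suc n) = (\<lambda>x. min (G n x) (H (Suc n) x))" by (rule ext) (rule GS)
    then show ?case using min[OF Suc H(1)] by simp
  qed (simp add: G0 H)
  have le: "G n x \<le> H n x" for n x by (cases n) (auto simp: GS G0)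
  have dec: "decseq (\<lambda>n. G n x)" for x by (rule decseq_SucI) (simp add: GS)
  have pos: "AE x in M. \<forall>n. 0 \<le> G n x" using nonneg[OF G] by (simp add: AE_all_countable)
  define g where "g x = lim (\<lambda>n. G n x)" for x
  have [measurable]: "G n \<in> borel_measurable M" for n using G sub by (auto simp: L2_def)
  have gm: "g \<in> borel_measurable M" unfolding g_def by measurable
  have conv: "AE x in M. (\<lambda>n. G n x) \<longlonglongrightarrow> g x \<and> (\<forall>n. 0 \<le> g x \<and> g x \<le> G n x)"
    using pos
  proof eventually_elim
    case (elim x)
    have "Bseq (\<lambda>n. G n x)"
      using elim dec[of x] by (intro BseqI'[of _ "G 0 x"]) (auto simp: decseq_def)
    with dec[of x] have "convergent (\<lambda>n. G n x)"
      by (simp add: Bseq_monoseq_convergent decseq_imp_monoseq)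
    then have *: "(\<lambda>n. G n x) \<longlonglongrightarrow> g x" by (simp add: g_def convergent_LIMSEQ_iff)
    show ?case using * decseq_ge[OF dec *] LIMSEQ_le_const[OF *] elim by blast
  qed
  have gL2: "g \<in> L2 M"
  proof (rule L2_bounded[OF gm, of "G 0"])
    show "G 0 \<in> L2 M" using G sub by blast
    show "AE x in M. \<bar>g x\<bar> \<le> \<bar>G 0 x\<bar>" using conv by eventually_elim (smt (verit))
  qed
  have g: "g \<in> \<G>"
  proof (rule lim[OF G gL2])
    show "AE x in M. (\<lambda>n. G n x) \<longlonglongrightarrow> g x" using conv by eventually_elim simp
    show "AE x in M. \<forall>n. 0 \<le> g x \<and> g x \<le> G n x \<and> G n x \<le> G 0 x"
      using conv by eventually_elim (use dec in \<open>auto simp: decseq_def\<close>)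
  qed
  have "J g \<le> I"
  proof (rule field_le_epsilon)
    fix e :: real assume "0 < e"
    then obtain n where n: "1 / real (Suc n) < e" using nat_approx_posE by blast
    have "J g \<le> J (H n)" unfolding J_def
    proof (rule integral_mono_AE[OF int[OF g] int[OF H(1)]])
      show "AE x in M. (g x)\<^sup>2 \<le> (H n x)\<^sup>2" using conv
        by eventually_elim (meson le order_trans power_mono)
    qed
    then show "J g \<le> I + e" using H(2)[of n] n by simp
  qed
  have "AE x in M. g x \<le> K x" if K: "K \<in> \<G>" for K
  proof -
    let ?m = "\<lambda>x. min (g x) (K x)"
    have m: "?m \<in> \<G>" by (rule min[OF g K])
    have ae: "AE x in M. 0 \<le> (g x)\<^sup>2 - (?m x)\<^sup>2"
      using conv nonneg[OF K] by eventually_elim (auto intro!: power_mono)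
    have "(\<integral>x. (g x)\<^sup>2 - (?m x)\<^sup>2 \<partial>M) = J g - J ?m" unfolding J_def using int[OF g] int[OF m] by simp
    also have "\<dots> \<le> 0" using I[OF m] \<open>J g \<le> I\<close> by simp
    finally have "(\<integral>x. (g x)\<^sup>2 - (?m x)\<^sup>2 \<partial>M) = 0" using integral_nonneg_AE[OF ae] by linarith
    then have "AE x in M. (g x)\<^sup>2 - (?m x)\<^sup>2 = 0"
      using integral_nonneg_eq_0_iff_AE[OF _ ae] int[OF g] int[OF m] by simp
    then show ?thesis using conv nonneg[OF K]
    proof eventually_elim
      case (elim x)
      then have "g x = ?m x" by (simp add: power2_eq_iff_nonneg)
      then show ?case by linarith
    qed
  qed
  with g that show thesis by blast
qed

section \<open>Measures finite on bounded sets, the setting shared by m and \<mu>\<close>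

locale boundedly_finite_measure =
  fixes M :: "'a::metric_space measure"
  assumes sets_M [measurable_cong]: "sets M = sets borel" and bf: "boundedly_finite M"
begin

lemma space_M [simp]: "space M = UNIV"
  using sets_eq_imp_space_eq[OF sets_M] by simp

lemma emeasure_bounded: "A \<in> sets borel \<Longrightarrow> bounded A \<Longrightarrow> emeasure M A < \<infinity>"
  using bf by (simp add: boundedly_finite_def sets_M)

end

sublocale boundedly_finite_measure \<subseteq> sigma_finite_measure M
proof
  define x0 :: 'a where "x0 = undefined"
  let ?A = "range (\<lambda>n::nat. cball x0 (real n))"
  have "\<exists>n::nat. dist x0 x \<le> real n" for x using real_arch_simple by blast
  then have "\<Union>?A = space M" by auto
  moreover have "\<forall>a\<in>?A. emeasure M a \<noteq> \<infinity>" using emeasure_bounded by (auto simp: less_top)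
  moreover have "?A \<subseteq> sets M" by (auto simp: sets_M)
  ultimately show "\<exists>A. countable A \<and> A \<subseteq> sets M \<and> \<Union>A = space M \<and> (\<forall>a\<in>A. emeasure M a \<noteq> \<infinity>)"
    by (intro exI[of _ ?A]) auto
qed

section \<open>The asymptotic Lipschitz constant\<close>

lemma lip_a_nonneg: "0 \<le> lip_a f x"
proof (cases "x isolated_in UNIV")
  case False
  let ?F = "inf (nhds x \<times>\<^sub>F nhds x) (principal {(y, z). y \<noteq> z})"
  let ?g = "\<lambda>(y, z). ereal (\<bar>f y - f z\<bar> / dist y z)"
  have "Limsup ?F ?g = -\<infinity> \<or> 0 \<le> Limsup ?F ?g"
  \<comment> \<open>On the trivial filter the upper limit is -\<infinity>, which
    \<open>real_of_ereal\<close> sends to 0, as it does with \<infinity>; so the sign is right for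
    every f.\<close>
  proof (cases "?F = bot")
    case True
    then show ?thesis by (simp add: bot_ereal_def)
  next
    case False
    have "0 \<le> Limsup ?F ?g" by (rule le_Limsup[OF False]) (auto simp: case_prod_beta)
    then show ?thesis ..
  qed
  with False show ?thesis unfolding lip_a_def by (auto simp: real_of_ereal_pos)
qed (simp add: lip_a_def)

lemma eventually_lip_filter:
  "eventually P (inf (nhds x \<times>\<^sub>F nhds x) (principal {(y, z). y \<noteq> z})) \<longleftrightarrow>
   (\<exists>r>0. \<forall>y\<in>ball x r. \<forall>z\<in>ball x r. y \<noteq> z \<longrightarrow> P (y, z))"
  for x :: "'a::metric_space"
proof
  assume "eventually P (inf (nhds x \<times>\<^sub>F nhds x) (principal {(y, z). y \<noteq> z}))"
  then have "eventually (\<lambda>p. p \<in> {(y, z). y \<noteq> z} \<longrightarrow> P p) (nhds x \<times>\<^sub>F nhds x)"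
    by (simp add: eventually_inf_principal)
  then obtain Pf Pg where PP: "eventually Pf (nhds x)" "eventually Pg (nhds x)"
    "\<And>y z. Pf y \<Longrightarrow> Pg z \<Longrightarrow> y \<noteq> z \<Longrightarrow> P (y, z)"
    unfolding eventually_prod_filter by auto
  from eventually_conj[OF PP(1,2)] obtain r where "r > 0" "\<And>y. dist y x < r \<Longrightarrow> Pf y \<and> Pg y"
    unfolding eventually_nhds_metric by auto
  then show "\<exists>r>0. \<forall>y\<in>ball x r. \<forall>z\<in>ball x r. y \<noteq> z \<longrightarrow> P (y, z)"
    using PP(3) by (intro exI[of _ r]) (auto simp: dist_commute)
next
  assume "\<exists>r>0. \<forall>y\<in>ball x r. \<forall>z\<in>ball x r. y \<noteq> z \<longrightarrow> P (y, z)"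
  then obtain r where r: "r > 0" "\<And>y z. y\<in>ball x r \<Longrightarrow> z\<in>ball x r \<Longrightarrow> y \<noteq> z \<Longrightarrow> P (y, z)" by blast
  have "eventually (\<lambda>y. y \<in> ball x r) (nhds x)" using r(1) by (intro eventually_nhds_in_open) auto
  then show "eventually P (inf (nhds x \<times>\<^sub>F nhds x) (principal {(y, z). y \<noteq> z}))"
    unfolding eventually_inf_principal eventually_prod_filter using r(2) by auto
qed

lemma lip_a_le:
  assumes "L-lipschitz_on (ball x r) f" "r > 0"
  shows "lip_a f x \<le> L"
proof (cases "x isolated_in UNIV")
  case True
  then show ?thesis using lipschitz_on_nonneg[OF assms(1)] by (simp add: lip_a_def)
next
  case False
  let ?F = "inf (nhds x \<times>\<^sub>F nhds x) (principal {(y, z). y \<noteq> z})"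
  let ?g = "\<lambda>(y, z). ereal (\<bar>f y - f z\<bar> / dist y z)"
  have "Limsup ?F ?g \<le> ereal L"
  proof (rule Limsup_bounded)
    show "\<forall>\<^sub>F p in ?F. ?g p \<le> ereal L"
      unfolding eventually_lip_filter
      using assms lipschitz_onD[OF assms(1)] by (intro exI[of _ r]) (auto simp: dist_real_def field_simps)
  qed
  then have "real_of_ereal (Limsup ?F ?g) \<le> L"
    using lipschitz_on_nonneg[OF assms(1)] by (cases "Limsup ?F ?g") auto
  with False show ?thesis by (simp add: lip_a_def)
qed

lemma LIP_bdD: "f \<in> LIP_bd \<Longrightarrow> bounded B \<Longrightarrow> \<exists>L. L-lipschitz_on B f"
  by (simp add: LIP_bd_def)

text \<open>With \<open>lip_a_le\<close> this identifies \<open>lip_a f x\<close> as the infimum of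
  the Lipschitz constants of f on balls around x, the form in which it is used later. Membership in
  \<open>LIP_bd\<close> keeps the upper limit finite; otherwise \<open>real_of_ereal\<close> would
  turn \<infinity> into 0.\<close>

lemma lip_a_lessD:
  assumes f: "f \<in> LIP_bd" and c: "lip_a f x < c"
  obtains r where "r > 0" "c-lipschitz_on (ball x r) f"
proof (cases "x isolated_in UNIV")
  case True
  then obtain r where r: "r > 0" "\<And>y. dist x y < r \<Longrightarrow> y = x" by (auto simp: isolated_in_dist_Ex_iff)
  have "c-lipschitz_on (ball x r) f"
  proof (rule lipschitz_onI)
    fix y z assume "y \<in> ball x r" "z \<in> ball x r"
    then have "y = x" "z = x" using r(2) by auto
    then show "dist (f y) (f z) \<le> c * dist y z" by simp
  qed (use c lip_a_nonneg[of f x] in linarith)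
  with r(1) that show thesis by blast
next
  case False
  let ?F = "inf (nhds x \<times>\<^sub>F nhds x) (principal {(y, z). y \<noteq> z})"
  let ?g = "\<lambda>(y, z). ereal (\<bar>f y - f z\<bar> / dist y z)"
  obtain L where L: "L-lipschitz_on (ball x 1) f" using LIP_bdD[OF f bounded_ball] by blast
  have "Limsup ?F ?g \<le> ereal L"
  proof (rule Limsup_bounded)
    show "\<forall>\<^sub>F p in ?F. ?g p \<le> ereal L"
      unfolding eventually_lip_filter
      using lipschitz_onD[OF L] by (intro exI[of _ 1]) (auto simp: dist_real_def field_simps)
  qed
  then have "Limsup ?F ?g < ereal c"
    using c False lip_a_nonneg[of f x] by (cases "Limsup ?F ?g") (auto simp: lip_a_def)
  from Limsup_lessD[OF this] obtain r where r: "r > 0"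
    "\<And>y z. y\<in>ball x r \<Longrightarrow> z\<in>ball x r \<Longrightarrow> y \<noteq> z \<Longrightarrow> \<bar>f y - f z\<bar> / dist y z < c"
    unfolding eventually_lip_filter by auto
  have "c-lipschitz_on (ball x r) f"
  proof (rule lipschitz_onI)
    fix y z assume "y \<in> ball x r" "z \<in> ball x r"
    then show "dist (f y) (f z) \<le> c * dist y z"
      using r(2)[of y z] by (cases "y = z") (auto simp: dist_real_def field_simps less_imp_le)
  qed (use c lip_a_nonneg[of f x] in linarith)
  with r(1) that show thesis by blast
qed

lemma lip_a_leI:
  assumes "\<And>c. c > K \<Longrightarrow> \<exists>r>0. c-lipschitz_on (ball x r) f"
  shows "lip_a f x \<le> K"
proof (rule dense_ge)
  fix c assume "K < c"
  then show "lip_a f x \<le> c" using assms lip_a_le by blast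
qed

text \<open>The asymptotic constant is upper semicontinuous: a Lipschitz constant on a ball serves
  on smaller balls around each of its points. The intermediate value d keeps the inequality
  strict.\<close>

lemma borel_measurable_lip_a:
  assumes f: "f \<in> LIP_bd"
  shows "lip_a f \<in> borel_measurable borel"
proof (rule borel_measurableI_less)
  fix c
  have "open {x. lip_a f x < c}" unfolding open_contains_ball
  proof
    fix x assume "x \<in> {x. lip_a f x < c}"
    then obtain d where d: "lip_a f x < d" "d < c" using dense[of "lip_a f x" c] by auto
    obtain r where r: "r > 0" "d-lipschitz_on (ball x r) f" using lip_a_lessD[OF f d(1)] by blast
    have "lip_a f y < c" if y: "y \<in> ball x r" for y
    proof -
      obtain e where e: "e > 0" "ball y e \<subseteq> ball x r" by (rule openE[OF open_ball y])
      from lipschitz_on_subset[OF r(2) e(2)] have "lip_a f y \<le> d" using e(1) by (rule lip_a_le)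
      with d(2) show ?thesis by simp
    qed
    with r(1) show "\<exists>e>0. ball x e \<subseteq> {x. lip_a f x < c}" by auto
  qed
  then show "{x \<in> space borel. lip_a f x < c} \<in> sets borel" by simp
qed

lemma LIP_bd_continuous:
  fixes f :: "'a::metric_space \<Rightarrow> real"
  assumes f: "f \<in> LIP_bd" shows "continuous_on UNIV f"
proof -
  have "isCont f x" for x
  proof -
    obtain L where L: "L-lipschitz_on (ball x 1) f" using LIP_bdD[OF f bounded_ball] by blast
    then have "continuous_on (ball x 1) f" by (rule lipschitz_on_continuous_on)
    then show ?thesis by (simp add: continuous_on_eq_continuous_at)
  qed
  then show ?thesis by (simp add: continuous_at_imp_continuous_on)
qed

lemma LIP_bd_measurable: "f \<in> LIP_bd \<Longrightarrow> f \<in> borel_measurable borel"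
  by (intro borel_measurable_continuous_onI LIP_bd_continuous)

section \<open>Operations on Lipschitz functions and their slopes\<close>

lemma lipschitz_on_max:
  fixes f g :: "'a::metric_space \<Rightarrow> real"
  assumes "L-lipschitz_on S f" "K-lipschitz_on S g"
  shows "(max L K)-lipschitz_on S (\<lambda>x. max (f x) (g x))"
proof (rule lipschitz_onI)
  fix x y assume xy: "x \<in> S" "y \<in> S"
  have "\<bar>max (f x) (g x) - max (f y) (g y)\<bar> \<le> max \<bar>f x - f y\<bar> \<bar>g x - g y\<bar>" by linarith
  also have "\<dots> \<le> max (L * dist x y) (K * dist x y)"
    using lipschitz_onD[OF assms(1) xy] lipschitz_onD[OF assms(2) xy] by (auto simp: dist_real_def)
  also have "\<dots> = max L K * dist x y" by (simp add: max_mult_distrib_right)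
  finally show "dist (max (f x) (g x)) (max (f y) (g y)) \<le> max L K * dist x y" by (simp add: dist_real_def)
qed (use lipschitz_on_nonneg[OF assms(1)] in auto)

lemma lipschitz_on_min:
  fixes f g :: "'a::metric_space \<Rightarrow> real"
  assumes "L-lipschitz_on S f" "K-lipschitz_on S g"
  shows "(max L K)-lipschitz_on S (\<lambda>x. min (f x) (g x))"
proof -
  have "(\<lambda>x. min (f x) (g x)) = (\<lambda>x. - max (- f x) (- g x))" by (auto simp: min_def max_def)
  moreover have "(max L K)-lipschitz_on S (\<lambda>x. - max (- f x) (- g x))"
    by (intro lipschitz_on_minus lipschitz_on_max assms)
  ultimately show ?thesis by (simp only:)
qed

lemma LIP_bd_max: "f \<in> LIP_bd \<Longrightarrow> g \<in> LIP_bd \<Longrightarrow> (\<lambda>x. max (f x) (g x)) \<in> LIP_bd"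
  unfolding LIP_bd_def by (blast intro: lipschitz_on_max)

lemma LIP_bd_min: "f \<in> LIP_bd \<Longrightarrow> g \<in> LIP_bd \<Longrightarrow> (\<lambda>x. min (f x) (g x)) \<in> LIP_bd"
  unfolding LIP_bd_def by (blast intro: lipschitz_on_min)

lemma LIP_bd_add: "f \<in> LIP_bd \<Longrightarrow> g \<in> LIP_bd \<Longrightarrow> (\<lambda>x. f x + g x) \<in> LIP_bd"
  unfolding LIP_bd_def by (blast intro: lipschitz_on_add)

lemma LIP_bd_cmult: "f \<in> LIP_bd \<Longrightarrow> (\<lambda>x. c * f x) \<in> LIP_bd"
  unfolding LIP_bd_def by (blast intro: lipschitz_on_cmult_real)

lemma LIP_bd_minus: "f \<in> LIP_bd \<Longrightarrow> (\<lambda>x. - f x) \<in> LIP_bd"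
  unfolding LIP_bd_def by (blast intro: lipschitz_on_minus)

lemma LIP_bd_diff: "f \<in> LIP_bd \<Longrightarrow> g \<in> LIP_bd \<Longrightarrow> (\<lambda>x. f x - g x) \<in> LIP_bd"
  unfolding LIP_bd_def by (blast intro: lipschitz_on_diff)

lemma LIP_bd_const: "(\<lambda>_. c) \<in> LIP_bd"
  unfolding LIP_bd_def by (blast intro: lipschitz_on_constant)

lemma LIP_bd_sum: "(\<And>i. i \<in> I \<Longrightarrow> f i \<in> LIP_bd) \<Longrightarrow> (\<lambda>x. \<Sum>i\<in>I. f i x) \<in> LIP_bd"
  by (induction I rule: infinite_finite_induct) (auto intro: LIP_bd_const LIP_bd_add)

lemma LIP_subset_LIP_bd: "LIP \<subseteq> LIP_bd"
  unfolding LIP_def LIP_bd_def using lipschitz_on_subset by blast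

lemma LIP_bd_comp:
  assumes "L-lipschitz_on UNIV p" "f \<in> LIP_bd" shows "(\<lambda>x. p (f x)) \<in> LIP_bd"
  unfolding LIP_bd_def
proof (intro CollectI allI impI)
  fix B :: "'a set" assume "bounded B"
  then obtain K where "K-lipschitz_on B f" using LIP_bdD assms(2) by blast
  from lipschitz_on_compose2[OF this lipschitz_on_subset[OF assms(1)]]
  show "\<exists>L. L-lipschitz_on B (\<lambda>x. p (f x))" by auto
qed

lemma lip_a_combine:
  assumes f: "f \<in> LIP_bd" and g: "g \<in> LIP_bd"
    and c: "\<And>S L K. L-lipschitz_on S f \<Longrightarrow> K-lipschitz_on S g \<Longrightarrow> (max L K)-lipschitz_on S h"
  shows "lip_a h x \<le> max (lip_a f x) (lip_a g x)"
proof (rule lip_a_leI)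
  fix d assume d: "max (lip_a f x) (lip_a g x) < d"
  obtain r where r: "r > 0" "d-lipschitz_on (ball x r) f" using lip_a_lessD[OF f, of x d] d by auto
  obtain s where s: "s > 0" "d-lipschitz_on (ball x s) g" using lip_a_lessD[OF g, of x d] d by auto
  have "ball x (min r s) \<subseteq> ball x r" "ball x (min r s) \<subseteq> ball x s" by auto
  from c[OF lipschitz_on_subset[OF r(2) this(1)] lipschitz_on_subset[OF s(2) this(2)]]
  show "\<exists>r>0. d-lipschitz_on (ball x r) h" using r(1) s(1) by (intro exI[of _ "min r s"]) auto
qed

lemma lip_a_max: "f \<in> LIP_bd \<Longrightarrow> g \<in> LIP_bd \<Longrightarrow> lip_a (\<lambda>x. max (f x) (g x)) x \<le> max (lip_a f x) (lip_a g x)"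
  by (rule lip_a_combine) (auto intro: lipschitz_on_max)

lemma lip_a_min: "f \<in> LIP_bd \<Longrightarrow> g \<in> LIP_bd \<Longrightarrow> lip_a (\<lambda>x. min (f x) (g x)) x \<le> max (lip_a f x) (lip_a g x)"
  by (rule lip_a_combine) (auto intro: lipschitz_on_min)

lemma lip_a_add:
  assumes f: "f \<in> LIP_bd" and g: "g \<in> LIP_bd"
  shows "lip_a (\<lambda>x. f x + g x) x \<le> lip_a f x + lip_a g x"
proof (rule lip_a_leI)
  fix d assume d: "lip_a f x + lip_a g x < d"
  define e where "e = (d - (lip_a f x + lip_a g x)) / 2"
  have e: "e > 0" using d by (simp add: e_def)
  obtain r where r: "r > 0" "(lip_a f x + e)-lipschitz_on (ball x r) f" using lip_a_lessD[OF f] e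
    by (metis less_add_same_cancel1)
  obtain s where s: "s > 0" "(lip_a g x + e)-lipschitz_on (ball x s) g" using lip_a_lessD[OF g] e
    by (metis less_add_same_cancel1)
  have "ball x (min r s) \<subseteq> ball x r" "ball x (min r s) \<subseteq> ball x s" by auto
  from lipschitz_on_add[OF lipschitz_on_subset[OF r(2) this(1)] lipschitz_on_subset[OF s(2) this(2)]]
  have "d-lipschitz_on (ball x (min r s)) (\<lambda>x. f x + g x)" by (simp add: e_def field_simps)
  then show "\<exists>r>0. d-lipschitz_on (ball x r) (\<lambda>x. f x + g x)" using r(1) s(1) by (intro exI[of _ "min r s"]) auto
qed

lemma lip_a_const [simp]: "lip_a (\<lambda>_. c) x = 0"
  using lip_a_le[OF lipschitz_on_constant[of "ball x 1" c]] lip_a_nonneg[of "\<lambda>_. c" x] by simp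

lemma lip_a_cmult:
  assumes f: "f \<in> LIP_bd"
  shows "lip_a (\<lambda>x. c * f x) x \<le> \<bar>c\<bar> * lip_a f x"
proof (cases "c = 0")
  case False
  show ?thesis
  proof (rule lip_a_leI)
    fix d assume "\<bar>c\<bar> * lip_a f x < d"
    then have "lip_a f x < d / \<bar>c\<bar>" using False by (simp add: field_simps)
    then obtain r where r: "r > 0" "(d / \<bar>c\<bar>)-lipschitz_on (ball x r) f" using lip_a_lessD[OF f] by blast
    from lipschitz_on_cmult_real[OF r(2), of c] have "d-lipschitz_on (ball x r) (\<lambda>x. c * f x)" using False by simp
    with r(1) show "\<exists>r>0. d-lipschitz_on (ball x r) (\<lambda>x. c * f x)" by blast
  qed
qed simp

lemma lip_a_minus: "f \<in> LIP_bd \<Longrightarrow> lip_a (\<lambda>x. - f x) x \<le> lip_a f x"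
  using lip_a_cmult[of f "-1" x] by simp

lemma lip_a_diff:
  assumes "f \<in> LIP_bd" "g \<in> LIP_bd"
  shows "lip_a (\<lambda>x. f x - g x) x \<le> lip_a f x + lip_a g x"
  using lip_a_add[OF assms(1) LIP_bd_minus[OF assms(2)], of x] lip_a_minus[OF assms(2), of x] by simp

lemma lip_a_sum:
  "(\<And>i. i \<in> I \<Longrightarrow> f i \<in> LIP_bd) \<Longrightarrow> lip_a (\<lambda>x. \<Sum>i\<in>I. f i x) x \<le> (\<Sum>i\<in>I. lip_a (f i) x)"
proof (induction I rule: infinite_finite_induct)
  case (insert i I)
  then show ?case using lip_a_add[of "f i" "\<lambda>x. \<Sum>i\<in>I. f i x" x] LIP_bd_sum[of I f] by auto
qed auto

lemma lip_a_comp: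
  assumes p: "1-lipschitz_on UNIV p" and f: "f \<in> LIP_bd"
  shows "lip_a (\<lambda>x. p (f x)) x \<le> lip_a f x"
proof (rule lip_a_leI)
  fix d assume "lip_a f x < d"
  then obtain r where r: "r > 0" "d-lipschitz_on (ball x r) f" using lip_a_lessD[OF f] by blast
  from lipschitz_on_compose2[OF r(2) lipschitz_on_subset[OF p]]
  show "\<exists>r>0. d-lipschitz_on (ball x r) (\<lambda>x. p (f x))" using r(1) by auto
qed

lemma lip_a_cong_open:
  assumes f: "f \<in> LIP_bd" and U: "open U" "x \<in> U" "\<And>y. y \<in> U \<Longrightarrow> g y = f y"
  shows "lip_a g x \<le> lip_a f x"
proof (rule lip_a_leI)
  fix d assume "lip_a f x < d"
  then obtain r where r: "r > 0" "d-lipschitz_on (ball x r) f" using lip_a_lessD[OF f] by blast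
  obtain s where s: "s > 0" "ball x s \<subseteq> U" by (rule openE[OF U(1,2)])
  have "ball x (min r s) \<subseteq> ball x r" by auto
  from lipschitz_on_subset[OF r(2) this] have "d-lipschitz_on (ball x (min r s)) f" .
  then have "d-lipschitz_on (ball x (min r s)) g"
    by (rule lipschitz_on_transform) (use U(3) s in auto)
  then show "\<exists>r>0. d-lipschitz_on (ball x r) g" using r(1) s(1) by (intro exI[of _ "min r s"]) auto
qed

lemma lip_a_eq_0:
  assumes "open U" "x \<in> U" "\<And>y. y \<in> U \<Longrightarrow> g y = c"
  shows "lip_a g x = 0"
  using lip_a_cong_open[OF LIP_bd_const[of c], of U x g] assms lip_a_nonneg[of g x] by simp

lemma lipschitz_on_infdist: "1-lipschitz_on S (\<lambda>x. infdist x A)"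
  by (rule lipschitz_onI) (auto simp: dist_real_def intro: infdist_triangle_abs)

lemma McShane_extension:
  fixes f :: "'a::metric_space \<Rightarrow> real"
  assumes f: "L-lipschitz_on B f"
  obtains g where "L-lipschitz_on UNIV g" "\<And>x. x \<in> B \<Longrightarrow> g x = f x"
proof (cases "B = {}")
  \<comment> \<open>McShane's infimum says nothing over an empty set, so a constant function is
    taken.\<close>
  case True
  then show thesis using that[of "\<lambda>_. 0"] lipschitz_on_nonneg[OF f] lipschitz_on_mono[OF lipschitz_on_constant[of UNIV "0::real"], of UNIV L] by auto
next
  case False
  have L: "L \<ge> 0" by (rule lipschitz_on_nonneg[OF f])
  obtain b where b: "b \<in> B" using False by blast
  define g where "g x = (INF z\<in>B. f z + L * dist x z)" for x
  have bd: "f b - L * dist x b \<le> f z + L * dist x z" if "z \<in> B" for x z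
  proof -
    have "f b - f z \<le> L * dist b z" using lipschitz_onD[OF f b that] by (simp add: dist_real_def)
    also have "\<dots> \<le> L * (dist x b + dist x z)" by (intro mult_left_mono L dist_triangle3)
    finally show ?thesis by (simp add: algebra_simps)
  qed
  then have bdd: "bdd_below ((\<lambda>z. f z + L * dist x z) ` B)" for x by (intro bdd_belowI2) auto
  have le: "g x \<le> g y + L * dist x y" for x y
  proof -
    have "g x - L * dist x y \<le> g y" unfolding g_def[of y]
    proof (rule cINF_greatest[OF False])
      fix z assume "z \<in> B"
      then have "g x \<le> f z + L * dist x z" unfolding g_def by (rule cINF_lower[OF bdd])
      also have "\<dots> \<le> f z + L * (dist x y + dist y z)" using L by (intro add_left_mono mult_left_mono dist_triangle)
      finally show "g x - L * dist x y \<le> f z + L * dist y z" by (simp add: algebra_simps)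
    qed
    then show ?thesis by simp
  qed
  have "L-lipschitz_on UNIV g"
  proof (rule lipschitz_onI[OF _ L])
    fix x y show "dist (g x) (g y) \<le> L * dist x y"
      using le[of x y] le[of y x] by (simp add: dist_real_def dist_commute abs_le_iff)
  qed
  moreover have "g x = f x" if "x \<in> B" for x
  proof (rule antisym)
    show "g x \<le> f x" unfolding g_def using cINF_lower[OF bdd[of x] that] by simp
    show "f x \<le> g x" unfolding g_def
    proof (rule cINF_greatest[OF False])
      fix z assume "z \<in> B"
      from lipschitz_onD[OF f that this] show "f x \<le> f z + L * dist x z" by (simp add: dist_real_def)
    qed
  qed
  ultimately show thesis using that by blast
qed

section \<open>Convex combinations of tails\<close>

text \<open>Weights are functions on all of nat, so that mixing is pointwise and the sets decrease
  in N; the condition below N is what preserves limits under \<open>comb\<close>.\<close>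

definition tail_weights :: "nat \<Rightarrow> (nat \<Rightarrow> real) set" where
  "tail_weights N = {l. (\<forall>i. 0 \<le> l i) \<and> finite {i. l i \<noteq> 0} \<and> (\<forall>i<N. l i = 0) \<and> (\<Sum>i\<in>{i. l i \<noteq> 0}. l i) = 1}"

definition comb :: "(nat \<Rightarrow> real) \<Rightarrow> (nat \<Rightarrow> 'c \<Rightarrow> real) \<Rightarrow> 'c \<Rightarrow> real" where
  "comb l a x = (\<Sum>i\<in>{i. l i \<noteq> 0}. l i * a i x)"

definition mix :: "real \<Rightarrow> (nat \<Rightarrow> real) \<Rightarrow> (nat \<Rightarrow> real) \<Rightarrow> nat \<Rightarrow> real" where
  "mix t l l' i = (1 - t) * l i + t * l' i"

lemma comb_superset:
  assumes "finite S" "{i. l i \<noteq> 0} \<subseteq> S"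
  shows "comb l a x = (\<Sum>i\<in>S. l i * a i x)"
  unfolding comb_def using assms by (intro sum.mono_neutral_left) auto

lemma comb_mix:
  assumes "finite {i. l i \<noteq> 0}" "finite {i. l' i \<noteq> 0}"
  shows "comb (mix t l l') a x = (1 - t) * comb l a x + t * comb l' a x"
proof -
  let ?S = "{i. l i \<noteq> 0} \<union> {i. l' i \<noteq> 0}"
  have S: "finite ?S" using assms by simp
  have "comb (mix t l l') a x = (\<Sum>i\<in>?S. mix t l l' i * a i x)"
    by (rule comb_superset[OF S]) (auto simp: mix_def)
  moreover have "comb l a x = (\<Sum>i\<in>?S. l i * a i x)" by (rule comb_superset[OF S]) auto
  moreover have "comb l' a x = (\<Sum>i\<in>?S. l' i * a i x)" by (rule comb_superset[OF S]) auto
  ultimately show ?thesis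
    by (simp add: mix_def algebra_simps sum.distrib sum_subtractf sum_distrib_left)
qed

lemma comb_1:
  "l \<in> tail_weights N \<Longrightarrow> comb l (\<lambda>_ _. 1) x = 1"
  by (simp add: comb_def tail_weights_def)

lemma tail_weights_finite: "l \<in> tail_weights N \<Longrightarrow> finite {i. l i \<noteq> 0}"
  by (simp add: tail_weights_def)

lemma mix_tail_weights:
  assumes l: "l \<in> tail_weights N" and l': "l' \<in> tail_weights N" and t: "0 \<le> t" "t \<le> 1"
  shows "mix t l l' \<in> tail_weights N"
proof -
  have "comb (mix t l l') (\<lambda>_ _. 1) () = 1"
    by (simp only: comb_mix[OF tail_weights_finite[OF l] tail_weights_finite[OF l']] comb_1[OF l] comb_1[OF l']) simp
  moreover have "finite {i. mix t l l' i \<noteq> 0}"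
    by (rule finite_subset[of _ "{i. l i \<noteq> 0} \<union> {i. l' i \<noteq> 0}"])
       (use l l' in \<open>auto simp: mix_def tail_weights_def\<close>)
  ultimately show ?thesis using l l' t by (auto simp: tail_weights_def comb_def mix_def)
qed

lemma unit_tail_weights: "N \<le> n \<Longrightarrow> (\<lambda>i. if i = n then 1 else 0) \<in> tail_weights N"
  by (auto simp: tail_weights_def)

lemma comb_unit [simp]: "comb (\<lambda>i. if i = n then 1 else 0) a x = a n x"
  by (simp add: comb_def)

lemma tail_weights_antimono: "m \<le> n \<Longrightarrow> tail_weights n \<subseteq> tail_weights m"
  by (auto simp: tail_weights_def)

lemma comb_mono:
  assumes l: "l \<in> tail_weights N" and "\<And>i. i \<ge> N \<Longrightarrow> a i x \<le> b i y"
  shows "comb l a x \<le> comb l b y"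
  unfolding comb_def
proof (rule sum_mono)
  fix i assume i: "i \<in> {i. l i \<noteq> 0}"
  with l have "i \<ge> N" "0 \<le> l i" by (auto simp: tail_weights_def not_less[symmetric])
  then show "l i * a i x \<le> l i * b i y" using assms(2) by (intro mult_left_mono) auto
qed

lemma comb_const: "l \<in> tail_weights N \<Longrightarrow> comb l (\<lambda>_ _. c) x = c"
  using sum_distrib_right[of l "{i. l i \<noteq> 0}" c] by (simp add: comb_def tail_weights_def)

lemma comb_add: "comb l (\<lambda>i x. a i x + b i x) x = comb l a x + comb l b x"
  by (simp add: comb_def algebra_simps sum.distrib)

lemma comb_tendsto:
  assumes l: "\<And>n. l n \<in> tail_weights n" and a: "(\<lambda>i. a i x) \<longlonglongrightarrow> c"
  shows "(\<lambda>n. comb (l n) a x) \<longlonglongrightarrow> c"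
proof (rule LIMSEQ_I)
  fix r :: real assume "0 < r"
  then have "r / 2 > 0" by simp
  from LIMSEQ_D[OF a this] obtain N where N: "\<And>i. i \<ge> N \<Longrightarrow> \<bar>a i x - c\<bar> < r / 2" by auto
  have "norm (comb (l n) a x - c) < r" if "n \<ge> N" for n
  proof -
    have "comb (l n) a x \<le> comb (l n) (\<lambda>_ _. c + r / 2) x"
      by (rule comb_mono[OF l]) (use N that in \<open>smt (verit) order_trans\<close>)
    moreover have "comb (l n) (\<lambda>_ _. c - r / 2) x \<le> comb (l n) a x"
      by (rule comb_mono[OF l]) (use N that in \<open>smt (verit) order_trans\<close>)
    ultimately have "c - r / 2 \<le> comb (l n) a x" "comb (l n) a x \<le> c + r / 2"
      by (simp_all add: comb_const[OF l])
    then show ?thesis using \<open>0 < r\<close> unfolding real_norm_def by linarith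
  qed
  then show "\<exists>no. \<forall>n\<ge>no. norm (comb (l n) a x - c) < r" by blast
qed

lemma comb_measurable:
  "(\<And>i. a i \<in> borel_measurable M) \<Longrightarrow> comb l a \<in> borel_measurable M"
  unfolding comb_def[abs_def] by (intro borel_measurable_sum borel_measurable_times) auto

lemma comb_L2: "(\<And>i. a i \<in> L2 M) \<Longrightarrow> comb l a \<in> L2 M"
  unfolding comb_def[abs_def] by (intro L2_sum L2_cmult)

lemma comb_LIP_bd: "(\<And>i. f i \<in> LIP_bd) \<Longrightarrow> comb l f \<in> LIP_bd"
  unfolding comb_def[abs_def] by (intro LIP_bd_sum LIP_bd_cmult)

lemma lip_a_comb:
  assumes l: "l \<in> tail_weights N" and f: "\<And>i. f i \<in> LIP_bd"
  shows "lip_a (comb l f) x \<le> comb l (\<lambda>i. lip_a (f i)) x"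
proof -
  have "lip_a (comb l f) x \<le> (\<Sum>i\<in>{i. l i \<noteq> 0}. lip_a (\<lambda>x. l i * f i x) x)"
    unfolding comb_def[abs_def] by (intro lip_a_sum LIP_bd_cmult f)
  also have "\<dots> \<le> (\<Sum>i\<in>{i. l i \<noteq> 0}. \<bar>l i\<bar> * lip_a (f i) x)"
    by (intro sum_mono lip_a_cmult f)
  also have "\<dots> = comb l (\<lambda>i. lip_a (f i)) x"
    unfolding comb_def using l by (intro sum.cong) (auto simp: tail_weights_def)
  finally show ?thesis .
qed

text \<open>Jensen's inequality for the square, from the nonnegativity of the variance around the
  mean \<open>m\<close>.\<close>

lemma comb_power2_le:
  assumes l: "l \<in> tail_weights N"
  shows "(comb l a x)\<^sup>2 \<le> comb l (\<lambda>i x. (a i x)\<^sup>2) x"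
proof -
  define m where "m = comb l a x"
  have "0 \<le> comb l (\<lambda>i x. (a i x - m)\<^sup>2) x"
    using l by (auto simp: comb_def tail_weights_def intro!: sum_nonneg)
  also have "\<dots> = comb l (\<lambda>i x. (a i x)\<^sup>2) x - 2 * m * comb l a x + m\<^sup>2 * comb l (\<lambda>_ _. 1) x"
    by (simp add: comb_def power2_diff algebra_simps sum.distrib sum_subtractf sum_distrib_left)
  also have "\<dots> = comb l (\<lambda>i x. (a i x)\<^sup>2) x - m\<^sup>2"
    by (simp only: comb_1[OF l]) (simp add: m_def power2_eq_square)
  finally show ?thesis by (simp add: m_def)
qed

lemma sqn_comb_le:
  assumes l: "l \<in> tail_weights N" and [measurable]: "\<And>i. a i \<in> borel_measurable M"
    and e: "\<And>i. i \<ge> N \<Longrightarrow> sqn M (a i) \<le> ennreal e" and e0: "0 \<le> e"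
  shows "sqn M (comb l a) \<le> ennreal e"
proof -
  have l0: "0 \<le> l i" for i using l by (simp add: tail_weights_def)
  have "sqn M (comb l a) \<le> (\<integral>\<^sup>+x. (\<Sum>i\<in>{i. l i \<noteq> 0}. ennreal (l i) * ennreal ((a i x)\<^sup>2)) \<partial>M)"
    unfolding sqn_def
  proof (rule nn_integral_mono)
    fix x
    have "ennreal ((comb l a x)\<^sup>2) \<le> ennreal (comb l (\<lambda>i x. (a i x)\<^sup>2) x)"
      by (intro ennreal_leI comb_power2_le[OF l])
    also have "\<dots> = (\<Sum>i\<in>{i. l i \<noteq> 0}. ennreal (l i * (a i x)\<^sup>2))"
      unfolding comb_def by (rule sum_ennreal[symmetric]) (use l0 in auto)
    finally show "ennreal ((comb l a x)\<^sup>2) \<le> (\<Sum>i\<in>{i. l i \<noteq> 0}. ennreal (l i) * ennreal ((a i x)\<^sup>2))"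
      by (simp add: ennreal_mult l0)
  qed
  also have "\<dots> = (\<Sum>i\<in>{i. l i \<noteq> 0}. ennreal (l i) * sqn M (a i))"
    by (simp add: nn_integral_sum nn_integral_cmult sqn_def)
  also have "\<dots> \<le> (\<Sum>i\<in>{i. l i \<noteq> 0}. ennreal (l i * e))"
  proof (rule sum_mono)
    fix i assume "i \<in> {i. l i \<noteq> 0}"
    then have "i \<ge> N" using l by (auto simp: tail_weights_def not_less[symmetric])
    from mult_left_mono[OF e[OF this], of "ennreal (l i)"]
    show "ennreal (l i) * sqn M (a i) \<le> ennreal (l i * e)" by (simp add: ennreal_mult l0 e0)
  qed
  also have "\<dots> = ennreal (comb l (\<lambda>_ _. e) ())"
    unfolding comb_def by (rule sum_ennreal) (use l0 e0 in auto)
  also have "\<dots> = ennreal e" by (simp only: comb_const[OF l])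
  finally show ?thesis .
qed

lemma sqn_comb_tendsto:
  assumes l: "\<And>n. l n \<in> tail_weights n" and a: "\<And>i. a i \<in> borel_measurable M"
    and z: "(\<lambda>i. sqn M (a i)) \<longlonglongrightarrow> 0"
  shows "(\<lambda>n. sqn M (comb (l n) a)) \<longlonglongrightarrow> 0"
  unfolding tendsto_0_ennreal_iff
proof (intro allI impI)
  fix e :: real assume "e > 0"
  then have "eventually (\<lambda>i. sqn M (a i) < ennreal (e/2)) sequentially"
    using z unfolding tendsto_0_ennreal_iff by simp
  then obtain N where N: "\<And>i. i \<ge> N \<Longrightarrow> sqn M (a i) < ennreal (e/2)" by (auto simp: eventually_sequentially)
  have "sqn M (comb (l n) a) < ennreal e" if "n \<ge> N" for n
  proof -
    have "sqn M (comb (l n) a) \<le> ennreal (e/2)"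
      by (rule sqn_comb_le[OF l a]) (use N that \<open>e > 0\<close> in \<open>auto intro: less_imp_le\<close>)
    also have "\<dots> < ennreal e" using \<open>e > 0\<close> by (simp add: ennreal_less_iff)
    finally show ?thesis .
  qed
  then show "\<forall>\<^sub>F n in sequentially. sqn M (comb (l n) a) < ennreal e"
    by (auto simp: eventually_sequentially)
qed

text \<open>The infima over the decreasing sets \<open>C n\<close> increase and stay below
  \<open>B\<close>, hence form a Cauchy sequence. Near-minimisers from late sets lie in a common
  earlier set together with their midpoint, whose value cannot drop below the infimum there; so the
  convexity gap bounding \<open>D\<close> is small. It is applied to three functionals: a squared
  distance (\<open>L2_Mazur\<close>), the energy of \<open>lip_a\<close>
  (\<open>lip_a_tendsto_min\<close>) and an integral of exponentials
  (\<open>nonneg_convex_combinations\<close>).\<close>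

lemma near_minimisers:
  fixes J :: "'c \<Rightarrow> real" and D :: "'c \<Rightarrow> 'c \<Rightarrow> real"
  assumes anti: "\<And>m n::nat. m \<le> n \<Longrightarrow> C n \<subseteq> C m"
    and B: "\<And>n. \<exists>x\<in>C n. J x \<le> B" and J0: "\<And>x. x \<in> C 0 \<Longrightarrow> 0 \<le> J x"
    and mid: "\<And>n x y. x \<in> C n \<Longrightarrow> y \<in> C n \<Longrightarrow> mid x y \<in> C n"
    and D: "\<And>x y. x \<in> C 0 \<Longrightarrow> y \<in> C 0 \<Longrightarrow> D x y \<le> J x + J y - 2 * J (mid x y)"
  obtains x where "\<And>n. x n \<in> C n" "\<And>n y. y \<in> C n \<Longrightarrow> J (x n) \<le> J y + 1 / real (Suc n)"
    "\<And>e. e > 0 \<Longrightarrow> \<exists>N. \<forall>m\<ge>N. \<forall>n\<ge>N. D (x m) (x n) < e"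
proof -
  define d where "d n = Inf (J ` C n)" for n
  have sub: "C n \<subseteq> C 0" for n by (rule anti) simp
  have ne: "C n \<noteq> {}" for n using B by blast
  have bdd: "bdd_below (J ` C n)" for n using sub J0 by (intro bdd_belowI[of _ 0]) auto
  have dle: "d n \<le> J y" if "y \<in> C n" for n y unfolding d_def using bdd that by (intro cInf_lower) auto
  have dB: "d n \<le> B" for n using B[of n] dle order_trans by blast
  have inc: "incseq d"
    unfolding incseq_def d_def using anti ne bdd by (intro allI impI cInf_superset_mono) (auto intro!: image_mono)
  have "bdd_above (range d)" by (rule bdd_aboveI2) (rule dB)
  with inc have "convergent d" by (meson LIMSEQ_incseq_SUP convergentI)
  then have Cd: "Cauchy d" by (rule convergent_Cauchy)
  have "\<exists>x\<in>C n. J x < d n + 1 / real (Suc n)" for n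
  proof -
    have "Inf (J ` C n) < d n + 1 / real (Suc n)" by (simp add: d_def)
    then show ?thesis using ne[of n] by (subst (asm) cInf_less_iff[OF _ bdd]) auto
  qed
  then obtain x where x: "\<And>n. x n \<in> C n" "\<And>n. J (x n) < d n + 1 / real (Suc n)" by metis
  have "\<exists>N. \<forall>m\<ge>N. \<forall>n\<ge>N. D (x m) (x n) < e" if e: "e > 0" for e
  proof -
    \<comment> \<open>Four quarters of e are spent: two on the differences of infima and two on the
      near-minimality errors.\<close>
    obtain N1 where N1: "\<And>m n. m \<ge> N1 \<Longrightarrow> n \<ge> N1 \<Longrightarrow> \<bar>d m - d n\<bar> < e / 4"
      using CauchyD[OF Cd, of "e/4"] e by auto
    obtain N2 where N2: "1 / real (Suc N2) < e / 4" using nat_approx_posE[of "e/4"] e by auto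
    let ?N = "max N1 N2"
    have "D (x m) (x n) < e" if m: "m \<ge> ?N" and n: "n \<ge> ?N" for m n
    proof -
      have xm: "x m \<in> C ?N" "x n \<in> C ?N" using x(1) anti m n by blast+
      then have "d ?N \<le> J (mid (x m) (x n))" by (intro dle mid)
      moreover have "D (x m) (x n) \<le> J (x m) + J (x n) - 2 * J (mid (x m) (x n))" using xm sub by (intro D) auto
      moreover have inv: "1 / real (Suc k) < e / 4" if "k \<ge> N2" for k
        by (rule le_less_trans[OF frac_le N2]) (use that in auto)
      moreover have "1 / real (Suc m) < e / 4" "1 / real (Suc n) < e / 4"
        using inv m n by simp_all
      moreover have "\<bar>d m - d ?N\<bar> < e / 4" "\<bar>d n - d ?N\<bar> < e / 4" using N1 m n by auto
      ultimately show ?thesis using x(2)[of m] x(2)[of n] by linarith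
    qed
    then show ?thesis by blast
  qed
  moreover have "J (x n) \<le> J y + 1 / real (Suc n)" if "y \<in> C n" for n y
    using x(2)[of n] dle[OF that] by linarith
  ultimately show thesis using x(1) that by blast
qed

section \<open>Norms, midpoints and Mazur's lemma in L2\<close>

lemma L2_norm_tendsto:
  assumes q: "\<And>k. q k \<in> L2 M" and q0: "q0 \<in> L2 M" and l: "(\<lambda>k. sqn M (\<lambda>x. q k x - q0 x)) \<longlonglongrightarrow> 0"
  shows "(\<lambda>k. \<integral>x. (q k x)\<^sup>2 \<partial>M) \<longlonglongrightarrow> (\<integral>x. (q0 x)\<^sup>2 \<partial>M)"
proof -
  have d: "(\<lambda>x. q k x - q0 x) \<in> L2 M" for k by (intro L2_diff q q0)
  have "(\<lambda>k. \<integral>x. (q k x - q0 x)\<^sup>2 \<partial>M) \<longlonglongrightarrow> 0"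
    using L2_tendsto_iff[of q M q0] q q0 l by (simp add: L2_tendsto_def)
  moreover have "(\<lambda>k. \<integral>x. (q k x - q0 x) * q0 x \<partial>M) \<longlonglongrightarrow> 0"
    by (rule L2_strong_inner[OF d q0 l])
  ultimately have "(\<lambda>k. (\<integral>x. (q k x - q0 x)\<^sup>2 \<partial>M) + 2 * (\<integral>x. (q k x - q0 x) * q0 x \<partial>M) + (\<integral>x. (q0 x)\<^sup>2 \<partial>M))
      \<longlonglongrightarrow> 0 + 2 * 0 + (\<integral>x. (q0 x)\<^sup>2 \<partial>M)"
    by (intro tendsto_intros)
  moreover have "(\<integral>x. (q k x)\<^sup>2 \<partial>M) = (\<integral>x. (q k x - q0 x)\<^sup>2 \<partial>M) + 2 * (\<integral>x. (q k x - q0 x) * q0 x \<partial>M) + (\<integral>x. (q0 x)\<^sup>2 \<partial>M)" for k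
  proof -
    have "(\<integral>x. (q k x)\<^sup>2 \<partial>M) = (\<integral>x. (q k x - q0 x)\<^sup>2 + 2 * ((q k x - q0 x) * q0 x) + (q0 x)\<^sup>2 \<partial>M)"
      by (intro Bochner_Integration.integral_cong refl) (simp add: power2_eq_square algebra_simps)
    also have "\<dots> = (\<integral>x. (q k x - q0 x)\<^sup>2 \<partial>M) + (\<integral>x. 2 * ((q k x - q0 x) * q0 x) \<partial>M) + (\<integral>x. (q0 x)\<^sup>2 \<partial>M)"
    proof -
      have i: "integrable M (\<lambda>x. (q k x - q0 x)\<^sup>2)" "integrable M (\<lambda>x. (q0 x)\<^sup>2)"
        "integrable M (\<lambda>x. 2 * ((q k x - q0 x) * q0 x))"
        using d[of k] q0 L2_mult_integrable[OF d[of k] q0] by (auto simp: L2_def)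
      from Bochner_Integration.integral_add[OF Bochner_Integration.integrable_add[OF i(1,3)] i(2)]
        Bochner_Integration.integral_add[OF i(1,3)]
      show ?thesis by simp
    qed
    finally show ?thesis by simp
  qed
  ultimately show ?thesis by simp
qed

text \<open>The coefficient \<open>1 - 1/2\<close> matches \<open>comb_mix\<close> at the midpoint,
  and the left side is the gap \<open>D\<close> to be fed to \<open>near_minimisers\<close>.\<close>

lemma L2_parallelogram:
  assumes "p \<in> L2 M" "q \<in> L2 M"
  shows "(\<integral>x. (p x - q x)\<^sup>2 \<partial>M) / 2 = (\<integral>x. (p x)\<^sup>2 \<partial>M) + (\<integral>x. (q x)\<^sup>2 \<partial>M) - 2 * (\<integral>x. ((1 - 1/2) * p x + 1/2 * q x)\<^sup>2 \<partial>M)"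
proof -
  have i: "integrable M (\<lambda>x. (p x)\<^sup>2)" "integrable M (\<lambda>x. (q x)\<^sup>2)" "integrable M (\<lambda>x. p x * q x)"
    using assms by (auto simp: L2_def intro: L2_mult_integrable[OF assms])
  have 1: "(p x - q x)\<^sup>2 = (p x)\<^sup>2 + (q x)\<^sup>2 - 2 * (p x * q x)" for x by (simp add: power2_diff)
  have 2: "((1 - 1/2) * p x + 1/2 * q x)\<^sup>2 = (1/4) * (p x)\<^sup>2 + (1/4) * (q x)\<^sup>2 + (1/2) * (p x * q x)" for x
    by (simp add: power2_eq_square field_simps)
  show ?thesis unfolding 1 2 using i by simp
qed

lemma sqn_CauchyI:
  assumes "\<And>m n. (\<lambda>x. y m x - y n x) \<in> L2 M"
    and "\<And>e. e > 0 \<Longrightarrow> \<exists>N. \<forall>m\<ge>N. \<forall>n\<ge>N. (\<integral>x. (y m x - y n x)\<^sup>2 \<partial>M) / 2 < e" and "e > 0"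
  shows "\<exists>N. \<forall>m\<ge>N. \<forall>n\<ge>N. sqn M (\<lambda>x. y m x - y n x) < ennreal e"
proof -
  obtain N where "\<forall>m\<ge>N. \<forall>n\<ge>N. (\<integral>x. (y m x - y n x)\<^sup>2 \<partial>M) / 2 < e / 2"
    using assms(2)[of "e/2"] assms(3) by auto
  then show ?thesis using sqn_integral[OF assms(1)]
    by (intro exI[of _ N]) (auto simp: ennreal_less_iff)
qed

text \<open>In each tail hull the distance to g is minimised. The differences of the near-minimisers
  from g converge in norm to a vector p of minimal norm, whose variational inequality bounds its
  squared norm by the inner products of p with f i - g. These vanish in the limit by weak
  convergence, so p = 0 and g has distance 0 from every tail hull.\<close>

theorem L2_Mazur:
  assumes w: "L2_weakly_tendsto M f g"
  obtains l where "\<And>n. l n \<in> tail_weights n" "(\<lambda>n. sqn M (\<lambda>x. comb (l n) f x - g x)) \<longlonglongrightarrow> 0"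
proof -
  have f: "\<And>n. f n \<in> L2 M" and g: "g \<in> L2 M" using w by (auto simp: L2_weakly_tendsto_def)
  define J where "J l = (\<integral>x. (comb l f x - g x)\<^sup>2 \<partial>M)" for l
  have cL2: "(\<lambda>x. comb l f x - g x) \<in> L2 M" for l by (intro L2_diff comb_L2 f g)
  have ex: "\<exists>l\<in>tail_weights N. J l < e" if e: "e > 0" for N e
  proof -
    define C where "C = (\<lambda>_::nat. tail_weights N)"
    have u: "(\<lambda>i. if i = N then 1 else 0) \<in> tail_weights N" by (rule unit_tail_weights) simp
    let ?D = "\<lambda>l l'. (\<integral>x. (comb l f x - comb l' f x)\<^sup>2 \<partial>M) / 2"
    have D: "?D l l' \<le> J l + J l' - 2 * J (mix (1/2) l l')" if "l \<in> C 0" "l' \<in> C 0" for l l'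
    proof -
      have "comb (mix (1/2) l l') f x - g x = (1 - 1/2) * (comb l f x - g x) + 1/2 * (comb l' f x - g x)" for x
        using that by (subst comb_mix) (auto simp: C_def tail_weights_finite algebra_simps)
      then show ?thesis using L2_parallelogram[OF cL2[of l] cL2[of l']] by (simp add: J_def)
    qed
    obtain x where x: "\<And>n. x n \<in> C n" "\<And>n y. y \<in> C n \<Longrightarrow> J (x n) \<le> J y + 1 / real (Suc n)"
      "\<And>e. e > 0 \<Longrightarrow> \<exists>N. \<forall>m\<ge>N. \<forall>n\<ge>N. ?D (x m) (x n) < e"
    proof (rule near_minimisers[of C J "J (\<lambda>i. if i = N then 1 else 0)" "mix (1/2)" ?D])
      fix l l' assume "l \<in> C 0" "l' \<in> C 0"
      then show "?D l l' \<le> J l + J l' - 2 * J (mix (1/2) l l')" by (rule D)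
    next
      show "mix (1/2) l l' \<in> C n" if "l \<in> C n" "l' \<in> C n" for n l l'
        using that by (auto simp: C_def intro: mix_tail_weights)
      show "\<exists>x\<in>C n. J x \<le> J (\<lambda>i. if i = N then 1 else 0)" for n
        using u by (auto simp: C_def)
      show "C n \<subseteq> C m" for m n by (simp add: C_def)
      show "0 \<le> J x" for x by (simp add: J_def)
    next
      fix x assume "\<And>n. x n \<in> C n" "\<And>n y. y \<in> C n \<Longrightarrow> J (x n) \<le> J y + 1 / real (Suc n)"
        "\<And>e. e > 0 \<Longrightarrow> \<exists>N. \<forall>m\<ge>N. \<forall>n\<ge>N. ?D (x m) (x n) < e"
      then show thesis by (rule that)
    qed
    let ?p = "\<lambda>n x'. comb (x n) f x' - g x'"
    have cauchy: "\<exists>N. \<forall>m\<ge>N. \<forall>n\<ge>N. sqn M (\<lambda>x'. ?p m x' - ?p n x') < ennreal e" if "e > 0" for e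
    proof (rule sqn_CauchyI[OF _ _ that])
      show "(\<lambda>x'. ?p m x' - ?p n x') \<in> L2 M" for m n by (intro L2_diff[OF cL2 cL2])
    qed (use x(3) in simp)
    obtain p and r :: "nat \<Rightarrow> nat" where pm: "p \<in> borel_measurable M"
      and "strict_mono r" "AE x' in M. (\<lambda>n. ?p (r n) x') \<longlonglongrightarrow> p x'"
      and pl: "(\<lambda>n. sqn M (\<lambda>x'. ?p n x' - p x')) \<longlonglongrightarrow> 0"
      by (rule L2_complete[of ?p M, OF L2_measurable[OF cL2] cauchy])
    have p: "p \<in> L2 M" by (rule L2_limit[of ?p, OF cL2 pm pl])
    have Jl: "(\<lambda>n. J (x n)) \<longlonglongrightarrow> (\<integral>x. (p x)\<^sup>2 \<partial>M)" unfolding J_def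
      by (rule L2_norm_tendsto[OF cL2 p pl])
    have inner: "(\<integral>x. (p x)\<^sup>2 \<partial>M) \<le> (\<integral>x. (f i x - g x) * p x \<partial>M)" if i: "i \<ge> N" for i
    proof -
      define v where "v y = f i y - g y" for y
      have v: "v \<in> L2 M" unfolding v_def[abs_def] by (intro L2_diff f g)
      define P V I where "P = (\<integral>x. (p x)\<^sup>2 \<partial>M)" and "V = (\<integral>x. (v x)\<^sup>2 \<partial>M)" and "I = (\<integral>x. v x * p x \<partial>M)"
      \<comment> \<open>Moving from a near-minimiser towards f i by the fraction t stays in the
        hull, so P is at most the squared norm of (1 - t) p + t v; expanding and dividing by t gives
        this. As t tends to 0 it becomes P \<le> I.\<close>
      have t: "0 \<le> (t - 2) * P + 2 * (1 - t) * I + t * V" if t: "0 < t" "t \<le> 1" for t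
      proof -
        define q q0 where "q n y = (1 - t) * ?p n y + t * v y" and "q0 y = (1 - t) * p y + t * v y" for n y
        have q: "q n \<in> L2 M" for n unfolding q_def[abs_def] by (intro L2_add L2_cmult cL2 v)
        have q0: "q0 \<in> L2 M" unfolding q0_def[abs_def] by (intro L2_add L2_cmult p v)
        have "(\<lambda>n. sqn M (\<lambda>x'. q n x' - q0 x')) \<longlonglongrightarrow> 0"
        proof (rule sqn_tendsto_mono[OF _ pl], intro AE_I2)
          fix n x'
          have "\<bar>q n x' - q0 x'\<bar> = (1 - t) * \<bar>?p n x' - p x'\<bar>"
            using t 
            by (simp add: q_def q0_def abs_mult flip: right_diff_distrib)
          also have "\<dots> \<le> 1 * \<bar>?p n x' - p x'\<bar>" using t by (intro mult_right_mono) auto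
          finally show "\<bar>q n x' - q0 x'\<bar> \<le> \<bar>?p n x' - p x'\<bar>" by simp
        qed
        from L2_norm_tendsto[OF q q0 this]
        have lim: "(\<lambda>n. \<integral>x. (q n x)\<^sup>2 \<partial>M) \<longlonglongrightarrow> (\<integral>x. (q0 x)\<^sup>2 \<partial>M)" .
        have ui: "(\<lambda>j. if j = i then 1 else 0) \<in> tail_weights N" by (rule unit_tail_weights[OF i])
        have "J (x n) \<le> (\<integral>x. (q n x)\<^sup>2 \<partial>M) + 1 / real (Suc n)" for n
        proof -
          have xn: "x n \<in> tail_weights N" using x(1)[of n] by (simp add: C_def)
          have "comb (mix t (x n) (\<lambda>j. if j = i then 1 else 0)) f x' - g x' = q n x'" for x'
            by (subst comb_mix[OF tail_weights_finite[OF xn] tail_weights_finite[OF ui]])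
               (simp add: q_def v_def algebra_simps)
          then have "J (mix t (x n) (\<lambda>j. if j = i then 1 else 0)) = (\<integral>x. (q n x)\<^sup>2 \<partial>M)"
            by (simp add: J_def)
          moreover have "mix t (x n) (\<lambda>j. if j = i then 1 else 0) \<in> C n"
            unfolding C_def using t by (intro mix_tail_weights xn ui) auto
          ultimately show ?thesis using x(2) by metis
        qed
        moreover have "(\<lambda>n. (\<integral>x. (q n x)\<^sup>2 \<partial>M) + 1 / real (Suc n)) \<longlonglongrightarrow> (\<integral>x. (q0 x)\<^sup>2 \<partial>M) + 0"
          using lim LIMSEQ_inverse_real_of_nat by (intro tendsto_add) (simp_all add: inverse_eq_divide)
        ultimately have "P \<le> (\<integral>x. (q0 x)\<^sup>2 \<partial>M)"
          unfolding P_def using LIMSEQ_le[OF Jl] by fastforce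
        also have "\<dots> = (\<integral>x. (1 - t)\<^sup>2 * (p x)\<^sup>2 + 2 * t * (1 - t) * (v x * p x) + t\<^sup>2 * (v x)\<^sup>2 \<partial>M)"
          by (intro Bochner_Integration.integral_cong refl) (simp add: q0_def power2_eq_square algebra_simps)
        also have "\<dots> = (1 - t)\<^sup>2 * P + 2 * t * (1 - t) * I + t\<^sup>2 * V"
          unfolding P_def V_def I_def using p v L2_mult_integrable[OF v p] by (simp add: L2_def)
        finally have "0 \<le> t * ((t - 2) * P + 2 * (1 - t) * I + t * V)"
          by (simp add: power2_eq_square algebra_simps)
        then show ?thesis using t by (simp add: zero_le_mult_iff)
      qed
      have "((\<lambda>t. (t - 2) * P + 2 * (1 - t) * I + t * V) \<longlongrightarrow> (0 - 2) * P + 2 * (1 - 0) * I + 0 * V) (at_right 0)"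
        by (intro tendsto_intros)
      moreover have "eventually (\<lambda>t. 0 \<le> (t - 2) * P + 2 * (1 - t) * I + t * V) (at_right (0::real))"
        unfolding eventually_at_right_field using t by (intro exI[of _ 1]) auto
      ultimately have "0 \<le> (0 - 2) * P + 2 * (1 - 0) * I + 0 * V"
        by (intro tendsto_lowerbound[of _ _ "at_right (0::real)"]) auto
      then show ?thesis by (simp add: P_def I_def v_def)
    qed
    have "(\<lambda>i. \<integral>x. (f i x - g x) * p x \<partial>M) \<longlonglongrightarrow> 0"
    proof -
      have "(\<lambda>i. (\<integral>x. f i x * p x \<partial>M) - (\<integral>x. g x * p x \<partial>M)) \<longlonglongrightarrow> 0"
        using w p by (simp add: L2_weakly_tendsto_def LIM_zero)
      moreover have "(\<integral>x. (f i x - g x) * p x \<partial>M) = (\<integral>x. f i x * p x \<partial>M) - (\<integral>x. g x * p x \<partial>M)" for i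
        using L2_mult_integrable[OF f p] L2_mult_integrable[OF g p] by (simp add: left_diff_distrib)
      ultimately show ?thesis by simp
    qed
    from LIMSEQ_le_const[OF this] inner have "(\<integral>x. (p x)\<^sup>2 \<partial>M) \<le> 0" by blast
    then have "(\<lambda>n. J (x n)) \<longlonglongrightarrow> 0" using Jl by (simp add: order_antisym[OF _ Bochner_Integration.integral_nonneg])
    then have "eventually (\<lambda>n. J (x n) < e) sequentially" using e by (rule order_tendstoD)
    then obtain n where "J (x n) < e" by (auto simp: eventually_sequentially)
    then show ?thesis using x(1)[of n] by (auto simp: C_def)
  qed
  have "\<forall>n. \<exists>l\<in>tail_weights n. J l < 1 / real (Suc n)" using ex by simp
  then obtain l where l: "\<And>n. l n \<in> tail_weights n" "\<And>n. J (l n) < 1 / real (Suc n)" by metis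
  have "(\<lambda>n. J (l n)) \<longlonglongrightarrow> 0"
  proof (rule tendsto_sandwich[OF _ _ tendsto_const])
    show "(\<lambda>n. 1 / real (Suc n)) \<longlonglongrightarrow> 0" using LIMSEQ_inverse_real_of_nat by (simp add: inverse_eq_divide)
    show "\<forall>\<^sub>F n in sequentially. J (l n) \<le> 1 / real (Suc n)"
      using less_imp_le[OF l(2)] by (rule always_eventually[OF allI])
  qed (simp add: J_def)
  then have "(\<lambda>n. ennreal (J (l n))) \<longlonglongrightarrow> ennreal 0" by (rule tendsto_ennrealI)
  then have "(\<lambda>n. sqn M (\<lambda>x. comb (l n) f x - g x)) \<longlonglongrightarrow> 0"
    using sqn_integral[OF cL2] by (simp add: J_def)
  with l(1) that show thesis by blast
qed

section \<open>Sub-slopes\<close>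

definition excess :: "'a::metric_space measure \<Rightarrow> ('a \<Rightarrow> real) \<Rightarrow> ('a \<Rightarrow> real) \<Rightarrow> ennreal" where
  "excess M \<phi> G = sqn M (\<lambda>x. max 0 (lip_a \<phi> x - G x))"

text \<open>In contrast to \<open>relaxed_slope\<close>, convergence is a.e. and the slope condition
  is strong and one-sided. It can thus be checked pointwise for maxima, minima and sums of the
  approximating functions, for which weak convergence of slopes is ill suited.\<close>

definition sub_slope :: "'a::metric_space measure \<Rightarrow> ('a \<Rightarrow> real) \<Rightarrow> ('a \<Rightarrow> real) \<Rightarrow> bool" where
  "sub_slope M f G \<longleftrightarrow> f \<in> borel_measurable M \<and> G \<in> L2 M \<and> (AE x in M. 0 \<le> G x) \<and>
     (\<exists>\<phi>. (\<forall>n. \<phi> n \<in> LIP_bd) \<and> (AE x in M. (\<lambda>n. \<phi> n x) \<longlonglongrightarrow> f x) \<and> (\<lambda>n. excess M (\<phi> n) G) \<longlonglongrightarrow> 0)"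

definition least_sub_slope :: "'a::metric_space measure \<Rightarrow> ('a \<Rightarrow> real) \<Rightarrow> ('a \<Rightarrow> real) \<Rightarrow> bool" where
  "least_sub_slope M f G \<longleftrightarrow> sub_slope M f G \<and> (\<forall>H. sub_slope M f H \<longrightarrow> (AE x in M. G x \<le> H x))"

lemma sub_slopeE:
  assumes "sub_slope M f G"
  obtains \<phi> where "\<And>n. \<phi> n \<in> LIP_bd" "AE x in M. (\<lambda>n. \<phi> n x) \<longlonglongrightarrow> f x" "(\<lambda>n. excess M (\<phi> n) G) \<longlonglongrightarrow> 0"
    "f \<in> borel_measurable M" "G \<in> L2 M" "G \<in> borel_measurable M" "AE x in M. 0 \<le> G x"
  using assms L2_measurable unfolding sub_slope_def by blast

lemma sub_slopeI:
  assumes "f \<in> borel_measurable M" "G \<in> L2 M" "AE x in M. 0 \<le> G x"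
    "\<And>n. \<phi> n \<in> LIP_bd" "AE x in M. (\<lambda>n. \<phi> n x) \<longlonglongrightarrow> f x" "(\<lambda>n. excess M (\<phi> n) G) \<longlonglongrightarrow> 0"
  shows "sub_slope M f G"
  using assms unfolding sub_slope_def by blast

lemma tendsto_ennreal_inverse_Suc: "(\<lambda>k. ennreal (1 / real (Suc k))) \<longlonglongrightarrow> 0"
  using tendsto_ennrealI[OF LIMSEQ_inverse_real_of_nat] by (simp add: inverse_eq_divide)

context boundedly_finite_measure begin

lemma measurable_M_iff: "borel_measurable M = borel_measurable borel"
  by (rule measurable_cong_sets) (auto simp: sets_M)

lemma LIP_bd_meas: "\<phi> \<in> LIP_bd \<Longrightarrow> \<phi> \<in> borel_measurable M"
  by (simp add: measurable_M_iff LIP_bd_measurable)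

lemma lip_a_meas: "\<phi> \<in> LIP_bd \<Longrightarrow> lip_a \<phi> \<in> borel_measurable M"
  by (simp add: measurable_M_iff borel_measurable_lip_a)

lemma excess_meas:
  "\<phi> \<in> LIP_bd \<Longrightarrow> G \<in> borel_measurable M \<Longrightarrow> (\<lambda>x. max 0 (lip_a \<phi> x - G x)) \<in> borel_measurable M"
  by (intro borel_measurable_max borel_measurable_diff borel_measurable_const lip_a_meas)

lemma excess_tendsto_trans:
  assumes "\<And>k. \<phi> k \<in> LIP_bd" "\<And>k. G k \<in> borel_measurable M" "H \<in> borel_measurable M"
    and "(\<lambda>k. excess M (\<phi> k) (G k)) \<longlonglongrightarrow> 0" "(\<lambda>k. sqn M (\<lambda>x. max 0 (G k x - H x))) \<longlonglongrightarrow> 0"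
  shows "(\<lambda>k. excess M (\<phi> k) H) \<longlonglongrightarrow> 0"
  unfolding excess_def
proof (rule sqn_tendsto_add[OF _ _ _ assms(4)[unfolded excess_def] assms(5)])
  show "(\<lambda>x. max 0 (lip_a (\<phi> n) x - G n x)) \<in> borel_measurable M" for n
    by (rule excess_meas[OF assms(1,2)])
  show "(\<lambda>x. max 0 (G n x - H x)) \<in> borel_measurable M" for n
    using assms(2)[of n] assms(3) by measurable
qed (intro AE_I2, linarith)

text \<open>A diagonal choice controls convergence to f0 and the excess at once. Only the positive
  part of \<open>G k - G0\<close> enters, so the \<open>G k\<close> may stay well below
  \<open>G0\<close>; the truncation in \<open>sub_slope_comp_bounded\<close> relies on this.\<close>

lemma sub_slope_closed:
  assumes s: "\<And>k. sub_slope M (f k) (G k)" and fm: "f0 \<in> borel_measurable M"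
    and fl: "AE x in M. (\<lambda>k. f k x) \<longlonglongrightarrow> f0 x"
    and G0: "G0 \<in> L2 M" "AE x in M. 0 \<le> G0 x"
    and Gl: "(\<lambda>k. sqn M (\<lambda>x. max 0 (G k x - G0 x))) \<longlonglongrightarrow> 0"
  shows "sub_slope M f0 G0"
proof -
  have "\<forall>k. \<exists>\<phi>. (\<forall>n. \<phi> n \<in> LIP_bd) \<and> (AE x in M. (\<lambda>n. \<phi> n x) \<longlonglongrightarrow> f k x) \<and> (\<lambda>n. excess M (\<phi> n) (G k)) \<longlonglongrightarrow> 0"
    using s unfolding sub_slope_def by blast
  from choice[OF this] obtain \<phi> where "\<forall>k. (\<forall>n. \<phi> k n \<in> LIP_bd) \<and> (AE x in M. (\<lambda>n. \<phi> k n x) \<longlonglongrightarrow> f k x) \<and>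
    (\<lambda>n. excess M (\<phi> k n) (G k)) \<longlonglongrightarrow> 0" ..
  then have \<phi>: "\<And>k n. \<phi> k n \<in> LIP_bd" "\<And>k. AE x in M. (\<lambda>n. \<phi> k n x) \<longlonglongrightarrow> f k x"
    "\<And>k. (\<lambda>n. excess M (\<phi> k n) (G k)) \<longlonglongrightarrow> 0" by auto
  have fk: "f k \<in> borel_measurable M" "G k \<in> borel_measurable M" for k
    using s[of k] by (auto simp: sub_slope_def L2_measurable)
  have L0: "L0_tendsto M (\<phi> k) (f k)" for k
    by (rule AE_imp_L0_tendsto[OF LIP_bd_meas[OF \<phi>(1)] fk(1) \<phi>(2)])
  from L0_diag[OF L0 fl] obtain Q where Q: "\<And>k. eventually (Q k) sequentially"
    "\<And>r. \<forall>k. Q k (r k) \<Longrightarrow> AE x in M. (\<lambda>k. \<phi> k (r k) x) \<longlonglongrightarrow> f0 x"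
    by auto
  have P: "eventually (\<lambda>n. excess M (\<phi> k n) (G k) < ennreal (1 / real (Suc k))) sequentially" for k
    using \<phi>(3)[of k, unfolded tendsto_0_ennreal_iff] by simp
  from eventually_choice[of Q "\<lambda>k n. excess M (\<phi> k n) (G k) < ennreal (1 / real (Suc k))", OF Q(1) P]
  obtain r where r: "\<And>k. Q k (r k)" "\<And>k. excess M (\<phi> k (r k)) (G k) < ennreal (1 / real (Suc k))"
    by auto
  have "(\<lambda>k. excess M (\<phi> k (r k)) (G k)) \<longlonglongrightarrow> 0"
    by (rule ennreal_squeeze_0[OF tendsto_ennreal_inverse_Suc less_imp_le[OF r(2)]])
  from excess_tendsto_trans[OF \<phi>(1) fk(2) L2_measurable[OF G0(1)] this Gl]
  show ?thesis using r(1) by (intro sub_slopeI[OF fm G0 \<phi>(1) Q(2)]) auto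
qed

text \<open>The sequences \<phi> for G and \<psi> for H have the same limit, so \<phi> clamped to
  the band of half-width \<eta> around \<psi> also converges to f. The width is 0 deep inside U,
  where the clamped function is \<psi>, and \<delta> outside U, where at a.e. point it eventually
  coincides with \<phi> nearby. In the layer of points of U within \<delta> of the complement all
  slopes add up, but this layer shrinks to the empty set with \<delta>.\<close>

lemma sub_slope_glue_open:
  assumes sG: "sub_slope M f G" and sH: "sub_slope M f H" and U: "open U" "bounded U"
  shows "sub_slope M f (\<lambda>x. if x \<in> U then H x else G x)"
proof (cases "U = UNIV")
  \<comment> \<open>With an empty complement \<open>infdist\<close> is 0 throughout and would not
    describe the depth inside U.\<close>
  case True
  then show ?thesis using sH by simp
next
  case False
  then have Une: "- U \<noteq> {}" by auto
  have clU: "closed (- U)" using U by auto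
  obtain \<phi> where \<phi>: "\<And>n. \<phi> n \<in> LIP_bd" "AE x in M. (\<lambda>n. \<phi> n x) \<longlonglongrightarrow> f x" "(\<lambda>n. excess M (\<phi> n) G) \<longlonglongrightarrow> 0"
    and fm[measurable]: "f \<in> borel_measurable M" and G: "G \<in> L2 M" and Gm[measurable]: "G \<in> borel_measurable M" and G0: "AE x in M. 0 \<le> G x"
    using sub_slopeE[OF sG] by blast
  obtain \<psi> where \<psi>: "\<And>n. \<psi> n \<in> LIP_bd" "AE x in M. (\<lambda>n. \<psi> n x) \<longlonglongrightarrow> f x" "(\<lambda>n. excess M (\<psi> n) H) \<longlonglongrightarrow> 0"
    and H: "H \<in> L2 M" and Hm[measurable]: "H \<in> borel_measurable M" and H0: "AE x in M. 0 \<le> H x"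
    using sub_slopeE[OF sH] by blast
  have [measurable]: "\<phi> n \<in> borel_measurable M" "\<psi> n \<in> borel_measurable M"
    "lip_a (\<phi> n) \<in> borel_measurable M" "lip_a (\<psi> n) \<in> borel_measurable M" for n
    using \<phi>(1) \<psi>(1) by (auto intro: LIP_bd_meas lip_a_meas)
  have [measurable]: "U \<in> sets M" "closure U \<in> sets M" using U by (auto simp: sets_M)
  define d where "d x = infdist x (- U)" for x
  have dm[measurable]: "d \<in> borel_measurable M"
    unfolding d_def[abs_def] measurable_M_iff by (intro borel_measurable_continuous_onI continuous_intros)
  have d0: "0 \<le> d x" for x by (simp add: d_def infdist_nonneg)
  have dout: "x \<notin> U \<Longrightarrow> d x = 0" for x by (simp add: d_def)
  have din: "x \<in> U \<Longrightarrow> 0 < d x" for x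
    using in_closed_iff_infdist_zero[OF clU Une, of x] d0[of x] by (auto simp: d_def less_le)
  have dcont: "continuous_on UNIV d" unfolding d_def[abs_def] by (intro continuous_intros)
  \<comment> \<open>Off the closure of U the width \<eta> is locally constant, so its slope is
    bounded by this indicator; boundedness of U makes the indicator square integrable.\<close>
  define B where "B = (\<lambda>x. indicator (closure U) x :: real)"
  have Bm[measurable]: "B \<in> borel_measurable M" unfolding B_def by measurable
  have B: "B \<in> L2 M"
  proof -
    have "(\<integral>\<^sup>+x. ennreal ((B x)\<^sup>2) \<partial>M) = (\<integral>\<^sup>+x. indicator (closure U) x \<partial>M)"
      by (rule nn_integral_cong) (simp add: B_def indicator_def)
    also have "\<dots> = emeasure M (closure U)" by simp
    also have "\<dots> < \<infinity>" by (rule emeasure_bounded) (use U in auto)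
    finally show ?thesis by (simp add: L2_iff sqn_def)
  qed
  define W where "W x = (if x \<in> U then H x else G x)" for x
  define Wk where "Wk k x = (if x \<in> U then (if d x \<le> 1 / real (Suc k) then G x + H x + B x else H x) else G x)" for k :: nat and x
  have WL2: "W \<in> L2 M"
    by (rule L2_bounded_add[OF _ G H]) (auto simp: W_def[abs_def])
  have WkL2: "Wk k \<in> L2 M" for k
    by (rule L2_bounded_add[OF _ L2_add[OF L2_add[OF L2_add[OF G H] B] H] G, of _])
       (use G0 H0 in \<open>auto simp: Wk_def[abs_def] B_def\<close>)
  have Wpos: "AE x in M. 0 \<le> W x" using G0 H0 by eventually_elim (simp add: W_def)
  have Wkpos: "AE x in M. 0 \<le> Wk k x" for k using G0 H0 by eventually_elim (simp add: Wk_def B_def)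
  have sk: "sub_slope M f (Wk k)" for k
  proof -
    define \<delta> where "\<delta> = 1 / real (Suc k)"
    have \<delta>: "\<delta> > 0" by (simp add: \<delta>_def)
    define \<eta> where "\<eta> x = max 0 (\<delta> - d x)" for x
    have \<eta>lip: "1-lipschitz_on S \<eta>" for S
    proof -
      have "1-lipschitz_on S d" unfolding d_def[abs_def] by (rule lipschitz_on_infdist)
      from lipschitz_on_max[OF lipschitz_on_constant[of S "0::real"] lipschitz_on_diff[OF lipschitz_on_constant[of S \<delta>] this]]
      show ?thesis by (simp add: \<eta>_def[abs_def])
    qed
    have \<eta>bd: "\<eta> \<in> LIP_bd" using \<eta>lip by (auto simp: LIP_bd_def)
    have \<eta>0: "0 \<le> \<eta> x" for x by (simp add: \<eta>_def)
    have \<eta>slope: "lip_a \<eta> x \<le> B x" for x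
    proof (cases "x \<in> closure U")
      case True
      then show ?thesis using lip_a_le[OF \<eta>lip, of 1 x] by (simp add: B_def)
    next
      case False
      have "lip_a \<eta> x = 0"
      proof (rule lip_a_eq_0[of "- closure U"])
        show "\<eta> y = \<delta>" if "y \<in> - closure U" for y
        proof -
          have "y \<notin> U" using that closure_subset[of U] by blast
          then show ?thesis using \<delta> by (simp add: \<eta>_def dout)
        qed
      qed (use False in auto)
      then show ?thesis by (simp add: B_def)
    qed
    define \<xi> where "\<xi> n x = max (\<psi> n x - \<eta> x) (min (\<phi> n x) (\<psi> n x + \<eta> x))" for n x
    have \<xi>bd: "\<xi> n \<in> LIP_bd" for n
      unfolding \<xi>_def[abs_def] by (intro LIP_bd_max LIP_bd_min LIP_bd_add LIP_bd_diff \<eta>bd \<phi> \<psi>)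
    have g1: "lip_a (\<xi> n) x \<le> lip_a (\<phi> n) x + lip_a (\<psi> n) x + B x" for n x
    proof -
      have "lip_a (\<xi> n) x \<le> max (lip_a (\<lambda>x. \<psi> n x - \<eta> x) x) (lip_a (\<lambda>x. min (\<phi> n x) (\<psi> n x + \<eta> x)) x)"
        unfolding \<xi>_def[abs_def] by (intro lip_a_max LIP_bd_min LIP_bd_add LIP_bd_diff \<eta>bd \<phi> \<psi>)
      also have "\<dots> \<le> max (lip_a (\<psi> n) x + lip_a \<eta> x) (max (lip_a (\<phi> n) x) (lip_a (\<psi> n) x + lip_a \<eta> x))"
        by (intro max.mono lip_a_diff order_trans[OF lip_a_min] lip_a_add \<eta>bd \<phi> \<psi> LIP_bd_add order_refl)
      finally show ?thesis
        using \<eta>slope[of x] lip_a_nonneg[of "\<phi> n" x] lip_a_nonneg[of "\<psi> n" x] lip_a_nonneg[of \<eta> x] by linarith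
    qed
    have g2: "lip_a (\<xi> n) x \<le> lip_a (\<psi> n) x" if "d x > \<delta>" for n x
    proof (rule lip_a_cong_open[OF \<psi>(1), of "{x. d x > \<delta>}"])
      show "open {x. d x > \<delta>}" by (intro open_Collect_less continuous_intros dcont)
    qed (use that in \<open>auto simp: \<xi>_def \<eta>_def\<close>)
    have g3: "lip_a (\<xi> n) x \<le> lip_a (\<phi> n) x" if "\<bar>\<phi> n x - \<psi> n x\<bar> < \<eta> x" for n x
    proof (rule lip_a_cong_open[OF \<phi>(1), of "{x. \<bar>\<phi> n x - \<psi> n x\<bar> < \<eta> x}"])
      show "open {x. \<bar>\<phi> n x - \<psi> n x\<bar> < \<eta> x}"
        by (intro open_Collect_less continuous_intros LIP_bd_continuous \<eta>bd \<phi> \<psi>)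
    qed (use that in \<open>auto simp: \<xi>_def\<close>)
    \<comment> \<open>Outside U the slope is that of \<phi> only where \<phi> and \<psi> differ by
      less than \<delta>. Elsewhere the crude bound costs H + B more, and at a.e. x this happens for
      finitely many n.\<close>
    define E where "E n x = (if \<bar>\<phi> n x - \<psi> n x\<bar> < \<delta> then 0 else H x + B x)" for n x
    have Em[measurable]: "E n \<in> borel_measurable M" for n unfolding E_def[abs_def] by measurable
    have E0: "(\<lambda>n. sqn M (E n)) \<longlonglongrightarrow> 0"
    proof (rule sqn_dominated[OF _ L2_add[OF H B]])
      show "AE x in M. \<bar>E n x\<bar> \<le> H x + B x" for n using H0 by eventually_elim (auto simp: E_def B_def)
      show "AE x in M. (\<lambda>n. E n x) \<longlonglongrightarrow> 0" using \<phi>(2) \<psi>(2)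
      proof eventually_elim
        case (elim x)
        from tendsto_diff[OF this] have "(\<lambda>n. \<phi> n x - \<psi> n x) \<longlonglongrightarrow> 0" by simp
        then have "eventually (\<lambda>n. \<bar>\<phi> n x - \<psi> n x\<bar> < \<delta>) sequentially"
          using \<delta> by (simp add: tendsto_iff dist_real_def)
        then have "eventually (\<lambda>n. E n x = 0) sequentially" by eventually_elim (simp add: E_def)
        then show ?case by (rule tendsto_eventually)
      qed
    qed simp
    let ?P = "\<lambda>n x. max 0 (lip_a (\<phi> n) x - G x)" and ?Q = "\<lambda>n x. max 0 (lip_a (\<psi> n) x - H x)"
    have PQ: "(\<lambda>n. sqn M (\<lambda>x. ?P n x + ?Q n x)) \<longlonglongrightarrow> 0"
      by (rule sqn_tendsto_add[OF _ _ _ \<phi>(3)[unfolded excess_def] \<psi>(3)[unfolded excess_def]])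
         (auto intro!: excess_meas \<phi>(1) \<psi>(1) Gm Hm)
    have "(\<lambda>n. excess M (\<xi> n) (Wk k)) \<longlonglongrightarrow> 0"
      unfolding excess_def
    proof (rule sqn_tendsto_add[OF _ _ _ PQ E0])
      show "AE x in M. \<bar>max 0 (lip_a (\<xi> n) x - Wk k x)\<bar> \<le> \<bar>?P n x + ?Q n x\<bar> + \<bar>E n x\<bar>" for n
        using G0 H0
      proof eventually_elim
        case (elim x)
        have B0: "0 \<le> B x" by (simp add: B_def)
        have E0: "0 \<le> E n x" using elim B0 by (simp add: E_def)
        have PQ: "lip_a (\<phi> n) x - G x \<le> ?P n x" "0 \<le> ?P n x" "lip_a (\<psi> n) x - H x \<le> ?Q n x" "0 \<le> ?Q n x"
          by auto
        have "lip_a (\<xi> n) x - Wk k x \<le> ?P n x + ?Q n x + E n x"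
        proof (cases "x \<in> U")
          case True
          show ?thesis
          proof (cases "d x \<le> \<delta>")
            case True
            then have "Wk k x = G x + H x + B x" using \<open>x \<in> U\<close> by (simp add: Wk_def \<delta>_def)
            then show ?thesis using g1[of n x] elim B0 E0 PQ by linarith
          next
            case False
            then have "Wk k x = H x" using \<open>x \<in> U\<close> by (simp add: Wk_def \<delta>_def)
            then show ?thesis using g2[of x n] False E0 PQ by linarith
          qed
        next
          case False
          then have W: "Wk k x = G x" and e: "\<eta> x = \<delta>" using \<delta> by (simp_all add: Wk_def \<eta>_def dout)
          show ?thesis
          proof (cases "\<bar>\<phi> n x - \<psi> n x\<bar> < \<delta>")
            case True
            then show ?thesis using g3[of n x] e W E0 PQ by linarith
          next
            case False
            then have "E n x = H x + B x" by (simp add: E_def)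
            then show ?thesis using g1[of n x] W PQ by linarith
          qed
        qed
        then show ?case using E0 PQ by linarith
      qed
    qed (auto intro!: borel_measurable_add excess_meas \<phi>(1) \<psi>(1) Gm Hm Em)
    moreover have "AE x in M. (\<lambda>n. \<xi> n x) \<longlonglongrightarrow> f x" using \<phi>(2) \<psi>(2)
    proof eventually_elim
      case (elim x)
      have "(\<lambda>n. \<xi> n x) \<longlonglongrightarrow> max (f x - \<eta> x) (min (f x) (f x + \<eta> x))"
        unfolding \<xi>_def by (intro tendsto_intros elim)
      then show ?case using \<eta>0[of x] by simp
    qed
    ultimately show ?thesis by (intro sub_slopeI[OF fm WkL2 Wkpos \<xi>bd])
  qed
  have "sub_slope M f W"
  proof (rule sub_slope_closed[OF sk fm _ WL2 Wpos])
    show "(\<lambda>k. sqn M (\<lambda>x. max 0 (Wk k x - W x))) \<longlonglongrightarrow> 0"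
    proof (rule sqn_dominated[OF _ L2_add[OF G B]])
      have "Wk k \<in> borel_measurable M" "W \<in> borel_measurable M" for k
        using WkL2 WL2 by (auto intro: L2_measurable)
      then show "(\<lambda>x. max 0 (Wk k x - W x)) \<in> borel_measurable M" for k by measurable
      show "AE x in M. \<bar>max 0 (Wk k x - W x)\<bar> \<le> G x + B x" for k
        using G0 by eventually_elim (auto simp: Wk_def W_def B_def)
      have "(\<lambda>k. max 0 (Wk k x - W x)) \<longlonglongrightarrow> 0" for x
      proof (cases "x \<in> U")
        case True
        have "eventually (\<lambda>k. 1 / real (Suc k) < d x) sequentially"
          using LIMSEQ_inverse_real_of_nat din[OF True] by (intro order_tendstoD) (simp_all add: inverse_eq_divide)
        then have "eventually (\<lambda>k. max 0 (Wk k x - W x) = 0) sequentially"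
          by eventually_elim (use True in \<open>auto simp: Wk_def W_def\<close>)
        then show ?thesis by (rule tendsto_eventually)
      qed (simp add: Wk_def W_def)
      then show "AE x in M. (\<lambda>k. max 0 (Wk k x - W x)) \<longlonglongrightarrow> 0" by simp
    qed
  qed simp
  then show ?thesis by (simp add: W_def[abs_def])
qed

section \<open>Gluing along Borel sets and the least sub-slope\<close>

lemma L2_glue:
  assumes "G \<in> L2 M" "H \<in> L2 M" "A \<in> sets M"
  shows "(\<lambda>x. if x \<in> A then H x else G x) \<in> L2 M"
  using assms L2_measurable[OF assms(1)] L2_measurable[OF assms(2)]
  by (intro L2_bounded_add[OF _ assms(1,2)]) auto

text \<open>At a point of the union not yet in \<open>A n\<close> the glued function exceeds the
  target by at most G, and only for finitely many n; dominated convergence and closedness do the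
  rest.\<close>

lemma sub_slope_glue_incseq:
  assumes A: "\<And>n::nat. A n \<in> sets M" "incseq A" "\<And>n. sub_slope M f (\<lambda>x. if x \<in> A n then H x else G x)"
    and sG: "sub_slope M f G" and sH: "sub_slope M f H"
  shows "sub_slope M f (\<lambda>x. if x \<in> (\<Union>n. A n) then H x else G x)"
proof -
  note G = sG[unfolded sub_slope_def] and H = sH[unfolded sub_slope_def]
  have [measurable]: "A n \<in> sets M" "G \<in> borel_measurable M" "H \<in> borel_measurable M" for n
    using A G H by (auto intro: L2_measurable)
  let ?W = "\<lambda>x. if x \<in> (\<Union>n. A n) then H x else G x" and ?Wn = "\<lambda>n x. if x \<in> A n then H x else G x"
  show ?thesis
  proof (rule sub_slope_closed[of "\<lambda>_. f" ?Wn])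
    show "?W \<in> L2 M" by (rule L2_glue) (use A G H in auto)
    have "AE x in M. 0 \<le> G x" "AE x in M. 0 \<le> H x" using G H by auto
    then show "AE x in M. 0 \<le> ?W x" by eventually_elim simp
    show "(\<lambda>k. sqn M (\<lambda>x. max 0 (?Wn k x - ?W x))) \<longlonglongrightarrow> 0"
    proof (rule sqn_dominated)
      show "G \<in> L2 M" using G by auto
      show "AE x in M. \<bar>max 0 (?Wn k x - ?W x)\<bar> \<le> G x" for k
        using \<open>AE x in M. 0 \<le> G x\<close> \<open>AE x in M. 0 \<le> H x\<close> by eventually_elim auto
      have "(\<lambda>k. max 0 (?Wn k x - ?W x)) \<longlonglongrightarrow> 0" for x
      proof (cases "x \<in> (\<Union>n. A n)")
        case True
        then obtain n where "x \<in> A n" by blast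
        then have "eventually (\<lambda>k. x \<in> A k) sequentially"
          using A(2) unfolding eventually_sequentially incseq_def by blast
        then have "eventually (\<lambda>k. max 0 (?Wn k x - ?W x) = 0) sequentially"
          by eventually_elim auto
        then show ?thesis by (rule tendsto_eventually)
      qed simp
      then show "AE x in M. (\<lambda>k. max 0 (?Wn k x - ?W x)) \<longlonglongrightarrow> 0" by simp
    qed measurable
  qed (use A G in auto)
qed

text \<open>Induction over the Borel sets. G and H vary because a complement exchanges their roles
  and a union is glued set by set, H being put into the result of the previous steps. An open set is
  exhausted by bounded ones, for which the clamping construction applies.\<close>

lemma sub_slope_glue:
  assumes sG: "sub_slope M f G" and sH: "sub_slope M f H" and A: "A \<in> sets M"
  shows "sub_slope M f (\<lambda>x. if x \<in> A then H x else G x)"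
proof -
  have "A \<in> sigma_sets UNIV {S. open S}" using A by (simp add: sets_M sets_borel)
  then show ?thesis using sG sH
  proof (induction A arbitrary: G H rule: sigma_sets.induct)
    case (Basic U)
    define x0 :: 'a where "x0 = undefined"
    let ?A = "\<lambda>n::nat. U \<inter> ball x0 (real n)"
    have "\<exists>n::nat. dist x0 x < real n" for x by (rule reals_Archimedean2)
    then have "U = (\<Union>n. ?A n)" by auto
    moreover have "sub_slope M f (\<lambda>x. if x \<in> (\<Union>n. ?A n) then H x else G x)"
    proof (rule sub_slope_glue_incseq[OF _ _ _ Basic(2,3)])
      show "sub_slope M f (\<lambda>x. if x \<in> ?A n then H x else G x)" for n
        by (rule sub_slope_glue_open[OF Basic(2,3)]) (use Basic(1) in auto)
      show "incseq ?A" by (auto simp: incseq_def)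
    qed (use Basic(1) in \<open>auto simp: sets_M\<close>)
    ultimately show ?case by simp
  next
    case Empty
    then show ?case by simp
  next
    case (Compl A)
    from Compl(2)[OF Compl(4,3)]
    have "sub_slope M f (\<lambda>x. if x \<in> A then G x else H x)" .
    moreover have "(\<lambda>x. if x \<in> A then G x else H x) = (\<lambda>x. if x \<in> UNIV - A then H x else G x)" by auto
    ultimately show ?case by simp
  next
    case (Union A)
    let ?A = "\<lambda>n::nat. \<Union>i<n. A i"
    have m: "A i \<in> sets M" for i using Union(1) by (simp add: sets_M sets_borel)
    have s: "sub_slope M f (\<lambda>x. if x \<in> ?A n then H x else G x)" for n
    proof (induction n)
      case 0
      then show ?case using Union(3) by simp
    next
      case (Suc n)
      have "(\<lambda>x. if x \<in> A n then H x else if x \<in> ?A n then H x else G x) = (\<lambda>x. if x \<in> ?A (Suc n) then H x else G x)"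
        by (auto simp: lessThan_Suc)
      then show ?case using Union(2)[OF Suc Union(4), of n] by (simp only:)
    qed
    have "sub_slope M f (\<lambda>x. if x \<in> (\<Union>n. ?A n) then H x else G x)"
    proof (rule sub_slope_glue_incseq[OF _ _ s Union(3,4)])
      show "incseq ?A" by (fastforce simp: incseq_def)
    qed (use m in auto)
    moreover have "(\<Union>n. ?A n) = (\<Union>i. A i)" by auto
    ultimately show ?case by simp
  qed
qed

lemma sub_slope_min:
  assumes "sub_slope M f G" "sub_slope M f H"
  shows "sub_slope M f (\<lambda>x. min (G x) (H x))"
proof -
  have [measurable]: "G \<in> borel_measurable M" "H \<in> borel_measurable M"
    using assms by (auto simp: sub_slope_def L2_measurable)
  have "{x \<in> space M. H x < G x} \<in> sets M" by measurable
  then have "{x. H x < G x} \<in> sets M" by simp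
  from sub_slope_glue[OF assms this]
  have "sub_slope M f (\<lambda>x. if H x < G x then H x else G x)" by simp
  moreover have "(\<lambda>x. if H x < G x then H x else G x) = (\<lambda>x. min (G x) (H x))" by auto
  ultimately show ?thesis by (simp only:)
qed

lemma least_sub_slope_exists:
  assumes "sub_slope M f G"
  obtains G0 where "least_sub_slope M f G0"
proof -
  obtain G0 where "G0 \<in> Collect (sub_slope M f)" "\<And>H. H \<in> Collect (sub_slope M f) \<Longrightarrow> AE x in M. G0 x \<le> H x"
  proof (rule L2_lattice_min[of "Collect (sub_slope M f)" M])
    fix G :: "nat \<Rightarrow> 'a \<Rightarrow> real" and G0
    assume *: "\<And>n. G n \<in> Collect (sub_slope M f)" "G0 \<in> L2 M" "AE x in M. (\<lambda>n. G n x) \<longlonglongrightarrow> G0 x"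
      "AE x in M. \<forall>n. 0 \<le> G0 x \<and> G0 x \<le> G n x \<and> G n x \<le> G 0 x"
    have [measurable]: "G n \<in> borel_measurable M" "G0 \<in> borel_measurable M" for n
      using *(1)[of n] *(2) by (auto simp: sub_slope_def L2_measurable)
    have "sub_slope M f G0"
    proof (rule sub_slope_closed[of "\<lambda>_. f" G])
      show "AE x in M. 0 \<le> G0 x" using *(4) by eventually_elim simp
      show "(\<lambda>k. sqn M (\<lambda>x. max 0 (G k x - G0 x))) \<longlonglongrightarrow> 0"
      proof (rule sqn_dominated)
        show "G 0 \<in> L2 M" using *(1)[of 0] by (simp add: sub_slope_def)
        show "AE x in M. \<bar>max 0 (G n x - G0 x)\<bar> \<le> G 0 x" for n
          using *(4) by eventually_elim (smt (verit))
        show "AE x in M. (\<lambda>n. max 0 (G n x - G0 x)) \<longlonglongrightarrow> 0" using *(3)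
        proof eventually_elim
          case (elim x)
          have "(\<lambda>n. max 0 (G n x - G0 x)) \<longlonglongrightarrow> max 0 (G0 x - G0 x)" by (intro tendsto_intros elim)
          then show ?case by simp
        qed
      qed measurable
    qed (use * in \<open>auto simp: sub_slope_def\<close>)
    then show "G0 \<in> Collect (sub_slope M f)" by simp
  next
    fix G0 assume "G0 \<in> Collect (sub_slope M f)" "\<And>H. H \<in> Collect (sub_slope M f) \<Longrightarrow> AE x in M. G0 x \<le> H x"
    then show thesis by (rule that)
  next
    show "Collect (sub_slope M f) \<subseteq> L2 M" by (auto simp: sub_slope_def)
    show "Collect (sub_slope M f) \<noteq> {}" using assms by blast
    show "AE x in M. 0 \<le> G x" if "G \<in> Collect (sub_slope M f)" for G
      using that by (simp add: sub_slope_def)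
    show "(\<lambda>x. min (G x) (H x)) \<in> Collect (sub_slope M f)"
      if "G \<in> Collect (sub_slope M f)" "H \<in> Collect (sub_slope M f)" for G H
      using that by (simp add: sub_slope_min)
  qed
  then show thesis using that[of G0] by (simp add: least_sub_slope_def)
qed

lemma lip_a_L2:
  assumes "\<phi> \<in> LIP_bd" "G \<in> L2 M" "excess M \<phi> G < \<infinity>"
  shows "lip_a \<phi> \<in> L2 M"
proof (rule L2_bounded_add[OF lip_a_meas[OF assms(1)] assms(2)])
  show "(\<lambda>x. max 0 (lip_a \<phi> x - G x)) \<in> L2 M"
    using assms excess_meas[OF assms(1) L2_measurable[OF assms(2)]] by (simp add: L2_iff excess_def)
  show "AE x in M. \<bar>lip_a \<phi> x\<bar> \<le> \<bar>G x\<bar> + \<bar>max 0 (lip_a \<phi> x - G x)\<bar>"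
    using lip_a_nonneg[of \<phi>] by (intro AE_I2) (smt (verit))
qed

end

section \<open>Minimal slopes and locality\<close>

context boundedly_finite_measure begin

lemma excess_le_sqn_diff:
  "excess M \<phi> G \<le> sqn M (\<lambda>x. lip_a \<phi> x - G x)"
  unfolding excess_def by (rule sqn_mono_AE) auto

text \<open>At the least sub-slope one-sided control improves to strong convergence: the energies
  cannot fall below that of G in the limit, since convex combinations would produce a smaller
  competitor, and almost equal energies together with a small positive part of a - G force a to be
  close to G.\<close>

lemma lip_a_tendsto_min:
  assumes m: "least_sub_slope M f G" and \<phi>: "\<And>n. \<phi> n \<in> LIP_bd" "AE x in M. (\<lambda>n. \<phi> n x) \<longlonglongrightarrow> f x"
    "(\<lambda>n. excess M (\<phi> n) G) \<longlonglongrightarrow> 0" and aL2: "\<And>n. lip_a (\<phi> n) \<in> L2 M"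
  shows "(\<lambda>n. sqn M (\<lambda>x. lip_a (\<phi> n) x - G x)) \<longlonglongrightarrow> 0"
proof -
  have sG: "sub_slope M f G" using m by (simp add: least_sub_slope_def)
  then have G: "G \<in> L2 M" and Gm: "G \<in> borel_measurable M" and G0: "AE x in M. 0 \<le> G x"
    and fm: "f \<in> borel_measurable M" by (auto simp: sub_slope_def L2_measurable)
  define a where "a n = lip_a (\<phi> n)" for n
  define e where "e n x = max 0 (a n x - G x)" for n x
  have a: "a n \<in> L2 M" for n using aL2 by (simp add: a_def)
  have em: "e n \<in> borel_measurable M" for n
    unfolding e_def[abs_def] a_def by (rule excess_meas[OF \<phi>(1) Gm])
  have e: "e n \<in> L2 M" for n
    by (rule L2_bounded_add[OF em a[of n] G]) (auto simp: e_def)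
  have e0: "(\<lambda>n. sqn M (e n)) \<longlonglongrightarrow> 0" using \<phi>(3) by (simp add: excess_def e_def[abs_def] a_def)
  have ie: "(\<lambda>n. \<integral>x. (e n x)\<^sup>2 \<partial>M) \<longlonglongrightarrow> 0"
    using L2_norm_tendsto[OF e, of "\<lambda>_. 0"] e0 by (simp add: L2_iff sqn_def)
  have iGe: "(\<lambda>n. \<integral>x. e n x * G x \<partial>M) \<longlonglongrightarrow> 0"
    by (rule L2_strong_inner[OF e G e0])
  define A where "A n = (\<integral>x. (a n x)\<^sup>2 \<partial>M)" for n
  define I where "I = (\<integral>x. (G x)\<^sup>2 \<partial>M)"
  have ii: "integrable M (\<lambda>x. (h x)\<^sup>2)" if "h \<in> L2 M" for h using that by (simp add: L2_def)
  text \<open>Lower semicontinuity of the energy: a limit along convex combinations of tails is again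
    a competitor for the minimal slope.\<close>
  have lsc: "\<exists>N. \<forall>n\<ge>N. I - \<epsilon> \<le> A n" if \<epsilon>: "\<epsilon> > 0" for \<epsilon>
  proof -
    define J where "J l = (\<integral>x. (lip_a (comb l \<phi>) x)\<^sup>2 \<partial>M)" for l
    have cbd: "comb l \<phi> \<in> LIP_bd" for l by (rule comb_LIP_bd) (rule \<phi>(1))
    have cL2: "lip_a (comb l \<phi>) \<in> L2 M" if "l \<in> tail_weights N" for l N
    proof (rule L2_bounded[OF lip_a_meas[OF cbd]])
      show "comb l a \<in> L2 M" by (rule comb_L2[OF a])
      show "AE x in M. \<bar>lip_a (comb l \<phi>) x\<bar> \<le> \<bar>comb l a x\<bar>"
        using lip_a_comb[of l N \<phi>, OF that \<phi>(1)] lip_a_nonneg[of "comb l \<phi>"]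
        by (intro AE_I2) (auto simp: a_def[abs_def] intro: order_trans[OF _ abs_ge_self])
    qed
    let ?D = "\<lambda>l l'. (\<integral>x. (lip_a (comb l \<phi>) x - lip_a (comb l' \<phi>) x)\<^sup>2 \<partial>M) / 2"
    have D: "?D l l' \<le> J l + J l' - 2 * J (mix (1/2) l l')"
      if l: "l \<in> tail_weights 0" and l': "l' \<in> tail_weights 0" for l l'
    proof -
      have "J (mix (1/2) l l') \<le> (\<integral>x. ((1 - 1/2) * lip_a (comb l \<phi>) x + 1/2 * lip_a (comb l' \<phi>) x)\<^sup>2 \<partial>M)"
        unfolding J_def
      proof (rule integral_mono)
        show "integrable M (\<lambda>x. (lip_a (comb (mix (1/2) l l') \<phi>) x)\<^sup>2)"
          by (rule ii[OF cL2[of _ 0]]) (rule mix_tail_weights[OF l l'], auto)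
        show "integrable M (\<lambda>x. ((1 - 1/2) * lip_a (comb l \<phi>) x + 1/2 * lip_a (comb l' \<phi>) x)\<^sup>2)"
          by (intro ii L2_add L2_cmult cL2[OF l] cL2[OF l'])
        fix x
        have "comb (mix (1/2) l l') \<phi> = (\<lambda>x. (1 - 1/2) * comb l \<phi> x + 1/2 * comb l' \<phi> x)"
          by (rule ext) (rule comb_mix[OF tail_weights_finite[OF l] tail_weights_finite[OF l']])
        then have "lip_a (comb (mix (1/2) l l') \<phi>) x \<le> lip_a (\<lambda>x. (1 - 1/2) * comb l \<phi> x) x + lip_a (\<lambda>x. 1/2 * comb l' \<phi> x) x"
          using lip_a_add[OF LIP_bd_cmult[OF cbd[of l], of "1 - 1/2"] LIP_bd_cmult[OF cbd[of l'], of "1/2"], of x] by (simp only:)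
        also have "\<dots> \<le> \<bar>1 - 1/2\<bar> * lip_a (comb l \<phi>) x + \<bar>1/2\<bar> * lip_a (comb l' \<phi>) x"
          by (intro add_mono lip_a_cmult cbd)
        finally have "lip_a (comb (mix (1/2) l l') \<phi>) x \<le> (1 - 1/2) * lip_a (comb l \<phi>) x + 1/2 * lip_a (comb l' \<phi>) x" by simp
        then show "(lip_a (comb (mix (1/2) l l') \<phi>) x)\<^sup>2 \<le> ((1 - 1/2) * lip_a (comb l \<phi>) x + 1/2 * lip_a (comb l' \<phi>) x)\<^sup>2"
          by (intro power_mono lip_a_nonneg)
      qed
      then show ?thesis using L2_parallelogram[OF cL2[OF l] cL2[OF l']] by (simp add: J_def)
    qed
    have Ju: "J (\<lambda>i. if i = n then 1 else 0) = A n" for n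
    proof -
      have "comb (\<lambda>i. if i = n then 1 else 0) \<phi> = \<phi> n" by (rule ext) simp
      then show ?thesis by (simp only: J_def A_def a_def)
    qed
    \<comment> \<open>From a \<le> G + e and (G + e)^2 \<le> 2 G^2 + 2 e^2, at an index where the
      energy of e is below 1.\<close>
    have bound: "\<exists>l\<in>tail_weights n. J l \<le> 2 * I + 2 * 1" for n
    proof -
      have "eventually (\<lambda>m. (\<integral>x. (e m x)\<^sup>2 \<partial>M) < 1) sequentially" using ie by (rule order_tendstoD) simp
      then obtain m where m: "m \<ge> n" "(\<integral>x. (e m x)\<^sup>2 \<partial>M) < 1"
        unfolding eventually_sequentially by (meson nat_le_linear order_trans)
      have "A m \<le> (\<integral>x. 2 * (G x)\<^sup>2 + 2 * (e m x)\<^sup>2 \<partial>M)" unfolding A_def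
      proof (rule integral_mono_AE[OF ii[OF a]])
        show "integrable M (\<lambda>x. 2 * (G x)\<^sup>2 + 2 * (e m x)\<^sup>2)" using ii[OF G] ii[OF e] by simp
        show "AE x in M. (a m x)\<^sup>2 \<le> 2 * (G x)\<^sup>2 + 2 * (e m x)\<^sup>2" using G0
        proof eventually_elim
          case (elim x)
          have "0 \<le> a m x" by (simp add: a_def lip_a_nonneg)
          moreover have "a m x \<le> G x + e m x" by (simp add: e_def)
          ultimately have "(a m x)\<^sup>2 \<le> (G x + e m x)\<^sup>2" by (intro power_mono)
          also have "\<dots> \<le> 2 * (G x)\<^sup>2 + 2 * (e m x)\<^sup>2"
            using sum_squares_bound[of "G x" "e m x"] by (simp add: power2_sum)
          finally show ?case .
        qed
      qed
      also have "\<dots> = 2 * I + 2 * (\<integral>x. (e m x)\<^sup>2 \<partial>M)" using ii[OF G] ii[OF e] by (simp add: I_def)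
      finally have "J (\<lambda>i. if i = m then 1 else 0) \<le> 2 * I + 2 * 1" using m(2) unfolding Ju by linarith
      then show ?thesis using unit_tail_weights[OF m(1)] by blast
    qed
    obtain w where w: "\<And>n. w n \<in> tail_weights n" "\<And>n l. l \<in> tail_weights n \<Longrightarrow> J (w n) \<le> J l + 1 / real (Suc n)"
      "\<And>e. e > 0 \<Longrightarrow> \<exists>N. \<forall>m\<ge>N. \<forall>n\<ge>N. ?D (w m) (w n) < e"
    proof (rule near_minimisers[of tail_weights J "2 * I + 2 * 1" "mix (1/2)" ?D])
      fix l l' assume "l \<in> tail_weights 0" "l' \<in> tail_weights 0"
      then show "?D l l' \<le> J l + J l' - 2 * J (mix (1/2) l l')" by (rule D)
    next
      fix w assume "\<And>n. w n \<in> tail_weights n" "\<And>n l. l \<in> tail_weights n \<Longrightarrow> J (w n) \<le> J l + 1 / real (Suc n)"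
        "\<And>e. e > 0 \<Longrightarrow> \<exists>N. \<forall>m\<ge>N. \<forall>n\<ge>N. ?D (w m) (w n) < e"
      then show thesis by (rule that)
    next
      show "mix (1/2) l l' \<in> tail_weights n" if "l \<in> tail_weights n" "l' \<in> tail_weights n" for n l l'
        using that by (intro mix_tail_weights) auto
      show "0 \<le> J l" for l by (simp add: J_def)
    qed (use bound tail_weights_antimono in auto)
    have yL2: "lip_a (comb (w n) \<phi>) \<in> L2 M" for n by (rule cL2[OF w(1)])
    have cauchy: "\<exists>N. \<forall>m\<ge>N. \<forall>n\<ge>N. sqn M (\<lambda>x. lip_a (comb (w m) \<phi>) x - lip_a (comb (w n) \<phi>) x) < ennreal \<delta>" if "\<delta> > 0" for \<delta>
    proof (rule sqn_CauchyI[OF _ _ that])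
      show "(\<lambda>x. lip_a (comb (w m) \<phi>) x - lip_a (comb (w n) \<phi>) x) \<in> L2 M" for m n by (intro L2_diff yL2)
    qed (use w(3) in simp)
    obtain y and r :: "nat \<Rightarrow> nat" where ym: "y \<in> borel_measurable M" and "strict_mono r"
      and yae: "AE x in M. (\<lambda>k. lip_a (comb (w (r k)) \<phi>) x) \<longlonglongrightarrow> y x"
      and yl: "(\<lambda>n. sqn M (\<lambda>x. lip_a (comb (w n) \<phi>) x - y x)) \<longlonglongrightarrow> 0"
      by (rule L2_complete[of "\<lambda>n. lip_a (comb (w n) \<phi>)" M, OF L2_measurable[OF yL2] cauchy])
    have y: "y \<in> L2 M" by (rule L2_limit[of "\<lambda>n. lip_a (comb (w n) \<phi>)", OF yL2 ym yl])
    have y0: "AE x in M. 0 \<le> y x" using yae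
    proof eventually_elim
      case (elim x)
      show ?case by (rule LIMSEQ_le_const[OF elim]) (simp add: lip_a_nonneg)
    qed
    have "sub_slope M f y"
    proof (rule sub_slopeI[OF fm y y0 cbd[of "w _"]])
      show "AE x in M. (\<lambda>n. comb (w n) \<phi> x) \<longlonglongrightarrow> f x"
        using \<phi>(2) by eventually_elim (rule comb_tendsto[OF w(1)])
      show "(\<lambda>n. excess M (comb (w n) \<phi>) y) \<longlonglongrightarrow> 0"
        by (rule ennreal_squeeze_0[OF yl excess_le_sqn_diff])
    qed
    then have Gy: "AE x in M. G x \<le> y x" using m by (simp add: least_sub_slope_def)
    have "I \<le> (\<integral>x. (y x)\<^sup>2 \<partial>M)" unfolding I_def
    proof (rule integral_mono_AE[OF ii[OF G] ii[OF y]])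
      show "AE x in M. (G x)\<^sup>2 \<le> (y x)\<^sup>2" using Gy G0 by eventually_elim (rule power_mono)
    qed
    moreover have Jl: "(\<lambda>n. J (w n)) \<longlonglongrightarrow> (\<integral>x. (y x)\<^sup>2 \<partial>M)"
      unfolding J_def by (rule L2_norm_tendsto[OF yL2 y yl])
    ultimately have "eventually (\<lambda>n. I - \<epsilon> / 2 < J (w n)) sequentially"
      using \<epsilon> by (intro order_tendstoD(1)[OF Jl]) linarith
    moreover have "eventually (\<lambda>n. 1 / real (Suc n) < \<epsilon> / 2) sequentially"
      using LIMSEQ_inverse_real_of_nat \<epsilon> by (intro order_tendstoD(2)[of _ 0]) (simp_all add: inverse_eq_divide)
    ultimately have "eventually (\<lambda>n. I - \<epsilon> / 2 < J (w n) \<and> 1 / real (Suc n) < \<epsilon> / 2) sequentially"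
      by (rule eventually_conj)
    then obtain N where N: "I - \<epsilon> / 2 < J (w N)" "1 / real (Suc N) < \<epsilon> / 2"
      unfolding eventually_sequentially by blast
    \<comment> \<open>For n \<ge> N the single function \<phi> n is itself a combination of the N-th
      tail, so its energy is at least that of the near-minimiser \<open>w N\<close> up to 1 /
      (N+1).\<close>
    have "I - \<epsilon> \<le> A n" if "n \<ge> N" for n
      using w(2)[OF unit_tail_weights[OF that]] N unfolding Ju by linarith
    then show ?thesis by blast
  qed
  \<comment> \<open>Pointwise: if a \<le> G, then e = 0 and (a - G)^2 \<le> G^2 - a^2; if a = G + e,
    both sides equal e^2.\<close>
  have key: "(\<integral>x. (a n x - G x)\<^sup>2 \<partial>M) \<le> I - A n + 2 * (\<integral>x. e n x * G x \<partial>M) + 2 * (\<integral>x. (e n x)\<^sup>2 \<partial>M)" for n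
  proof -
    have ieG: "integrable M (\<lambda>x. e n x * G x)" by (rule L2_mult_integrable[OF e G])
    have "(\<integral>x. (a n x - G x)\<^sup>2 \<partial>M) \<le> (\<integral>x. (G x)\<^sup>2 - (a n x)\<^sup>2 + 2 * (e n x * G x) + 2 * (e n x)\<^sup>2 \<partial>M)"
    proof (rule integral_mono_AE)
      show "integrable M (\<lambda>x. (a n x - G x)\<^sup>2)" by (intro ii L2_diff a G)
      show "integrable M (\<lambda>x. (G x)\<^sup>2 - (a n x)\<^sup>2 + 2 * (e n x * G x) + 2 * (e n x)\<^sup>2)"
        using ii[OF G] ii[OF a] ii[OF e] ieG by simp
      show "AE x in M. (a n x - G x)\<^sup>2 \<le> (G x)\<^sup>2 - (a n x)\<^sup>2 + 2 * (e n x * G x) + 2 * (e n x)\<^sup>2"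
        using G0
      proof eventually_elim
        case (elim x)
        have a0: "0 \<le> a n x" by (simp add: a_def lip_a_nonneg)
        show ?case
        proof (cases "a n x \<le> G x")
          case True
          then have "e n x = 0" by (simp add: e_def)
          moreover have "a n x * a n x \<le> a n x * G x" using True a0 by (intro mult_left_mono)
          ultimately show ?thesis by (simp add: power2_eq_square algebra_simps)
        next
          case False
          then have "e n x = a n x - G x" by (simp add: e_def)
          then have ag: "a n x = G x + e n x" by simp
          show ?thesis unfolding ag by (simp add: power2_eq_square algebra_simps)
        qed
      qed
    qed
    also have "\<dots> = I - A n + 2 * (\<integral>x. e n x * G x \<partial>M) + 2 * (\<integral>x. (e n x)\<^sup>2 \<partial>M)"
      unfolding I_def A_def using ii[OF G] ii[OF a] ii[OF e] ieG by simp
    finally show ?thesis .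
  qed
  have "(\<lambda>n. \<integral>x. (a n x - G x)\<^sup>2 \<partial>M) \<longlonglongrightarrow> 0"
  proof (rule LIMSEQ_I)
    fix \<epsilon> :: real assume \<epsilon>: "0 < \<epsilon>"
    obtain N1 where N1: "\<And>n. n \<ge> N1 \<Longrightarrow> I - \<epsilon>/2 \<le> A n" using lsc[of "\<epsilon>/2"] \<epsilon> by auto
    have "(\<lambda>n. 2 * (\<integral>x. e n x * G x \<partial>M) + 2 * (\<integral>x. (e n x)\<^sup>2 \<partial>M)) \<longlonglongrightarrow> 2 * 0 + 2 * 0"
      by (intro tendsto_intros iGe ie)
    then have "eventually (\<lambda>n. 2 * (\<integral>x. e n x * G x \<partial>M) + 2 * (\<integral>x. (e n x)\<^sup>2 \<partial>M) < \<epsilon> / 2) sequentially"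
      by (rule order_tendstoD) (use \<epsilon> in simp)
    then obtain N2 where N2: "\<And>n. n \<ge> N2 \<Longrightarrow> 2 * (\<integral>x. e n x * G x \<partial>M) + 2 * (\<integral>x. (e n x)\<^sup>2 \<partial>M) < \<epsilon> / 2"
      unfolding eventually_sequentially by blast
    have "norm ((\<integral>x. (a n x - G x)\<^sup>2 \<partial>M) - 0) < \<epsilon>" if "n \<ge> max N1 N2" for n
    proof -
      have "(\<integral>x. (a n x - G x)\<^sup>2 \<partial>M) < \<epsilon>" using key[of n] N1[of n] N2[of n] that by auto
      then show ?thesis by simp
    qed
    then show "\<exists>no. \<forall>n\<ge>no. norm ((\<integral>x. (a n x - G x)\<^sup>2 \<partial>M) - 0) < \<epsilon>" by blast
  qed
  then show ?thesis using L2_tendsto_iff[of a M G] a G by (simp add: L2_tendsto_def a_def)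
qed

text \<open>Mazur's lemma makes convex combinations of the slopes converge strongly to H, and the
  slope of a combination lies below the combination of the slopes, which is enough for the one-sided
  excess. The sign of H, on which \<open>relaxed_slope\<close> is silent, comes from the same
  combinations.\<close>

lemma relaxed_imp_sub_slope:
  assumes "relaxed_slope M f H"
  shows "sub_slope M f H"
proof -
  obtain \<phi> where \<phi>: "\<And>n. \<phi> n \<in> LIP_bd" "L0_tendsto M \<phi> f" "L2_weakly_tendsto M (\<lambda>n. lip_a (\<phi> n)) H"
    using assms unfolding relaxed_slope_def by blast
  obtain r where r: "\<And>k. k \<le> r k" "AE x in M. (\<lambda>k. \<phi> (r k) x) \<longlonglongrightarrow> f x"
    using L0_AE_subseq[OF \<phi>(2)] by blast
  have H: "H \<in> L2 M" and lL2: "\<And>n. lip_a (\<phi> n) \<in> L2 M" using \<phi>(3) by (auto simp: L2_weakly_tendsto_def)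
  have Hm: "H \<in> borel_measurable M" using H by (rule L2_measurable)
  have "L2_weakly_tendsto M (\<lambda>k. lip_a (\<phi> (r k))) H"
    using \<phi>(3) filterlim_compose[OF _ filterlim_ge_self[of r, OF r(1)]]
    unfolding L2_weakly_tendsto_def by blast
  from L2_Mazur[OF this] obtain l where l: "\<And>n. l n \<in> tail_weights n"
    "(\<lambda>n. sqn M (\<lambda>x. comb (l n) (\<lambda>k. lip_a (\<phi> (r k))) x - H x)) \<longlonglongrightarrow> 0" by blast
  let ?c = "\<lambda>n. comb (l n) (\<lambda>k. lip_a (\<phi> (r k)))"
  have cm: "?c n \<in> borel_measurable M" for n by (intro comb_measurable lip_a_meas \<phi>)
  have c0: "0 \<le> ?c n x" for n x
    using l(1)[of n] by (auto simp: comb_def tail_weights_def intro!: sum_nonneg mult_nonneg_nonneg lip_a_nonneg)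
  have H0: "AE x in M. 0 \<le> H x"
  proof -
    have "(\<lambda>n::nat. sqn M (\<lambda>x. max 0 (- H x))) \<longlonglongrightarrow> 0"
    proof (rule sqn_tendsto_mono[OF _ l(2)], intro AE_I2)
      fix n x show "\<bar>max 0 (- H x)\<bar> \<le> \<bar>?c n x - H x\<bar>" using c0[of n x] by linarith
    qed
    then have "sqn M (\<lambda>x. max 0 (- H x)) = 0" by (simp add: LIMSEQ_const_iff)
    then have "AE x in M. ennreal ((max 0 (- H x))\<^sup>2) = 0"
      unfolding sqn_def using Hm by (subst (asm) nn_integral_0_iff_AE) auto
    then show ?thesis by eventually_elim (auto simp: max_def split: if_splits)
  qed
  show ?thesis
  proof (rule sub_slopeI[OF _ H H0])
    show "f \<in> borel_measurable M" using \<phi>(2) by (simp add: L0_tendsto_def)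
    show "comb (l n) (\<lambda>k. \<phi> (r k)) \<in> LIP_bd" for n by (intro comb_LIP_bd \<phi>)
    show "AE x in M. (\<lambda>n. comb (l n) (\<lambda>k. \<phi> (r k)) x) \<longlonglongrightarrow> f x"
      using r(2) by eventually_elim (rule comb_tendsto[OF l(1)])
    show "(\<lambda>n. excess M (comb (l n) (\<lambda>k. \<phi> (r k))) H) \<longlonglongrightarrow> 0"
      unfolding excess_def
    proof (rule sqn_tendsto_mono[OF _ l(2)], intro AE_I2)
      fix n x
      have "lip_a (comb (l n) (\<lambda>k. \<phi> (r k))) x \<le> ?c n x" by (rule lip_a_comb[OF l(1) \<phi>(1)])
      then show "\<bar>max 0 (lip_a (comb (l n) (\<lambda>k. \<phi> (r k))) x - H x)\<bar> \<le> \<bar>?c n x - H x\<bar>" by linarith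
    qed
  qed
qed

text \<open>Early members may have infinite excess; dropping them leaves square integrable slopes,
  as the notions of convergence in L2 demand.\<close>

lemma sub_slope_L2_sequence:
  assumes "sub_slope M f G"
  obtains \<phi> where "\<And>n. \<phi> n \<in> LIP_bd" "AE x in M. (\<lambda>n. \<phi> n x) \<longlonglongrightarrow> f x" "(\<lambda>n. excess M (\<phi> n) G) \<longlonglongrightarrow> 0"
    "\<And>n. lip_a (\<phi> n) \<in> L2 M"
proof -
  obtain \<phi> where \<phi>: "\<And>n. \<phi> n \<in> LIP_bd" "AE x in M. (\<lambda>n. \<phi> n x) \<longlonglongrightarrow> f x" "(\<lambda>n. excess M (\<phi> n) G) \<longlonglongrightarrow> 0"
    and G: "G \<in> L2 M" using sub_slopeE[OF assms] by blast
  from \<phi>(3)[unfolded tendsto_0_ennreal_iff, rule_format, OF zero_less_one]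
  obtain N where N: "\<And>n. n \<ge> N \<Longrightarrow> excess M (\<phi> n) G < ennreal 1" unfolding eventually_sequentially by blast
  show thesis
  proof (rule that[of "\<lambda>n. \<phi> (n + N)"])
    show "AE x in M. (\<lambda>n. \<phi> (n + N) x) \<longlonglongrightarrow> f x"
      using \<phi>(2) by eventually_elim (rule LIMSEQ_ignore_initial_segment)
    show "(\<lambda>n. excess M (\<phi> (n + N)) G) \<longlonglongrightarrow> 0" using \<phi>(3) by (rule LIMSEQ_ignore_initial_segment)
    show "lip_a (\<phi> (n + N)) \<in> L2 M" for n
      by (rule lip_a_L2[OF \<phi>(1) G]) (use less_trans[OF N[of "n + N"] ennreal_less_top] in simp)
  qed (rule \<phi>(1))
qed

lemma least_sub_slope_imp_is_minimal_slope:
  assumes m: "least_sub_slope M f G"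
  shows "is_minimal_slope M f G"
proof -
  have s: "sub_slope M f G" using m by (simp add: least_sub_slope_def)
  then have G: "G \<in> L2 M" "AE x in M. 0 \<le> G x" and fm: "f \<in> borel_measurable M" by (auto simp: sub_slope_def)
  obtain \<phi> where \<phi>: "\<And>n. \<phi> n \<in> LIP_bd" "AE x in M. (\<lambda>n. \<phi> n x) \<longlonglongrightarrow> f x" "(\<lambda>n. excess M (\<phi> n) G) \<longlonglongrightarrow> 0"
    "\<And>n. lip_a (\<phi> n) \<in> L2 M" using sub_slope_L2_sequence[OF s] by blast
  have "L2_weakly_tendsto M (\<lambda>n. lip_a (\<phi> n)) G"
    by (rule L2_strong_imp_weak[OF \<phi>(4) G(1) lip_a_tendsto_min[OF m \<phi>]])
  moreover have "L0_tendsto M \<phi> f" by (rule AE_imp_L0_tendsto[OF LIP_bd_meas[OF \<phi>(1)] fm \<phi>(2)])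
  ultimately have "relaxed_slope M f G" unfolding relaxed_slope_def using \<phi>(1) by blast
  then show ?thesis unfolding is_minimal_slope_def
    using G m relaxed_imp_sub_slope by (auto simp: least_sub_slope_def)
qed

text \<open>The choice in \<open>slope\<close> is minimal only among the limits that occur in
  relaxation. A least sub-slope is one of these, so comparison with it extends minimality to all
  sub-slopes.\<close>

lemma slope_least_sub_slope:
  assumes "sub_slope M f G"
  shows "least_sub_slope M f (slope M f)"
proof -
  obtain G0 where G0: "least_sub_slope M f G0" using least_sub_slope_exists[OF assms] .
  have im0: "is_minimal_slope M f G0" by (rule least_sub_slope_imp_is_minimal_slope[OF G0])
  have im: "is_minimal_slope M f (slope M f)" unfolding slope_def by (rule someI[of "is_minimal_slope M f", OF im0])
  then have s: "sub_slope M f (slope M f)" by (simp add: is_minimal_slope_def relaxed_imp_sub_slope)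
  have le: "AE x in M. slope M f x \<le> G0 x" using im im0 by (simp add: is_minimal_slope_def)
  show ?thesis unfolding least_sub_slope_def
  proof (intro conjI allI impI s)
    fix H assume "sub_slope M f H"
    then have "AE x in M. G0 x \<le> H x" using G0 by (simp add: least_sub_slope_def)
    with le show "AE x in M. slope M f x \<le> H x" by eventually_elim simp
  qed
qed

lemma S2_iff: "f \<in> S2 M \<longleftrightarrow> (\<exists>G. sub_slope M f G)"
proof
  assume "f \<in> S2 M"
  then show "\<exists>G. sub_slope M f G" by (auto simp: S2_def intro: relaxed_imp_sub_slope)
next
  assume "\<exists>G. sub_slope M f G"
  then obtain G where G: "sub_slope M f G" ..
  then have fm: "f \<in> borel_measurable M" by (simp add: sub_slope_def)
  have "is_minimal_slope M f (slope M f)"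
    using G slope_least_sub_slope least_sub_slope_imp_is_minimal_slope by blast
  then show "f \<in> S2 M" using fm by (auto simp: S2_def is_minimal_slope_def)
qed

lemma S2_least_sub_slope: "f \<in> S2 M \<Longrightarrow> least_sub_slope M f (slope M f)"
  using S2_iff slope_least_sub_slope by blast

lemma S2_sub_slope: "f \<in> S2 M \<Longrightarrow> sub_slope M f (slope M f)"
  using S2_least_sub_slope by (simp add: least_sub_slope_def)

lemma slope_le_sub_slope: "sub_slope M f G \<Longrightarrow> AE x in M. slope M f x \<le> G x"
  using slope_least_sub_slope unfolding least_sub_slope_def by blast

section \<open>Sums, positive parts and locality\<close>

lemma sub_slope_add:
  assumes sf: "sub_slope M f G" and sh: "sub_slope M h H"
  shows "sub_slope M (\<lambda>x. f x + h x) (\<lambda>x. G x + H x)"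
proof -
  obtain \<phi> where \<phi>: "\<And>n. \<phi> n \<in> LIP_bd" "AE x in M. (\<lambda>n. \<phi> n x) \<longlonglongrightarrow> f x" "(\<lambda>n. excess M (\<phi> n) G) \<longlonglongrightarrow> 0"
    and fm: "f \<in> borel_measurable M" and G: "G \<in> L2 M" "G \<in> borel_measurable M" "AE x in M. 0 \<le> G x"
    using sub_slopeE[OF sf] by blast
  obtain \<psi> where \<psi>: "\<And>n. \<psi> n \<in> LIP_bd" "AE x in M. (\<lambda>n. \<psi> n x) \<longlonglongrightarrow> h x" "(\<lambda>n. excess M (\<psi> n) H) \<longlonglongrightarrow> 0"
    and hm: "h \<in> borel_measurable M" and H: "H \<in> L2 M" "H \<in> borel_measurable M" "AE x in M. 0 \<le> H x"
    using sub_slopeE[OF sh] by blast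
  show ?thesis
  proof (rule sub_slopeI)
    show "(\<lambda>x. f x + h x) \<in> borel_measurable M" using fm hm by simp
    show "(\<lambda>x. G x + H x) \<in> L2 M" using G H by (simp add: L2_add)
    show "AE x in M. 0 \<le> G x + H x" using G(3) H(3) by eventually_elim simp
    show "(\<lambda>x. \<phi> n x + \<psi> n x) \<in> LIP_bd" for n by (intro LIP_bd_add \<phi> \<psi>)
    show "AE x in M. (\<lambda>n. \<phi> n x + \<psi> n x) \<longlonglongrightarrow> f x + h x"
      using \<phi>(2) \<psi>(2) by eventually_elim (rule tendsto_add)
    show "(\<lambda>n. excess M (\<lambda>x. \<phi> n x + \<psi> n x) (\<lambda>x. G x + H x)) \<longlonglongrightarrow> 0"
      unfolding excess_def
    proof (rule sqn_tendsto_add[OF _ _ _ \<phi>(3)[unfolded excess_def] \<psi>(3)[unfolded excess_def]])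
      show "AE x in M. \<bar>max 0 (lip_a (\<lambda>x. \<phi> n x + \<psi> n x) x - (G x + H x))\<bar>
          \<le> \<bar>max 0 (lip_a (\<phi> n) x - G x)\<bar> + \<bar>max 0 (lip_a (\<psi> n) x - H x)\<bar>" for n
      proof (intro AE_I2)
        fix x
        from lip_a_add[OF \<phi>(1) \<psi>(1), of n n x]
        show "\<bar>max 0 (lip_a (\<lambda>x. \<phi> n x + \<psi> n x) x - (G x + H x))\<bar>
          \<le> \<bar>max 0 (lip_a (\<phi> n) x - G x)\<bar> + \<bar>max 0 (lip_a (\<psi> n) x - H x)\<bar>" by linarith
      qed
    qed (intro excess_meas \<phi> \<psi> G H)+
  qed
qed

lemma sub_slope_minus:
  assumes sf: "sub_slope M f G"
  shows "sub_slope M (\<lambda>x. - f x) G"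
proof -
  obtain \<phi> where \<phi>: "\<And>n. \<phi> n \<in> LIP_bd" "AE x in M. (\<lambda>n. \<phi> n x) \<longlonglongrightarrow> f x" "(\<lambda>n. excess M (\<phi> n) G) \<longlonglongrightarrow> 0"
    and fm: "f \<in> borel_measurable M" and G: "G \<in> L2 M" "AE x in M. 0 \<le> G x"
    using sub_slopeE[OF sf] by blast
  show ?thesis
  proof (rule sub_slopeI[OF _ G])
    show "(\<lambda>x. - f x) \<in> borel_measurable M" using fm by simp
    show "(\<lambda>x. - \<phi> n x) \<in> LIP_bd" for n by (intro LIP_bd_minus \<phi>)
    show "AE x in M. (\<lambda>n. - \<phi> n x) \<longlonglongrightarrow> - f x"
      using \<phi>(2) by eventually_elim (rule tendsto_minus)
    show "(\<lambda>n. excess M (\<lambda>x. - \<phi> n x) G) \<longlonglongrightarrow> 0"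
      unfolding excess_def
    proof (rule sqn_tendsto_mono[OF _ \<phi>(3)[unfolded excess_def]], intro AE_I2)
      fix n x
      show "\<bar>max 0 (lip_a (\<lambda>x. - \<phi> n x) x - G x)\<bar> \<le> \<bar>max 0 (lip_a (\<phi> n) x - G x)\<bar>"
        using lip_a_minus[OF \<phi>(1), of n x] by linarith
    qed
  qed
qed

text \<open>Cutting \<phi> at a level c k > 0 makes it vanish on an open set which, at a.e. x with f
  x \<le> 0, contains x from some n on; there no slope is left. At level 0 this could fail where f =
  0, since \<phi> may approach 0 from above. The levels are sent to 0 afterwards by
  closedness.\<close>

lemma sub_slope_pos_part:
  assumes sf: "sub_slope M f G"
  shows "sub_slope M (\<lambda>x. max 0 (f x)) (\<lambda>x. if f x > 0 then G x else 0)"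
proof -
  obtain \<phi> where \<phi>: "\<And>n. \<phi> n \<in> LIP_bd" "AE x in M. (\<lambda>n. \<phi> n x) \<longlonglongrightarrow> f x" "(\<lambda>n. excess M (\<phi> n) G) \<longlonglongrightarrow> 0"
    and fm[measurable]: "f \<in> borel_measurable M" and G: "G \<in> L2 M" and Gm[measurable]: "G \<in> borel_measurable M"
    and G0: "AE x in M. 0 \<le> G x"
    using sub_slopeE[OF sf] by blast
  let ?W = "\<lambda>x. if f x > 0 then G x else 0"
  have W: "?W \<in> L2 M" by (rule L2_bounded[OF _ G]) (auto, measurable)
  have W0: "AE x in M. 0 \<le> ?W x" using G0 by eventually_elim simp
  have [measurable]: "\<phi> n \<in> borel_measurable M" for n by (rule LIP_bd_meas[OF \<phi>(1)])
  define c where "c k = 1 / real (Suc k)" for k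
  have c: "c k > 0" for k by (simp add: c_def)
  have s: "sub_slope M (\<lambda>x. max 0 (f x - c k)) ?W" for k
  proof (rule sub_slopeI[OF _ W W0])
    let ?a = "\<lambda>n x. max 0 (\<phi> n x - c k)"
    show "?a n \<in> LIP_bd" for n by (intro LIP_bd_max LIP_bd_diff LIP_bd_const \<phi>)
    show "AE x in M. (\<lambda>n. ?a n x) \<longlonglongrightarrow> max 0 (f x - c k)"
      using \<phi>(2)
    proof eventually_elim
      case (elim x)
      then show ?case by (intro tendsto_intros)
    qed
    define E where "E n x = (if f x \<le> 0 \<and> \<phi> n x \<ge> c k then G x else 0)" for n x
    have Em: "E n \<in> borel_measurable M" for n unfolding E_def[abs_def] by measurable
    have E0: "(\<lambda>n. sqn M (E n)) \<longlonglongrightarrow> 0"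
    proof (rule sqn_dominated[OF Em G])
      show "AE x in M. \<bar>E n x\<bar> \<le> G x" for n using G0 by eventually_elim (simp add: E_def)
      show "AE x in M. (\<lambda>n. E n x) \<longlonglongrightarrow> 0" using \<phi>(2)
      proof eventually_elim
        case (elim x)
        show ?case
        proof (cases "f x \<le> 0")
          case True
          then have "eventually (\<lambda>n. \<phi> n x < c k) sequentially"
            using c[of k] by (intro order_tendstoD(2)[OF elim]) linarith
          then have "eventually (\<lambda>n. E n x = 0) sequentially" by eventually_elim (simp add: E_def)
          then show ?thesis by (rule tendsto_eventually)
        qed (simp add: E_def)
      qed
    qed
    show "(\<lambda>n. excess M (?a n) ?W) \<longlonglongrightarrow> 0"
      unfolding excess_def
    proof (rule sqn_tendsto_add[OF _ _ _ \<phi>(3)[unfolded excess_def] E0])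
      show "AE x in M. \<bar>max 0 (lip_a (?a n) x - ?W x)\<bar> \<le> \<bar>max 0 (lip_a (\<phi> n) x - G x)\<bar> + \<bar>E n x\<bar>" for n
        using G0
      proof eventually_elim
        case (elim x)
        show ?case
        proof (cases "\<phi> n x < c k")
          case True
          have "lip_a (?a n) x = 0"
          proof (rule lip_a_eq_0[of "{x. \<phi> n x < c k}"])
            show "open {x. \<phi> n x < c k}" by (intro open_Collect_less continuous_intros LIP_bd_continuous \<phi>)
          qed (use True in auto)
          then show ?thesis using elim by (simp add: max_def)
        next
          case False
          have "lip_a (?a n) x \<le> max (lip_a (\<lambda>_. 0) x) (lip_a (\<lambda>x. \<phi> n x - c k) x)"
            by (intro lip_a_max LIP_bd_diff LIP_bd_const \<phi>)
          also have "\<dots> \<le> lip_a (\<phi> n) x"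
            using lip_a_diff[OF \<phi>(1) LIP_bd_const, of n "c k" x] lip_a_nonneg[of "\<phi> n" x] by simp
          finally show ?thesis using False elim by (auto simp: E_def)
        qed
      qed
    qed (intro excess_meas \<phi> Gm Em)+
  qed measurable
  show ?thesis
  proof (rule sub_slope_closed[OF s _ _ W W0])
    have "(\<lambda>k. max 0 (f x - c k)) \<longlonglongrightarrow> max 0 (f x - 0)" for x
      unfolding c_def using LIMSEQ_inverse_real_of_nat by (intro tendsto_intros) (simp add: inverse_eq_divide)
    then show "AE x in M. (\<lambda>k. max 0 (f x - c k)) \<longlonglongrightarrow> max 0 (f x)" by simp
    show "(\<lambda>k. sqn M (\<lambda>x. max 0 (?W x - ?W x))) \<longlonglongrightarrow> 0" by (simp add: sqn_def)
  qed measurable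
qed

lemma sub_slope_neg_part:
  assumes sf: "sub_slope M f G"
  shows "sub_slope M (\<lambda>x. max 0 (- f x)) (\<lambda>x. if f x < 0 then G x else 0)"
  using sub_slope_pos_part[OF sub_slope_minus[OF sf]] by simp

lemma sub_slope_nonzero:
  assumes sf: "sub_slope M f G"
  shows "sub_slope M f (\<lambda>x. if f x \<noteq> 0 then G x else 0)"
proof -
  have "sub_slope M (\<lambda>x. max 0 (f x) + - max 0 (- f x)) (\<lambda>x. (if f x > 0 then G x else 0) + (if f x < 0 then G x else 0))"
    by (intro sub_slope_add sub_slope_minus sub_slope_pos_part sub_slope_neg_part sf)
  moreover have "(\<lambda>x. max 0 (f x) + - max 0 (- f x)) = f" by auto
  moreover have "(\<lambda>x. (if f x > 0 then G x else 0) + (if f x < 0 then G x else 0)) = (\<lambda>x. if f x \<noteq> 0 then G x else 0)"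
    by auto
  ultimately show ?thesis by (simp only:)
qed

text \<open>Write f = (f - h) + h. By \<open>sub_slope_nonzero\<close> the difference contributes
  only where f and h differ, so the crude bound G + H for it is harmless.\<close>

lemma slope_le_on_eq:
  assumes f: "sub_slope M f G" and h: "sub_slope M h H"
  shows "AE x in M. f x = h x \<longrightarrow> slope M f x \<le> H x"
proof -
  have "sub_slope M (\<lambda>x. f x + - h x) (\<lambda>x. G x + H x)" by (intro sub_slope_add sub_slope_minus f h)
  from sub_slope_add[OF sub_slope_nonzero[OF this] h]
  have "sub_slope M f (\<lambda>x. (if f x + - h x \<noteq> 0 then G x + H x else 0) + H x)" by simp
  from slope_le_sub_slope[OF this] show ?thesis by eventually_elim auto
qed

end

section \<open>Composition with Sobolev maps\<close>

lemma Lip_const_le: "L-lipschitz_on UNIV F \<Longrightarrow> Lip_const F \<le> L"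
  unfolding Lip_const_def by (rule cInf_lower) (auto intro!: bdd_belowI[of _ 0] dest: lipschitz_on_nonneg)

lemma separable_dense:
  fixes S :: "'b::metric_space set"
  assumes "separable_space (top_of_set S)"
  obtains Q where "countable Q" "\<And>y e. y \<in> S \<Longrightarrow> e > 0 \<Longrightarrow> \<exists>q\<in>Q. dist y q < e"
proof -
  from assms obtain Q where Q: "countable Q" "Q \<subseteq> S" "top_of_set S closure_of Q = S"
    unfolding separable_space_def by auto
  have "S \<subseteq> closure Q"
  proof -
    have "S \<inter> closure (S \<inter> Q) = S" using Q(3) by (simp add: closure_of_subtopology)
    then show ?thesis using closure_mono[of "S \<inter> Q" Q] by blast
  qed
  then have "\<exists>q\<in>Q. dist y q < e" if "y \<in> S" "e > 0" for y e
    using that by (metis closure_approachable dist_commute subsetD)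
  with Q(1) that show thesis by blast
qed

context boundedly_finite_measure begin

text \<open>The choice in \<open>map_slope\<close> presupposes a least bound. It exists because
  bounds are stable under minima, the inequality holding at a.e. point with either function, and
  under a.e. limits.\<close>

lemma map_slope_bound_map_slope:
  fixes u :: "'a \<Rightarrow> 'b::metric_space"
  assumes ex: "\<exists>G. map_slope_bound M u G"
  shows "map_slope_bound M u (map_slope M u)"
proof -
  let ?C = "Collect (map_slope_bound M u)"
  have "\<exists>G. map_slope_bound M u G \<and> (\<forall>H. map_slope_bound M u H \<longrightarrow> (AE x in M. G x \<le> H x))"
  proof -
    obtain G where "G \<in> ?C" "\<And>H. H \<in> ?C \<Longrightarrow> AE x in M. G x \<le> H x"
    proof (rule L2_lattice_min[of ?C M])
      show "?C \<subseteq> L2 M" by (auto simp: map_slope_bound_def)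
      show "?C \<noteq> {}" using ex by blast
      show "AE x in M. 0 \<le> G x" if "G \<in> ?C" for G using that by (simp add: map_slope_bound_def)
      show "(\<lambda>x. min (G x) (H x)) \<in> ?C" if "G \<in> ?C" "H \<in> ?C" for G H
      proof -
        have G: "G \<in> L2 M" "AE x in M. 0 \<le> G x" "\<And>F. F \<in> LIP \<Longrightarrow> F \<circ> u \<in> S2 M"
          "\<And>F. F \<in> LIP \<Longrightarrow> AE x in M. slope M (F \<circ> u) x \<le> Lip_const F * G x"
          using that by (auto simp: map_slope_bound_def)
        have H: "H \<in> L2 M" "AE x in M. 0 \<le> H x"
          "\<And>F. F \<in> LIP \<Longrightarrow> AE x in M. slope M (F \<circ> u) x \<le> Lip_const F * H x"
          using that by (auto simp: map_slope_bound_def)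
        have "(\<lambda>x. min (G x) (H x)) \<in> L2 M"
          using L2_measurable[OF G(1)] L2_measurable[OF H(1)]
          by (intro L2_bounded_add[OF _ G(1) H(1)]) auto
        moreover have "AE x in M. 0 \<le> min (G x) (H x)" using G(2) H(2) by eventually_elim simp
        moreover have "AE x in M. slope M (F \<circ> u) x \<le> Lip_const F * min (G x) (H x)" if "F \<in> LIP" for F
          using G(4)[OF that] H(3)[OF that] by eventually_elim (simp add: min_def)
        ultimately show ?thesis using G(3) by (simp add: map_slope_bound_def)
      qed
      fix G :: "nat \<Rightarrow> 'a \<Rightarrow> real" and G0
      assume *: "\<And>n. G n \<in> ?C" "G0 \<in> L2 M" "AE x in M. (\<lambda>n. G n x) \<longlonglongrightarrow> G0 x"
        "AE x in M. \<forall>n. 0 \<le> G0 x \<and> G0 x \<le> G n x \<and> G n x \<le> G 0 x"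
      have "AE x in M. slope M (F \<circ> u) x \<le> Lip_const F * G0 x" if "F \<in> LIP" for F
      proof -
        have "\<forall>n. AE x in M. slope M (F \<circ> u) x \<le> Lip_const F * G n x"
          using *(1) that by (simp add: map_slope_bound_def)
        then have "AE x in M. \<forall>n. slope M (F \<circ> u) x \<le> Lip_const F * G n x" by (simp add: AE_all_countable)
        then show ?thesis using *(3)
        proof eventually_elim
          case (elim x)
          have "(\<lambda>n. Lip_const F * G n x) \<longlonglongrightarrow> Lip_const F * G0 x" by (intro tendsto_intros elim)
          then show ?case by (rule LIMSEQ_le_const) (use elim in auto)
        qed
      qed
      moreover have "AE x in M. 0 \<le> G0 x" using *(4) by eventually_elim simp
      moreover have "F \<circ> u \<in> S2 M" if "F \<in> LIP" for F using *(1)[of 0] that by (simp add: map_slope_bound_def)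
      ultimately show "G0 \<in> ?C" using *(2) by (simp add: map_slope_bound_def)
    next
      fix G assume "G \<in> ?C" "\<And>H. H \<in> ?C \<Longrightarrow> AE x in M. G x \<le> H x"
      then show thesis by (rule that)
    qed
    then show ?thesis by auto
  qed
  from someI_ex[OF this] show ?thesis by (simp add: map_slope_def)
qed

lemma S2_mapD:
  fixes u :: "'a \<Rightarrow> 'b::metric_space"
  assumes "u \<in> S2_map M"
  shows "u \<in> borel_measurable M" "essentially_separable M u" "map_slope M u \<in> L2 M"
    "AE x in M. 0 \<le> map_slope M u x"
    "F \<in> LIP \<Longrightarrow> F \<circ> u \<in> S2 M"
    "F \<in> LIP \<Longrightarrow> AE x in M. slope M (F \<circ> u) x \<le> Lip_const F * map_slope M u x"
  using assms map_slope_bound_map_slope[of u] unfolding S2_map_def map_slope_bound_def by auto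

lemma slope_comp_LIP:
  fixes u :: "'a \<Rightarrow> 'b::metric_space"
  assumes u: "u \<in> S2_map M" and F: "F \<in> LIP"
  shows "AE x in M. slope M (F \<circ> u) x \<le> lip_a F (u x) * map_slope M u x"
proof -
  note D = S2_mapD[OF u]
  let ?D = "map_slope M u"
  obtain N where N: "N \<in> null_sets M" "separable_space (top_of_set (u ` (space M - N)))"
    using D(2) unfolding essentially_separable_def by blast
  obtain Q where Q: "countable Q" "\<And>y e. y \<in> u ` (space M - N) \<Longrightarrow> e > 0 \<Longrightarrow> \<exists>q\<in>Q. dist y q < e"
    using separable_dense[OF N(2)] by blast
  \<comment> \<open>Rational constants, radii 1 / (n+1) and centres in the countable set
    \<open>Q\<close> keep the index set countable, so that one null set serves all balls.\<close>
  define I where "I = {(q, n, L). q \<in> Q \<and> L \<in> \<rat> \<and> L-lipschitz_on (ball q (1 / real (Suc n))) F}"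
  have "I \<subseteq> Q \<times> UNIV \<times> \<rat>" by (auto simp: I_def)
  moreover have "countable (Q \<times> (UNIV :: nat set) \<times> (\<rat> :: real set))"
    using Q(1) countable_rat by (intro countable_SIGMA) auto
  ultimately have "countable I" by (rule countable_subset)
  moreover have "AE x in M. u x \<in> ball q (1 / real (Suc n)) \<longrightarrow> slope M (F \<circ> u) x \<le> L * ?D x"
    if "(q, n, L) \<in> I" for q n L
  proof -
    from that have L: "L-lipschitz_on (ball q (1 / real (Suc n))) F" by (simp add: I_def)
    obtain F' where F': "L-lipschitz_on UNIV F'" "\<And>x. x \<in> ball q (1 / real (Suc n)) \<Longrightarrow> F' x = F x"
      using McShane_extension[OF L] by blast
    have LIP': "F' \<in> LIP" using F'(1) by (auto simp: LIP_def)
    have "AE x in M. (F \<circ> u) x = (F' \<circ> u) x \<longrightarrow> slope M (F \<circ> u) x \<le> slope M (F' \<circ> u) x"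
      by (rule slope_le_on_eq[OF S2_sub_slope[OF D(5)[OF F]] S2_sub_slope[OF D(5)[OF LIP']]])
    then show ?thesis using D(6)[OF LIP'] D(4)
    proof eventually_elim
      case (elim x)
      have "Lip_const F' * ?D x \<le> L * ?D x" using elim by (intro mult_right_mono Lip_const_le F')
      then show ?case using elim F'(2) by auto
    qed
  qed
  ultimately have "AE x in M. \<forall>i\<in>I. case i of (q, n, L) \<Rightarrow>
      u x \<in> ball q (1 / real (Suc n)) \<longrightarrow> slope M (F \<circ> u) x \<le> L * ?D x"
    by (subst AE_ball_countable) auto
  then show ?thesis using D(4) AE_not_in[OF N(1)]
  proof eventually_elim
    case (elim x)
    have Fb: "F \<in> LIP_bd" using F LIP_subset_LIP_bd by blast
    have "slope M (F \<circ> u) x \<le> c * ?D x" if c: "c > lip_a F (u x)" for c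
    proof -
      obtain L where L: "L \<in> \<rat>" "lip_a F (u x) < L" "L < c" using Rats_dense_in_real[OF c] by blast
      obtain r where r: "r > 0" "L-lipschitz_on (ball (u x) r) F" using lip_a_lessD[OF Fb L(2)] by blast
      \<comment> \<open>Half of r, because the small ball is centred at q rather than u x: its
        points are within twice its radius of u x.\<close>
      obtain n where n: "1 / real (Suc n) < r / 2" using nat_approx_posE[of "r/2"] r(1) by auto
      obtain q where q: "q \<in> Q" "dist (u x) q < 1 / real (Suc n)"
        using Q(2)[of "u x" "1 / real (Suc n)"] elim by auto
      have "ball q (1 / real (Suc n)) \<subseteq> ball (u x) r"
      proof
        fix y assume "y \<in> ball q (1 / real (Suc n))"
        then show "y \<in> ball (u x) r" using q(2) n dist_triangle[of "u x" y q] by simp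
      qed
      from lipschitz_on_subset[OF r(2) this] have "(q, n, L) \<in> I" using q L by (simp add: I_def)
      with elim(1) q(2) have "slope M (F \<circ> u) x \<le> L * ?D x" by (auto simp: dist_commute)
      also have "\<dots> \<le> c * ?D x" using elim L by (intro mult_right_mono) auto
      finally show ?thesis .
    qed
    then have "eventually (\<lambda>c. slope M (F \<circ> u) x \<le> c * ?D x) (at_right (lip_a F (u x)))"
      by (auto simp: eventually_at_right_field intro: exI[of _ "lip_a F (u x) + 1"])
    moreover have "((\<lambda>c. c * ?D x) \<longlongrightarrow> lip_a F (u x) * ?D x) (at_right (lip_a F (u x)))"
      by (intro tendsto_intros)
    ultimately show ?case by (intro tendsto_lowerbound[of _ _ "at_right (lip_a F (u x))"]) auto
  qed
qed

text \<open>The definition of |Du| speaks of globally Lipschitz functions, so F is clamped between -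
  c n and c n, which leaves it unchanged within \<open>R n\<close> of \<open>y0\<close> and makes it
  vanish beyond \<open>2 * R n\<close>. As c n descends from K to 0 over a distance R n, clamping
  adds slope at most K / R n, an error that tends to 0 in L2 after multiplication by |Du|.\<close>

lemma sub_slope_comp_bounded:
  fixes u :: "'a \<Rightarrow> 'b::metric_space"
  assumes u: "u \<in> S2_map M" and F: "F \<in> LIP_bd" and K: "\<And>y. \<bar>F y\<bar> \<le> K"
    and L2: "(\<lambda>x. lip_a F (u x) * map_slope M u x) \<in> L2 M"
  shows "sub_slope M (F \<circ> u) (\<lambda>x. lip_a F (u x) * map_slope M u x)"
proof -
  note D = S2_mapD[OF u]
  let ?D = "map_slope M u"
  have Dm[measurable]: "?D \<in> borel_measurable M" using D(3) by (rule L2_measurable)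
  define y0 :: 'b where "y0 = undefined"
  have K0: "0 \<le> K" using K[of y0] by linarith
  define R where "R n = real (Suc n)" for n
  have R: "R n > 0" for n by (simp add: R_def)
  define c where "c n y = max 0 (min K (K / R n * (2 * R n - dist y y0)))" for n y
  have clip: "(K / R n)-lipschitz_on S (c n)" for n S
  proof -
    have d: "1-lipschitz_on S (\<lambda>y. dist y y0)"
    proof (rule lipschitz_onI)
      fix y z show "dist (dist y y0) (dist z y0) \<le> 1 * dist y z"
        using dist_triangle[of y y0 z] dist_triangle3[of z y0 y] by (simp add: dist_real_def)
    qed simp
    have "1-lipschitz_on S (\<lambda>y. 2 * R n - dist y y0)"
      using lipschitz_on_diff[OF lipschitz_on_constant[of S "2 * R n"] d] by simp
    from lipschitz_on_cmult_real[OF this, of "K / R n"]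
    have "(K / R n)-lipschitz_on S (\<lambda>y. K / R n * (2 * R n - dist y y0))" using K0 R[of n] by simp
    from lipschitz_on_max[OF lipschitz_on_constant[of S "0::real"] lipschitz_on_min[OF lipschitz_on_constant[of S K] this]]
    show ?thesis using K0 R[of n] by (simp add: c_def[abs_def])
  qed
  have cbd: "c n \<in> LIP_bd" for n using clip by (auto simp: LIP_bd_def)
  have c0: "0 \<le> c n y" "c n y \<le> K" for n y using K0 by (auto simp: c_def)
  define \<Phi> where "\<Phi> n y = max (- c n y) (min (F y) (c n y))" for n y
  have \<Phi>bd: "\<Phi> n \<in> LIP_bd" for n
    unfolding \<Phi>_def[abs_def] by (intro LIP_bd_max LIP_bd_min LIP_bd_minus cbd F)
  have \<Phi>K: "\<bar>\<Phi> n y\<bar> \<le> K" for n y using c0[of n y] by (auto simp: \<Phi>_def)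
  have \<Phi>in: "\<Phi> n y = F y" if "dist y y0 \<le> R n" for n y
  proof -
    have "K / R n * R n \<le> K / R n * (2 * R n - dist y y0)" using K0 R[of n] that by (intro mult_left_mono) auto
    then have "c n y = K" using K0 R[of n] by (simp add: c_def)
    then show ?thesis using K[of y] by (auto simp: \<Phi>_def)
  qed
  have \<Phi>out: "\<Phi> n y = 0" if "dist y y0 \<ge> 2 * R n" for n y
  proof -
    have "K / R n * (2 * R n - dist y y0) \<le> 0" using K0 R[of n] that by (intro mult_nonneg_nonpos) auto
    then have "c n y = 0" by (simp add: c_def)
    then show ?thesis by (simp add: \<Phi>_def)
  qed
  have \<Phi>LIP: "\<Phi> n \<in> LIP" for n
  proof -
    obtain L where L: "L-lipschitz_on (cball y0 (3 * R n)) (\<Phi> n)" using LIP_bdD[OF \<Phi>bd bounded_cball] by blast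
    have L0: "L \<ge> 0" by (rule lipschitz_on_nonneg[OF L])
    let ?L = "max L (K / R n)"
    \<comment> \<open>The value at z is 0. Either y is beyond 2 R n and both values vanish, or the
      points are at least R n apart and the bound K on |\<Phi> n| suffices.\<close>
    have far: "\<bar>\<Phi> n y - \<Phi> n z\<bar> \<le> ?L * dist y z" if z: "dist z y0 > 3 * R n" for y z
    proof (cases "dist y y0 \<ge> 2 * R n")
      case True
      then show ?thesis using \<Phi>out[of n y] \<Phi>out[of n z] z R[of n] L0 by simp
    next
      case False
      have "R n \<le> dist y z" using dist_triangle[of z y0 y] z False by (simp add: dist_commute)
      then have "K / R n * R n \<le> K / R n * dist y z" using K0 R[of n] by (intro mult_left_mono) auto
      also have "\<dots> \<le> ?L * dist y z" by (intro mult_right_mono) auto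
      finally show ?thesis using \<Phi>K[of n y] \<Phi>out[of n z] z R[of n] by simp
    qed
    have "?L-lipschitz_on UNIV (\<Phi> n)"
    proof (rule lipschitz_onI)
      fix y z
      consider "dist z y0 > 3 * R n" | "dist y y0 > 3 * R n" | "dist y y0 \<le> 3 * R n" "dist z y0 \<le> 3 * R n" by linarith
      then show "dist (\<Phi> n y) (\<Phi> n z) \<le> ?L * dist y z"
      proof cases
        case 1
        then show ?thesis using far[of z y] by (simp add: dist_real_def)
      next
        case 2
        then show ?thesis using far[of y z] by (simp add: dist_real_def dist_commute abs_minus_commute)
      next
        case 3
        then have "dist (\<Phi> n y) (\<Phi> n z) \<le> L * dist y z" by (intro lipschitz_onD[OF L]) (auto simp: dist_commute)
        also have "\<dots> \<le> ?L * dist y z" by (intro mult_right_mono) auto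
        finally show ?thesis .
      qed
    qed (use L0 in simp)
    then show ?thesis by (auto simp: LIP_def)
  qed
  have lip: "lip_a (\<Phi> n) y \<le> lip_a F y + K / R n" for n y
  proof -
    have "lip_a (c n) y \<le> K / R n" by (rule lip_a_le[OF clip[of n "ball y 1"]]) simp
    moreover have "lip_a (\<lambda>y. - c n y) y \<le> lip_a (c n) y" by (rule lip_a_minus[OF cbd])
    moreover have "lip_a (\<Phi> n) y \<le> max (lip_a (\<lambda>y. - c n y) y) (lip_a (\<lambda>y. min (F y) (c n y)) y)"
      unfolding \<Phi>_def[abs_def] by (intro lip_a_max LIP_bd_min LIP_bd_minus cbd F)
    moreover have "lip_a (\<lambda>y. min (F y) (c n y)) y \<le> max (lip_a F y) (lip_a (c n) y)"
      by (intro lip_a_min cbd F)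
    moreover have "0 \<le> K / R n" using K0 R[of n] by simp
    ultimately show ?thesis using lip_a_nonneg[of F y] by linarith
  qed
  show ?thesis
  proof (rule sub_slope_closed[OF S2_sub_slope[OF D(5)[OF \<Phi>LIP]] _ _ L2])
    show "F \<circ> u \<in> borel_measurable M"
      by (rule measurable_comp[OF D(1) LIP_bd_measurable[OF F]])
    have "(\<lambda>n. (\<Phi> n \<circ> u) x) \<longlonglongrightarrow> (F \<circ> u) x" for x
    proof (rule tendsto_eventually)
      obtain N :: nat where "dist (u x) y0 \<le> real N" using real_arch_simple by blast
      then have "(\<Phi> n \<circ> u) x = (F \<circ> u) x" if "n \<ge> N" for n
        using \<Phi>in[of "u x" n] that by (simp add: R_def)
      then show "\<forall>\<^sub>F n in sequentially. (\<Phi> n \<circ> u) x = (F \<circ> u) x" by (auto simp: eventually_sequentially)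
    qed
    then show "AE x in M. (\<lambda>n. (\<Phi> n \<circ> u) x) \<longlonglongrightarrow> (F \<circ> u) x" by simp
    show "AE x in M. 0 \<le> lip_a F (u x) * ?D x" using D(4) by eventually_elim (simp add: lip_a_nonneg)
    show "(\<lambda>n. sqn M (\<lambda>x. max 0 (slope M (\<Phi> n \<circ> u) x - lip_a F (u x) * ?D x))) \<longlonglongrightarrow> 0"
    proof (rule sqn_tendsto_mono)
      show "AE x in M. \<bar>max 0 (slope M (\<Phi> n \<circ> u) x - lip_a F (u x) * ?D x)\<bar> \<le> \<bar>K / R n * ?D x\<bar>" for n
        using slope_comp_LIP[OF u \<Phi>LIP[of n]] D(4)
      proof eventually_elim
        case (elim x)
        have "slope M (\<Phi> n \<circ> u) x \<le> (lip_a F (u x) + K / R n) * ?D x"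
          using elim by (meson lip mult_right_mono order_trans)
        then have "slope M (\<Phi> n \<circ> u) x - lip_a F (u x) * ?D x \<le> K / R n * ?D x" by (simp add: algebra_simps)
        moreover have "0 \<le> K / R n * ?D x" using K0 R[of n] elim by simp
        ultimately show ?case by linarith
      qed
      show "(\<lambda>n. sqn M (\<lambda>x. K / R n * ?D x)) \<longlonglongrightarrow> 0"
      proof (rule sqn_dominated[OF _ L2_cmult[OF D(3), of K]])
        show "AE x in M. \<bar>K / R n * ?D x\<bar> \<le> K * ?D x" for n
          using D(4)
        proof eventually_elim
          case (elim x)
          have "K / R n \<le> K" using K0 by (simp add: R_def divide_le_eq) (simp add: algebra_simps)
          then have "K / R n * ?D x \<le> K * ?D x" using elim by (intro mult_right_mono)
          then show ?case using elim K0 R[of n] by (simp add: abs_mult)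
        qed
        have "(\<lambda>n. K * (1 / real (Suc n)) * ?D x) \<longlonglongrightarrow> K * 0 * ?D x" for x
          using LIMSEQ_inverse_real_of_nat by (intro tendsto_intros) (simp add: inverse_eq_divide)
        then show "AE x in M. (\<lambda>n. K / R n * ?D x) \<longlonglongrightarrow> 0" by (simp add: R_def)
      qed measurable
    qed
  qed
qed

text \<open>Taking positive parts is convex, so pointwise the error of a combination is at most the
  combination of the errors.\<close>

lemma excess_comb_tendsto:
  assumes l: "\<And>n. l n \<in> tail_weights n" and \<phi>: "\<And>i. \<phi> i \<in> LIP_bd" and G: "G \<in> borel_measurable M"
    and e: "(\<lambda>i. excess M (\<phi> i) G) \<longlonglongrightarrow> 0"
  shows "(\<lambda>n. excess M (comb (l n) \<phi>) G) \<longlonglongrightarrow> 0"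
  unfolding excess_def
proof (rule sqn_tendsto_mono[OF _ sqn_comb_tendsto[OF l _ e[unfolded excess_def]]], intro AE_I2)
  show "(\<lambda>x. max 0 (lip_a (\<phi> i) x - G x)) \<in> borel_measurable M" for i by (rule excess_meas[OF \<phi> G])
  fix n x
  let ?e = "comb (l n) (\<lambda>i x. max 0 (lip_a (\<phi> i) x - G x)) x"
  have "lip_a (comb (l n) \<phi>) x \<le> comb (l n) (\<lambda>i. lip_a (\<phi> i)) x" by (rule lip_a_comb[OF l \<phi>])
  also have "\<dots> \<le> comb (l n) (\<lambda>i x. max 0 (lip_a (\<phi> i) x - G x) + G x) x" by (rule comb_mono[OF l]) linarith
  also have "\<dots> = ?e + comb (l n) (\<lambda>_. G) x" by (rule comb_add)
  also have "comb (l n) (\<lambda>_. G) x = G x"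
    using comb_const[OF l, of n "G x" x] by (simp add: comb_def)
  finally have "lip_a (comb (l n) \<phi>) x - G x \<le> ?e" by simp
  moreover have "0 \<le> ?e"
    using comb_mono[OF l, of n "\<lambda>_ _. 0" x "\<lambda>i x. max 0 (lip_a (\<phi> i) x - G x)" x] comb_const[OF l, of n 0 x] by simp
  ultimately show "\<bar>max 0 (lip_a (comb (l n) \<phi>) x - G x)\<bar> \<le> \<bar>?e\<bar>" by linarith
qed

end

text \<open>Strict convexity of \<open>t \<mapsto> exp (-t)\<close> replaces the missing bounds: nonnegative functions
  always have tail convex combinations converging almost everywhere in \<open>[0, \<infinity>]\<close>,
  here simultaneously for two sequences.\<close>

lemma (in sigma_finite_measure) nonneg_convex_combinations:
  fixes a b :: "nat \<Rightarrow> 'a \<Rightarrow> real"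
  assumes a: "\<And>i. a i \<in> borel_measurable M" "\<And>i x. 0 \<le> a i x"
    and b: "\<And>i. b i \<in> borel_measurable M" "\<And>i x. 0 \<le> b i x"
  obtains l \<alpha> \<beta> where "\<forall>n. l n \<in> tail_weights n"
    "\<alpha> \<in> borel_measurable M" "\<beta> \<in> borel_measurable M"
    "AE x in M. (\<lambda>n. exp (- comb (l n) a x / 2)) \<longlonglongrightarrow> \<alpha> x"
    "AE x in M. (\<lambda>n. exp (- comb (l n) b x / 2)) \<longlonglongrightarrow> \<beta> x"
proof -
  obtain h where h[measurable]: "h \<in> borel_measurable M" "integral\<^sup>N M h \<noteq> \<infinity>" "\<And>x. x \<in> space M \<Longrightarrow> 0 < h x \<and> h x < \<infinity>"
    using Ex_finite_integrable_function by blast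
  \<comment> \<open>An equivalent finite measure: functions bounded by 1 become square integrable,
    and positivity of h keeps the null sets.\<close>
  define M' where "M' = density M h"
  have "emeasure M' (space M') = integral\<^sup>N M h"
    unfolding M'_def by (simp add: emeasure_density cong: nn_integral_cong)
  then interpret M': finite_measure M' using h(2) by (intro finite_measureI) simp
  have AE': "AE x in M. P x" if "AE x in M'. P x" for P
  proof -
    have "AE x in M. h x > 0 \<longrightarrow> P x" using that unfolding M'_def by (simp add: AE_density)
    then show ?thesis using AE_space by eventually_elim (use h(3) in auto)
  qed
  have meas': "borel_measurable M' = borel_measurable M" unfolding M'_def by (rule measurable_cong_sets) auto
  have L2I: "(\<lambda>x. exp (- comb l c x / 2)) \<in> L2 M'"
    if c: "\<And>i. c i \<in> borel_measurable M" "\<And>i x. 0 \<le> c i x" and l: "l \<in> tail_weights N"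
    for c :: "nat \<Rightarrow> 'a \<Rightarrow> real" and l N
  proof (rule L2_bounded[of _ _ "\<lambda>_. 1"])
    have [measurable]: "comb l c \<in> borel_measurable M'" unfolding meas' by (rule comb_measurable[OF c(1)])
    show "(\<lambda>x. exp (- comb l c x / 2)) \<in> borel_measurable M'" by measurable
    show "(\<lambda>_. 1) \<in> L2 M'" by (simp add: L2_def)
    have "0 \<le> comb l c x" for x
      using l c(2) by (auto simp: comb_def tail_weights_def intro!: sum_nonneg)
    then show "AE x in M'. \<bar>exp (- comb l c x / 2)\<bar> \<le> \<bar>1\<bar>" by simp
  qed
  \<comment> \<open>The integral of exp (- comb), written with the square of p = exp (- comb / 2) so
    that the L2 lemmas apply to p. At a midpoint the integrand becomes the product p q, and the
    convexity gap is exactly the integral of (p - q)^2.\<close>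
  define P where "P c l = (\<integral>x. (exp (- comb l c x / 2))\<^sup>2 \<partial>M')" for c :: "nat \<Rightarrow> 'a \<Rightarrow> real" and l
  define Df where "Df c l l' = (\<integral>x. (exp (- comb l c x / 2) - exp (- comb l' c x / 2))\<^sup>2 \<partial>M') / 2"
    for c :: "nat \<Rightarrow> 'a \<Rightarrow> real" and l l'
  have P1: "P c l \<le> measure M' (space M')"
    if c: "\<And>i. c i \<in> borel_measurable M" "\<And>i x. 0 \<le> c i x" and l: "l \<in> tail_weights N" for c l N
  proof -
    have c0: "0 \<le> comb l c x" for x
      using l c(2) by (auto simp: comb_def tail_weights_def intro!: sum_nonneg)
    have "P c l \<le> (\<integral>x. 1 \<partial>M')" unfolding P_def
      using L2I[OF c l] c0 by (intro integral_mono) (auto simp: L2_def power_le_one)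
    then show ?thesis by simp
  qed
  have Dle: "Df c l l' \<le> P c l + P c l' - 2 * P c (mix (1/2) l l')"
    if c: "\<And>i. c i \<in> borel_measurable M" "\<And>i x. 0 \<le> c i x" and l: "l \<in> tail_weights N" "l' \<in> tail_weights N" for c l l' N
  proof -
    let ?p = "\<lambda>x. exp (- comb l c x / 2)" and ?q = "\<lambda>x. exp (- comb l' c x / 2)"
    have p: "?p \<in> L2 M'" and q: "?q \<in> L2 M'" by (rule L2I[OF c l(1)], rule L2I[OF c l(2)])
    have i: "integrable M' (\<lambda>x. (?p x)\<^sup>2)" "integrable M' (\<lambda>x. (?q x)\<^sup>2)" "integrable M' (\<lambda>x. ?p x * ?q x)"
      using p q L2_mult_integrable[OF p q] by (auto simp: L2_def)
    have "(exp (- comb (mix (1/2) l l') c x / 2))\<^sup>2 = ?p x * ?q x" for x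
    proof -
      have e: "comb (mix (1/2) l l') c x = (1 - 1/2) * comb l c x + 1/2 * comb l' c x"
        by (rule comb_mix[OF tail_weights_finite[OF l(1)] tail_weights_finite[OF l(2)]])
      show ?thesis unfolding e power2_eq_square exp_add[symmetric] by (rule arg_cong[of _ _ exp]) (simp add: field_simps)
    qed
    then have "P c (mix (1/2) l l') = (\<integral>x. ?p x * ?q x \<partial>M')" by (simp add: P_def)
    moreover have "(\<integral>x. (?p x - ?q x)\<^sup>2 \<partial>M') = P c l + P c l' - 2 * (\<integral>x. ?p x * ?q x \<partial>M')"
    proof -
      have "(\<integral>x. (?p x - ?q x)\<^sup>2 \<partial>M') = (\<integral>x. (?p x)\<^sup>2 + (?q x)\<^sup>2 - 2 * (?p x * ?q x) \<partial>M')"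
        by (intro Bochner_Integration.integral_cong refl) (simp add: power2_diff)
      also have "\<dots> = P c l + P c l' - 2 * (\<integral>x. ?p x * ?q x \<partial>M')" using i by (simp add: P_def)
      finally show ?thesis .
    qed
    moreover have "0 \<le> (\<integral>x. (?p x - ?q x)\<^sup>2 \<partial>M')" by simp
    ultimately show ?thesis unfolding Df_def by linarith
  qed
  have Dpos: "0 \<le> Df c l l'" for c l l' by (simp add: Df_def)
  obtain w where w: "\<And>n. w n \<in> tail_weights n"
    "\<And>e. e > 0 \<Longrightarrow> \<exists>N. \<forall>m\<ge>N. \<forall>n\<ge>N. Df a (w m) (w n) + Df b (w m) (w n) < e"
  \<comment> \<open>Minimising the sum yields one sequence of weights for both families; as
    \<open>Df\<close> is nonnegative, each of its two values is small when their sum is.\<close>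
  proof (rule near_minimisers[of tail_weights "\<lambda>l. P a l + P b l" "2 * measure M' (space M')" "mix (1/2)" "\<lambda>l l'. Df a l l' + Df b l l'"])
    show "tail_weights n \<subseteq> tail_weights m" if "m \<le> n" for m n using that by (rule tail_weights_antimono)
    show "\<exists>l\<in>tail_weights n. P a l + P b l \<le> 2 * measure M' (space M')" for n
    proof
      show u: "(\<lambda>i. if i = n then 1 else 0) \<in> tail_weights n" by (rule unit_tail_weights) simp
      show "P a (\<lambda>i. if i = n then 1 else 0) + P b (\<lambda>i. if i = n then 1 else 0) \<le> 2 * measure M' (space M')"
        using P1[of a, OF a u] P1[of b, OF b u] by linarith
    qed
    show "0 \<le> P a l + P b l" for l by (simp add: P_def)
    show "mix (1/2) l l' \<in> tail_weights n" if "l \<in> tail_weights n" "l' \<in> tail_weights n" for n l l'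
      using that by (intro mix_tail_weights) auto
    show "Df a l l' + Df b l l' \<le> P a l + P b l + (P a l' + P b l') - 2 * (P a (mix (1/2) l l') + P b (mix (1/2) l l'))"
      if "l \<in> tail_weights 0" "l' \<in> tail_weights 0" for l l'
      using add_mono[OF Dle[of a, OF a that] Dle[of b, OF b that]] by (simp add: algebra_simps)
  next
    fix w assume "\<And>n. w n \<in> tail_weights n"
      "\<And>e. e > 0 \<Longrightarrow> \<exists>N. \<forall>m\<ge>N. \<forall>n\<ge>N. Df a (w m) (w n) + Df b (w m) (w n) < e"
    then show thesis by (rule that)
  qed
  have wC: "\<exists>N. \<forall>m\<ge>N. \<forall>n\<ge>N. Df c (w m) (w n) < e" if "e > 0" and "c = a \<or> c = b" for c e
  proof -
    obtain N where N: "\<And>m n. m \<ge> N \<Longrightarrow> n \<ge> N \<Longrightarrow> Df a (w m) (w n) + Df b (w m) (w n) < e"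
      using w(2)[OF \<open>e > 0\<close>] by blast
    have "Df c (w m) (w n) < e" if "m \<ge> N" "n \<ge> N" for m n
      using N[OF that] Dpos[of a "w m" "w n"] Dpos[of b "w m" "w n"] \<open>c = a \<or> c = b\<close> by auto
    then show ?thesis by blast
  qed
  have sub: "\<exists>\<alpha> r. \<alpha> \<in> borel_measurable M \<and> strict_mono (r :: nat \<Rightarrow> nat) \<and>
      (AE x in M. (\<lambda>n. exp (- comb (w (s (r n))) c x / 2)) \<longlonglongrightarrow> \<alpha> x)"
    if c: "\<And>i. c i \<in> borel_measurable M" "\<And>i x. 0 \<le> c i x" "c = a \<or> c = b" and s: "strict_mono s" for c and s :: "nat \<Rightarrow> nat"
  proof -
    let ?x = "\<lambda>n x. exp (- comb (w (s n)) c x / 2)"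
    have xL2: "?x n \<in> L2 M'" for n by (rule L2I[OF c(1,2) w(1)])
    have cauchy: "\<exists>N. \<forall>m\<ge>N. \<forall>n\<ge>N. sqn M' (\<lambda>x. ?x m x - ?x n x) < ennreal e" if e: "e > 0" for e
    proof (rule sqn_CauchyI[OF _ _ e])
      show "(\<lambda>x. ?x m x - ?x n x) \<in> L2 M'" for m n by (intro L2_diff xL2)
      fix e :: real assume "e > 0"
      from wC[OF this c(3)] obtain N where N: "\<forall>m\<ge>N. \<forall>n\<ge>N. Df c (w m) (w n) < e" ..
      have "s n \<ge> N" if "n \<ge> N" for n using seq_suble[OF s, of n] that by linarith
      with N have "\<forall>m\<ge>N. \<forall>n\<ge>N. Df c (w (s m)) (w (s n)) < e" by simp
      then show "\<exists>N. \<forall>m\<ge>N. \<forall>n\<ge>N. (\<integral>x. (?x m x - ?x n x)\<^sup>2 \<partial>M') / 2 < e"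
        unfolding Df_def ..
    qed
    obtain y and r :: "nat \<Rightarrow> nat" where y: "y \<in> borel_measurable M'" "strict_mono r"
      "AE x in M'. (\<lambda>k. ?x (r k) x) \<longlonglongrightarrow> y x" "(\<lambda>n. sqn M' (\<lambda>x. ?x n x - y x)) \<longlonglongrightarrow> 0"
      by (rule L2_complete[of ?x M', OF L2_measurable[OF xL2] cauchy])
    show ?thesis
      using y(1,2) AE'[OF y(3)] by (intro exI[of _ y] exI[of _ r]) (simp add: meas')
  qed
  from sub[of a "\<lambda>n. n", OF a] obtain \<alpha> r where r: "\<alpha> \<in> borel_measurable M" "strict_mono r"
    "AE x in M. (\<lambda>n. exp (- comb (w (r n)) a x / 2)) \<longlonglongrightarrow> \<alpha> x" by (auto simp: strict_mono_def)
  \<comment> \<open>The second subsequence is extracted from the first, so that the same weights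
    serve both limits.\<close>
  from sub[of b, OF b _ r(2)] obtain \<beta> s where s: "\<beta> \<in> borel_measurable M" "strict_mono s"
    "AE x in M. (\<lambda>n. exp (- comb (w (r (s n))) b x / 2)) \<longlonglongrightarrow> \<beta> x" by blast
  show thesis
  proof (rule that[of "\<lambda>n. w (r (s n))" \<alpha> \<beta>])
    have "w (r (s n)) \<in> tail_weights n" for n
      using w(1)[of "r (s n)"] tail_weights_antimono[of n "r (s n)"] seq_suble[OF r(2), of "s n"] seq_suble[OF s(2), of n]
      by (auto dest: subsetD)
    then show "\<forall>n. w (r (s n)) \<in> tail_weights n" ..
    show "AE x in M. (\<lambda>n. exp (- comb (w (r (s n))) a x / 2)) \<longlonglongrightarrow> \<alpha> x" using r(3)
    proof eventually_elim
      case (elim x)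
      from LIMSEQ_subseq_LIMSEQ[OF this s(2)] show ?case by (simp add: o_def)
    qed
  qed (use r s in auto)
qed

text \<open>Folding at height \<open>K\<close>: the identity on \<open>[0, K]\<close>, but vanishing near \<open>\<infinity>\<close>,
  so that composing with it turns limits equal to \<open>\<infinity>\<close> into limits equal to \<open>0\<close>.\<close>

definition fold_at :: "real \<Rightarrow> real \<Rightarrow> real" where
  "fold_at K t = max 0 (K - \<bar>t - K\<bar>)"

lemma fold_at_lipschitz: "1-lipschitz_on UNIV (fold_at K)"
  by (rule lipschitz_onI) (auto simp: fold_at_def dist_real_def)

lemma fold_at_bounds: "0 \<le> K \<Longrightarrow> 0 \<le> fold_at K t \<and> fold_at K t \<le> K"
  by (auto simp: fold_at_def)

lemma fold_at_far: "2 * K \<le> t \<Longrightarrow> fold_at K t = 0"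
  by (auto simp: fold_at_def)

lemma fold_at_tendsto: "(f \<longlongrightarrow> t) F \<Longrightarrow> ((\<lambda>n. fold_at K (f n)) \<longlongrightarrow> fold_at K t) F"
  unfolding fold_at_def by (intro tendsto_intros)

lemma fold_at_limit: "(\<lambda>k. fold_at (real (Suc k)) t) \<longlonglongrightarrow> max 0 t"
proof (rule tendsto_eventually)
  obtain N :: nat where "t \<le> real N" using real_arch_simple by blast
  then have "fold_at (real (Suc k)) t = max 0 t" if "k \<ge> N" for k
    using that by (auto simp: fold_at_def)
  then show "\<forall>\<^sub>F k in sequentially. fold_at (real (Suc k)) t = max 0 t" by (auto simp: eventually_sequentially)
qed

text \<open>The argument s stands for the limit of exp (- A / 2): the value
  \<open>- 2 * ln s\<close> recovers a finite limit of A, and s = 0 means that A tends to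
  \<infinity>, where folding gives 0.\<close>

definition fold_exp_limit :: "real \<Rightarrow> real \<Rightarrow> real" where
  "fold_exp_limit K s = (if s > 0 then fold_at K (- 2 * ln s) else 0)"

lemma fold_exp_limit:
  assumes "(\<lambda>n. exp (- A n / 2)) \<longlonglongrightarrow> s"
  shows "(\<lambda>n. fold_at K (A n)) \<longlonglongrightarrow> fold_exp_limit K s"
proof (cases "s > 0")
  case True
  have "(\<lambda>n. - 2 * ln (exp (- A n / 2))) \<longlonglongrightarrow> - 2 * ln s"
    using True by (intro tendsto_intros assms) auto
  then have "A \<longlonglongrightarrow> - 2 * ln s" by simp
  then show ?thesis using True by (simp add: fold_exp_limit_def fold_at_tendsto)
next
  case False
  \<comment> \<open>This says A n > 2 K, the range on which \<open>fold_at K\<close>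
    vanishes.\<close>
  then have "eventually (\<lambda>n. exp (- A n / 2) < exp (- K)) sequentially"
    using exp_gt_zero[of "-K"] by (intro order_tendstoD(2)[OF assms]) linarith
  then have "eventually (\<lambda>n. fold_at K (A n) = 0) sequentially"
    by eventually_elim (simp add: fold_at_far)
  then show ?thesis using False by (simp add: fold_exp_limit_def tendsto_eventually)
qed

section \<open>The composition theorem\<close>

lemma measurable_fold_exp_limit [measurable]: "fold_exp_limit K \<in> borel_measurable borel"
  unfolding fold_exp_limit_def[abs_def] fold_at_def by measurable

section \<open>The energy image and the pullback along u\<close>

locale S2_map_measure = boundedly_finite_measure M for M :: "'a::metric_space measure" +
  fixes u :: "'a \<Rightarrow> 'b::metric_space"
  assumes u_S2_map: "u \<in> S2_map M"
begin

abbreviation "\<mu> \<equiv> energy_image M u"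
abbreviation "D \<equiv> map_slope M u"

lemma u_meas [measurable]: "u \<in> borel_measurable M"
  and D_L2: "D \<in> L2 M" and D_nonneg: "AE x in M. 0 \<le> D x"
  using S2_mapD[OF u_S2_map] by auto

lemma D_meas [measurable]: "D \<in> borel_measurable M"
  using D_L2 by (rule L2_measurable)

lemma sets_energy_image: "sets \<mu> = sets borel"
  by (simp add: energy_image_def)

lemma nn_integral_energy_image:
  assumes [measurable]: "h \<in> borel_measurable borel"
  shows "(\<integral>\<^sup>+y. h y \<partial>\<mu>) = (\<integral>\<^sup>+x. ennreal ((D x)\<^sup>2) * h (u x) \<partial>M)"
proof -
  have "(\<integral>\<^sup>+y. h y \<partial>\<mu>) = (\<integral>\<^sup>+x. h (u x) \<partial>density M (\<lambda>x. ennreal ((D x)\<^sup>2)))"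
    unfolding energy_image_def by (rule nn_integral_distr) (auto simp: u_meas)
  also have "\<dots> = (\<integral>\<^sup>+x. ennreal ((D x)\<^sup>2) * h (u x) \<partial>M)"
    by (rule nn_integral_density) measurable
  finally show ?thesis .
qed

text \<open>The map sending h to the product of h o u and D is an isometry from L2(\<mu>) into
  L2(m); through it strong convergence of slopes in L2(\<mu>) gives the last convergence of the
  theorem.\<close>

lemma sqn_energy_image:
  assumes [measurable]: "h \<in> borel_measurable borel"
  shows "sqn \<mu> h = sqn M (\<lambda>x. h (u x) * D x)"
proof -
  have "sqn \<mu> h = (\<integral>\<^sup>+x. ennreal ((D x)\<^sup>2) * ennreal ((h (u x))\<^sup>2) \<partial>M)"
    unfolding sqn_def by (rule nn_integral_energy_image) measurable
  also have "\<dots> = sqn M (\<lambda>x. h (u x) * D x)"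
    unfolding sqn_def by (simp add: power_mult_distrib ennreal_mult mult.commute)
  finally show ?thesis .
qed

lemma bf_energy_image: "boundedly_finite_measure \<mu>"
proof
  have "emeasure \<mu> (space \<mu>) = (\<integral>\<^sup>+y. 1 \<partial>\<mu>)" by simp
  also have "\<dots> = sqn M D" by (subst nn_integral_energy_image) (auto simp: sqn_def)
  also have "\<dots> < \<infinity>" using D_L2 by (simp add: L2_iff)
  finally have "emeasure \<mu> (space \<mu>) < \<infinity>" .
  then show "boundedly_finite \<mu>"
    unfolding boundedly_finite_def using emeasure_space le_less_trans by blast
qed (rule sets_energy_image)

sublocale E: boundedly_finite_measure \<mu>
  by (rule bf_energy_image)

text \<open>\<mu> receives no mass from {D = 0}, so statements a.e. in \<mu> carry no information
  along u there; this is the gap that the construction of g has to fill.\<close>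

lemma AE_energy_image:
  assumes "AE y in \<mu>. P y"
  shows "AE x in M. D x > 0 \<longrightarrow> P (u x)"
proof -
  have "AE x in density M (\<lambda>x. ennreal ((D x)\<^sup>2)). P (u x)"
    using assms unfolding energy_image_def by (rule AE_distrD[rotated]) (simp add: u_meas)
  then have "AE x in M. 0 < ennreal ((D x)\<^sup>2) \<longrightarrow> P (u x)" by (subst (asm) AE_density) auto
  then show ?thesis by eventually_elim (simp add: ennreal_less_zero_iff)
qed

lemma comp_L2: "h \<in> L2 \<mu> \<Longrightarrow> (\<lambda>x. h (u x) * D x) \<in> L2 M"
proof -
  assume h: "h \<in> L2 \<mu>"
  then have hm[measurable]: "h \<in> borel_measurable borel" by (simp add: L2_iff E.measurable_M_iff)
  have "(\<lambda>x. h (u x) * D x) \<in> borel_measurable M" by measurable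
  then show ?thesis using h sqn_energy_image[OF hm] by (simp add: L2_iff)
qed

lemma composition_S2:
  assumes f: "f \<in> S2 \<mu>"
  shows "\<exists>g\<in>S2 M.
      (AE x in M. D x > 0 \<longrightarrow> g x = f (u x)) \<and>
      (AE x in M. slope M g x \<le> slope \<mu> f (u x) * D x) \<and>
      (\<exists>fs. (\<forall>n. fs n \<in> LIP_bd) \<and>
         (AE y in \<mu>. (\<lambda>n. fs n y) \<longlonglongrightarrow> f y) \<and>
         L2_tendsto \<mu> (\<lambda>n. lip_a (fs n)) (slope \<mu> f) \<and>
         (AE x in M. (\<lambda>n. fs n (u x)) \<longlonglongrightarrow> g x) \<and>
         L2_tendsto M (\<lambda>n x. lip_a (fs n) (u x) * D x) (\<lambda>x. slope \<mu> f (u x) * D x))"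
proof -
  define G where "G = slope \<mu> f"
  have Gmin: "least_sub_slope \<mu> f G" unfolding G_def by (rule E.S2_least_sub_slope[OF f])
  then have Gs: "sub_slope \<mu> f G" by (simp add: least_sub_slope_def)
  then have fm: "f \<in> borel_measurable \<mu>" and GL2: "G \<in> L2 \<mu>" and G0: "AE y in \<mu>. 0 \<le> G y"
    by (auto simp: sub_slope_def)
  have Gm: "G \<in> borel_measurable \<mu>" using GL2 by (rule L2_measurable)
  have [measurable]: "f \<in> borel_measurable borel" "G \<in> borel_measurable borel"
    using fm Gm by (simp_all add: E.measurable_M_iff)
  define Gp Gn where "Gp y = (if f y > 0 then G y else 0)" and "Gn y = (if f y < 0 then G y else 0)" for y
  have Gpm: "Gp \<in> borel_measurable \<mu>" and Gnm: "Gn \<in> borel_measurable \<mu>"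
    unfolding Gp_def[abs_def] Gn_def[abs_def] E.measurable_M_iff by measurable

  text \<open>The positive and the negative part are approximated separately, since both convex
    combinations below may diverge on \<open>{D = 0}\<close>.\<close>
  have ex: "\<exists>a. (\<forall>n. a n \<in> LIP_bd) \<and> (\<forall>n y. 0 \<le> a n y) \<and> (AE y in \<mu>. (\<lambda>n. a n y) \<longlonglongrightarrow> p y) \<and>
      (\<lambda>n. excess \<mu> (a n) H) \<longlonglongrightarrow> 0" if s: "sub_slope \<mu> p H" and p: "\<And>y. 0 \<le> p y" for p H
  proof -
    obtain \<phi> where \<phi>: "\<And>n. \<phi> n \<in> LIP_bd" "AE y in \<mu>. (\<lambda>n. \<phi> n y) \<longlonglongrightarrow> p y" "(\<lambda>n. excess \<mu> (\<phi> n) H) \<longlonglongrightarrow> 0"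
      using sub_slopeE[OF s] by blast
    have "AE y in \<mu>. (\<lambda>n. max 0 (\<phi> n y)) \<longlonglongrightarrow> p y" using \<phi>(2)
    proof eventually_elim
      case (elim y)
      have "(\<lambda>n. max 0 (\<phi> n y)) \<longlonglongrightarrow> max 0 (p y)" by (intro tendsto_intros elim)
      then show ?case using p[of y] by simp
    qed
    moreover have "(\<lambda>n. excess \<mu> (\<lambda>y. max 0 (\<phi> n y)) H) \<longlonglongrightarrow> 0"
      unfolding excess_def
    proof (rule sqn_tendsto_mono[OF _ \<phi>(3)[unfolded excess_def]], intro AE_I2)
      fix n y
      have "lip_a (\<lambda>y. max 0 (\<phi> n y)) y \<le> lip_a (\<phi> n) y"
        using lip_a_max[OF LIP_bd_const[of 0] \<phi>(1)[of n], of y] lip_a_nonneg[of "\<phi> n" y] by simp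
      then show "\<bar>max 0 (lip_a (\<lambda>y. max 0 (\<phi> n y)) y - H y)\<bar> \<le> \<bar>max 0 (lip_a (\<phi> n) y - H y)\<bar>" by linarith
    qed
    ultimately show ?thesis using \<phi>(1) by (intro exI[of _ "\<lambda>n y. max 0 (\<phi> n y)"]) (auto intro: LIP_bd_max LIP_bd_const)
  qed
  have "sub_slope \<mu> (\<lambda>y. max 0 (f y)) Gp" unfolding Gp_def[abs_def] by (rule E.sub_slope_pos_part[OF Gs])
  from ex[OF this] obtain a where a: "\<And>n. a n \<in> LIP_bd" "\<And>n y. 0 \<le> a n y"
    "AE y in \<mu>. (\<lambda>n. a n y) \<longlonglongrightarrow> max 0 (f y)" "(\<lambda>n. excess \<mu> (a n) Gp) \<longlonglongrightarrow> 0" by auto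
  have "sub_slope \<mu> (\<lambda>y. max 0 (- f y)) Gn" unfolding Gn_def[abs_def] by (rule E.sub_slope_neg_part[OF Gs])
  from ex[OF this] obtain b where b: "\<And>n. b n \<in> LIP_bd" "\<And>n y. 0 \<le> b n y"
    "AE y in \<mu>. (\<lambda>n. b n y) \<longlonglongrightarrow> max 0 (- f y)" "(\<lambda>n. excess \<mu> (b n) Gn) \<longlonglongrightarrow> 0" by auto
  have comp_meas: "(\<lambda>x. F (u x)) \<in> borel_measurable M" if "F \<in> LIP_bd" for F
    using LIP_bd_measurable[OF that] by measurable
  \<comment> \<open>The weights are chosen for the compositions on X but are applied on Y as well,
    where tail combinations keep the a.e. limits and the vanishing excess.\<close>
  obtain l \<alpha> \<beta> where l': "\<forall>n. l n \<in> tail_weights n"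
    and \<alpha>\<beta>[measurable]: "\<alpha> \<in> borel_measurable M" "\<beta> \<in> borel_measurable M"
    and \<alpha>: "AE x in M. (\<lambda>n. exp (- comb (l n) (\<lambda>i x. a i (u x)) x / 2)) \<longlonglongrightarrow> \<alpha> x"
    and \<beta>: "AE x in M. (\<lambda>n. exp (- comb (l n) (\<lambda>i x. b i (u x)) x / 2)) \<longlonglongrightarrow> \<beta> x"
    by (rule nonneg_convex_combinations[of "\<lambda>i x. a i (u x)" "\<lambda>i x. b i (u x)",
        OF comp_meas[OF a(1)] a(2) comp_meas[OF b(1)] b(2)])
  have l: "l n \<in> tail_weights n" for n using l' ..
  define A B where "A n = comb (l n) a" and "B n = comb (l n) b" for n
  have Abd: "A n \<in> LIP_bd" and Bbd: "B n \<in> LIP_bd" for n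
    unfolding A_def B_def using a(1) b(1) by (auto intro: comb_LIP_bd)
  have A\<alpha>: "AE x in M. (\<lambda>n. exp (- A n (u x) / 2)) \<longlonglongrightarrow> \<alpha> x"
    using \<alpha> by (simp add: A_def comb_def)
  have B\<beta>: "AE x in M. (\<lambda>n. exp (- B n (u x) / 2)) \<longlonglongrightarrow> \<beta> x"
    using \<beta> by (simp add: B_def comb_def)
  have A\<mu>: "AE y in \<mu>. (\<lambda>n. A n y) \<longlonglongrightarrow> max 0 (f y)"
    using a(3) unfolding A_def by eventually_elim (rule comb_tendsto[OF l])
  have B\<mu>: "AE y in \<mu>. (\<lambda>n. B n y) \<longlonglongrightarrow> max 0 (- f y)"
    using b(3) unfolding B_def by eventually_elim (rule comb_tendsto[OF l])
  have Ae: "(\<lambda>n. excess \<mu> (A n) Gp) \<longlonglongrightarrow> 0" unfolding A_def by (rule E.excess_comb_tendsto[OF l a(1) Gpm a(4)])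
  have Be: "(\<lambda>n. excess \<mu> (B n) Gn) \<longlonglongrightarrow> 0" unfolding B_def by (rule E.excess_comb_tendsto[OF l b(1) Gnm b(4)])

  define K where "K k = real (Suc k)" for k
  \<comment> \<open>Each part is folded before the subtraction, because either may tend to
    \<infinity> along u; the difference is bounded by \<open>K k\<close>.\<close>
  define \<Psi> where "\<Psi> k n y = fold_at (K k) (A n y) - fold_at (K k) (B n y)" for k n y
  have \<Psi>bd: "\<Psi> k n \<in> LIP_bd" for k n
    unfolding \<Psi>_def[abs_def] by (intro LIP_bd_diff LIP_bd_comp[OF fold_at_lipschitz] Abd Bbd)
  have \<Psi>K: "\<bar>\<Psi> k n y\<bar> \<le> K k" for k n y
    using fold_at_bounds[of "K k" "A n y"] fold_at_bounds[of "K k" "B n y"] by (auto simp: \<Psi>_def K_def)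
  have \<Psi>slope: "lip_a (\<Psi> k n) y \<le> lip_a (A n) y + lip_a (B n) y" for k n y
  proof -
    have "lip_a (\<Psi> k n) y \<le> lip_a (\<lambda>y. fold_at (K k) (A n y)) y + lip_a (\<lambda>y. fold_at (K k) (B n y)) y"
      unfolding \<Psi>_def[abs_def] by (intro lip_a_diff LIP_bd_comp[OF fold_at_lipschitz] Abd Bbd)
    then show ?thesis
      using lip_a_comp[OF fold_at_lipschitz Abd, of "K k" n y] lip_a_comp[OF fold_at_lipschitz Bbd, of "K k" n y] by linarith
  qed
  have \<Psi>e: "(\<lambda>n. excess \<mu> (\<Psi> k n) G) \<longlonglongrightarrow> 0" for k
    unfolding excess_def
  proof (rule sqn_tendsto_add[OF _ _ _ Ae[unfolded excess_def] Be[unfolded excess_def]])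
    show "AE y in \<mu>. \<bar>max 0 (lip_a (\<Psi> k n) y - G y)\<bar> \<le> \<bar>max 0 (lip_a (A n) y - Gp y)\<bar> + \<bar>max 0 (lip_a (B n) y - Gn y)\<bar>" for n
      using G0
    proof eventually_elim
      case (elim y)
      \<comment> \<open>The two bounds live on the disjoint sets {f > 0} and {f < 0}. Using G for
        both parts would give only 2 G, and the minimality of G would not apply.\<close>
      have "Gp y + Gn y \<le> G y" using elim by (simp add: Gp_def Gn_def)
      then show ?case using \<Psi>slope[of k n y] by linarith
    qed
  qed (intro E.excess_meas Abd Bbd Gpm Gnm)+

  define fk where "fk k y = fold_at (K k) (max 0 (f y)) - fold_at (K k) (max 0 (- f y))" for k y
  define gk where "gk k x = fold_exp_limit (K k) (\<alpha> x) - fold_exp_limit (K k) (\<beta> x)" for k x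
  \<comment> \<open>The limit of \<open>fold_exp_limit (K k) s\<close> in k: a finite limit of A is
    kept, and an infinite one, that is s = 0, is replaced by 0.\<close>
  define gl where "gl s = (if s > 0 then max 0 (- 2 * ln s) else 0)" for s :: real
  define g where "g x = gl (\<alpha> x) - gl (\<beta> x)" for x
  have gm: "g \<in> borel_measurable M" unfolding g_def[abs_def] gl_def by measurable
  have L0\<mu>: "L0_tendsto \<mu> (\<Psi> k) (fk k)" for k
  proof (rule AE_imp_L0_tendsto)
    show "fk k \<in> borel_measurable \<mu>"
      unfolding fk_def[abs_def] fold_at_def E.measurable_M_iff by measurable
    show "AE y in \<mu>. (\<lambda>n. \<Psi> k n y) \<longlonglongrightarrow> fk k y"
      using A\<mu> B\<mu> unfolding \<Psi>_def fk_def by eventually_elim (intro tendsto_diff fold_at_tendsto)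
  qed (intro E.LIP_bd_meas \<Psi>bd)
  have f_lim: "AE y in \<mu>. (\<lambda>k. fk k y) \<longlonglongrightarrow> f y"
  proof (intro AE_I2)
    fix y
    have "(\<lambda>k. fk k y) \<longlonglongrightarrow> max 0 (max 0 (f y)) - max 0 (max 0 (- f y))"
      unfolding fk_def K_def by (intro tendsto_diff fold_at_limit)
    moreover have "max 0 (max 0 (f y)) - max 0 (max 0 (- f y)) = f y" by simp
    ultimately show "(\<lambda>k. fk k y) \<longlonglongrightarrow> f y" by (simp only:)
  qed
  have L0M: "L0_tendsto M (\<lambda>n x. \<Psi> k n (u x)) (gk k)" for k
  proof (rule AE_imp_L0_tendsto)
    show "gk k \<in> borel_measurable M" unfolding gk_def[abs_def] by measurable
    show "AE x in M. (\<lambda>n. \<Psi> k n (u x)) \<longlonglongrightarrow> gk k x"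
      using A\<alpha> B\<beta> unfolding \<Psi>_def gk_def by eventually_elim (intro tendsto_diff fold_exp_limit)
  qed (intro comp_meas \<Psi>bd)
  have g_lim: "AE x in M. (\<lambda>k. gk k x) \<longlonglongrightarrow> g x"
  proof (intro AE_I2)
    fix x
    have "(\<lambda>k. fold_exp_limit (K k) s) \<longlonglongrightarrow> gl s" for s
      using fold_at_limit[of "- 2 * ln s"] by (simp add: fold_exp_limit_def gl_def K_def)
    then show "(\<lambda>k. gk k x) \<longlonglongrightarrow> g x" unfolding gk_def g_def by (intro tendsto_diff)
  qed
  from L0_diag[of "\<lambda>k n x. \<Psi> k n (u x)", OF L0M g_lim] obtain Q1 where Q1: "\<And>k. eventually (Q1 k) sequentially"
    "\<And>r. \<forall>k. Q1 k (r k) \<Longrightarrow> AE x in M. (\<lambda>k. \<Psi> k (r k) (u x)) \<longlonglongrightarrow> g x" by auto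
  from E.L0_diag[OF L0\<mu> f_lim] obtain Q2 where Q2: "\<And>k. eventually (Q2 k) sequentially"
    "\<And>r. \<forall>k. Q2 k (r k) \<Longrightarrow> AE y in \<mu>. (\<lambda>k. \<Psi> k (r k) y) \<longlonglongrightarrow> f y" by auto
  have "eventually (\<lambda>n. excess \<mu> (\<Psi> k n) G < ennreal (1 / real (Suc k))) sequentially" for k
    using \<Psi>e[of k, unfolded tendsto_0_ennreal_iff] by simp
  then have P: "eventually (\<lambda>n. Q2 k n \<and> excess \<mu> (\<Psi> k n) G < ennreal (1 / real (Suc k))) sequentially" for k
    using Q2(1) by (rule eventually_conj[rotated])
  \<comment> \<open>One index function serves the diagonals on X and on Y and the decay of the
    excess, so the same functions converge to f, converge along u to g, and have slopes bounded by G
    in the limit.\<close>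
  from eventually_choice[of Q1 "\<lambda>k n. Q2 k n \<and> excess \<mu> (\<Psi> k n) G < ennreal (1 / real (Suc k))", OF Q1(1) P]
  obtain r where r: "\<forall>k. Q1 k (r k)" "\<forall>k. Q2 k (r k)" "\<And>k. excess \<mu> (\<Psi> k (r k)) G < ennreal (1 / real (Suc k))"
    by auto
  define fs where "fs k = \<Psi> k (r k)" for k
  have fs: "fs k \<in> LIP_bd" for k by (simp add: fs_def \<Psi>bd)
  have fs_f: "AE y in \<mu>. (\<lambda>k. fs k y) \<longlonglongrightarrow> f y" unfolding fs_def by (rule Q2(2)[OF r(2)])
  have fs_g: "AE x in M. (\<lambda>k. fs k (u x)) \<longlonglongrightarrow> g x" unfolding fs_def by (rule Q1(2)[OF r(1)])
  have fs_e: "(\<lambda>k. excess \<mu> (fs k) G) \<longlonglongrightarrow> 0"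
    unfolding fs_def by (rule ennreal_squeeze_0[OF tendsto_ennreal_inverse_Suc less_imp_le[OF r(3)]])
  have fs_L2: "lip_a (fs k) \<in> L2 \<mu>" for k
    by (rule E.lip_a_L2[OF fs GL2]) (use less_trans[OF r(3) ennreal_less_top] in \<open>simp add: fs_def\<close>)
  have s0: "(\<lambda>k. sqn \<mu> (\<lambda>y. lip_a (fs k) y - G y)) \<longlonglongrightarrow> 0"
    by (rule E.lip_a_tendsto_min[OF Gmin fs fs_f fs_e fs_L2])
  have L2\<mu>: "L2_tendsto \<mu> (\<lambda>k. lip_a (fs k)) G" using s0 L2_tendsto_iff[OF fs_L2 GL2] by simp
  let ?r = "\<lambda>k x. lip_a (fs k) (u x) * D x" and ?R = "\<lambda>x. G (u x) * D x"
  have rL2: "?r k \<in> L2 M" for k by (rule comp_L2[OF fs_L2])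
  have RL2: "?R \<in> L2 M" by (rule comp_L2[OF GL2])
  have "sqn \<mu> (\<lambda>y. lip_a (fs k) y - G y) = sqn M (\<lambda>x. ?r k x - ?R x)" for k
  proof -
    have "(\<lambda>y. lip_a (fs k) y - G y) \<in> borel_measurable borel"
      using borel_measurable_lip_a[OF fs] by measurable
    from sqn_energy_image[OF this] show ?thesis by (simp add: left_diff_distrib)
  qed
  with s0 have t0: "(\<lambda>k. sqn M (\<lambda>x. ?r k x - ?R x)) \<longlonglongrightarrow> 0" by simp
  then have L2M: "L2_tendsto M ?r ?R" using L2_tendsto_iff[OF rL2 RL2] by simp
  have "sub_slope M g ?R"
  \<comment> \<open>The bound \<open>K k\<close> from folding makes the composition estimate
    applicable to each \<open>fs k\<close>, and the resulting sub-slopes converge in L2(m) by the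
    isometry.\<close>
  proof (rule sub_slope_closed[OF sub_slope_comp_bounded[OF u_S2_map fs _ rL2] gm _ RL2])
    show "\<bar>fs k y\<bar> \<le> K k" for k y by (simp add: fs_def \<Psi>K)
    show "AE x in M. (\<lambda>k. (fs k \<circ> u) x) \<longlonglongrightarrow> g x" using fs_g by simp
    \<comment> \<open>G is nonnegative only a.e. in \<mu>, so G o u is unrestricted on {D = 0};
      there the product is 0.\<close>
    show "AE x in M. 0 \<le> ?R x" using AE_energy_image[OF G0] D_nonneg
      by eventually_elim (auto simp: less_le)
    show "(\<lambda>k. sqn M (\<lambda>x. max 0 (?r k x - ?R x))) \<longlonglongrightarrow> 0"
      by (rule sqn_tendsto_mono[OF _ t0]) auto
  qed
  then have "g \<in> S2 M" and "AE x in M. slope M g x \<le> ?R x"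
    using S2_iff slope_le_sub_slope by auto
  moreover have "AE x in M. D x > 0 \<longrightarrow> g x = f (u x)"
    using AE_energy_image[OF fs_f] fs_g by eventually_elim (auto intro: LIMSEQ_unique)
  ultimately show ?thesis
    using fs fs_f fs_g L2\<mu> L2M unfolding G_def by blast
qed

end

theorem proposition3p3:
  fixes M :: "'a::polish_space measure"
    and u :: "'a \<Rightarrow> 'b::complete_space"
    and f :: "'b \<Rightarrow> real"
    and \<mu> :: "'b measure"
  assumes "radon_measure M" and "boundedly_finite M" and "emeasure M (space M) \<noteq> 0"
    and "u \<in> S2_map M"
    and "\<mu> = energy_image M u"
    and "f \<in> S2 \<mu>"
  shows "\<exists>g\<in>S2 M.
      (AE x in M. map_slope M u x > 0 \<longrightarrow> g x = f (u x)) \<and>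
      (AE x in M. slope M g x \<le> slope \<mu> f (u x) * map_slope M u x) \<and>
      (\<exists>fs. (\<forall>n. fs n \<in> LIP_bd) \<and>
         (AE y in \<mu>. (\<lambda>n. fs n y) \<longlonglongrightarrow> f y) \<and>
         L2_tendsto \<mu> (\<lambda>n. lip_a (fs n)) (slope \<mu> f) \<and>
         (AE x in M. (\<lambda>n. fs n (u x)) \<longlonglongrightarrow> g x) \<and>
         L2_tendsto M (\<lambda>n x. lip_a (fs n) (u x) * map_slope M u x)
                      (\<lambda>x. slope \<mu> f (u x) * map_slope M u x))"
proof -
  interpret S2_map_measure M u
    using assms by unfold_locales (auto simp: radon_measure_def)
  show ?thesis using composition_S2 assms(5,6) by blast
qed

end
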